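(* Let $\{\lambda_n,\mu_n\}_{n\ge 0}$ be a rate set with $\mu_0>0$ for which the series $\sum_{n=0}^\infty\left(\pi_n+\frac{1}{\lambda_n\pi_n}\right)$ converges, let $\mathcal{X}$ be the minimal birth-death process defined by this rate set, and let $\psi$ be the measure corresponding to $\mathcal{X}$. Then $\mu_0<1/m_{-1}(\psi)$, and the measure $\phi^{(a)}$ is indet(S) for every $a>0$. Moreover, for $a=(\mu_0m_{-1}(\psi))^{-1}-1$, $\phi^{(a)}$ is the measure corresponding to $\mathcal{X}^d$, the maximal process that is dual to $\mathcal{X}$, and hence $\phi^{(a)}$ is $N$-extremal.
   Context: Measures. A measure is a Borel probability measure on $\mathbb{R}$ with infinite support and finite moments of all positive orders. A measure with support in $[0,\infty)$ is det(S) if it is the only measure with support in $[0,\infty)$ having its moments, and indet(S) otherwise; det(H) and indet(H) are defined in the same way with $\mathbb{R}$ in place of $[0,\infty)$. If a measure with left-bounded support is indet(H), then among all measures on $\mathbb{R}$ with the same moments there is a unique one for which the minimum of the support is maximal; it is called the natural solution. A measure that is the solution of a determined moment problem is also called natural. For a measure $\psi$ on $[0,\infty)$ put $m_{-1}(\psi):=\int_{[0,\infty)}x^{-1}\psi(dx)$. $N$-extremal. Let $\nu$ be an indet(S) measure on $[0,\infty)$, let $p_n$ be the orthonormal polynomials with respect to $\nu$ (they depend only on the moments), and let $\rho(x):=\left\{\sum_{n\ge0}p_n^2(x)\right\}^{-1}>0$, $x\in\mathbb{R}$. A solution of the Stieltjes moment problem associated with $\nu$ (a measure on $[0,\infty)$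 with the same moments) that has positive mass at a point $x$ is $N$-extremal (Nevanlinna extremal) if and only if its mass at $x$ equals $\rho(x)$; thus the $N$-extremal solutions are those having mass exactly $\rho(x)$ at some point $x$. Rate sets. A rate set is a collection of numbers $\lambda_n>0$, $\mu_{n+1}>0$ ($n\ge 0$) and $\mu_0\ge 0$. Put $\pi_0:=1$ and $\pi_n:=\frac{\lambda_0\cdots\lambda_{n-1}}{\mu_1\cdots\mu_n}$ for $n\ge1$. The monic polynomials $P_n$ of the rate set are given by $P_0=1$, $P_1(x)=x-\lambda_0-\mu_0$, $P_n(x)=(x-\lambda_{n-1}-\mu_{n-1})P_{n-1}(x)-\lambda_{n-2}\mu_{n-1}P_{n-2}(x)$ for $n>1$. There is a unique natural measure on $[0,\infty)$ with respect to which the $P_n$ are orthogonal; it is the natural measure defined by the rate set. If $\mu_0>0$ this measure $\psi$ satisfies $m_{-1}(\psi)<\infty$ and $\mu_0\le 1/m_{-1}(\psi)$. Birth-death processes. Let $Q=(q_{ij})_{i,j\ge0}$ be the tridiagonal matrix with $q_{n,n+1}=\lambda_n$, $q_{n,n}=-(\lambda_n+\mu_n)$, $q_{n+1,n}=\mu_{n+1}$. A birth-death process with these rates (a $Q$-process) is identified with its matrix of transition functions $P(t)=(p_{ij}(t))_{i,j\ge 0}$, $t\ge0$, satisfying $p_{ij}(t)\ge0$, $\sum_j p_{ij}(t)\le1$, $P(s+t)=P(s)P(t)$, $P(0)=I$, and both $P'(t)=QP(t)$ and $P'(t)=P(t)Q$. (If $\mu_0>0$ the process may be absorbed in an extra state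 $-1$.) If $\sum_{n\ge 0}\left(\pi_n+\frac{1}{\lambda_n\pi_n}\right)<\infty$ there are infinitely many $Q$-processes, among which there are a unique minimal one, $P^{\min}$, and a unique maximal one, $P^{\max}$, characterized by $P^{\min}(t)\le P(t)\le P^{\max}(t)$ (componentwise, for all $t\ge0$) for every $Q$-process $P$. The measure corresponding to a $Q$-process is the unique measure $\psi$ on $[0,\infty)$ such that $$p_{ij}(t)=\frac{(-1)^{i+j}}{\lambda_0\cdots\lambda_{i-1}\,\mu_1\cdots\mu_j}\int_{[0,\infty)}e^{-xt}P_i(x)P_j(x)\,\psi(dx),\qquad i,j\ge0,\ t\ge0$$ (empty products are $1$); for the minimal process this is the natural measure defined by the rate set. Duality. The dual of the rate set $\{\lambda_n,\mu_n\}$ with $\mu_0>0$ is the rate set $\mu_0^d:=0$, $\lambda_n^d:=\mu_n$, $\mu_{n+1}^d:=\lambda_n$ ($n\ge0$). The series $\sum(\pi_n+1/(\lambda_n\pi_n))$ converges for a rate set if and only if the analogous series converges for its dual. When the series converges, the dual $\mathcal{X}^d$ of the minimal process $\mathcal{X}$ with rates $\{\lambda_n,\mu_n\}$ is the maximal process with rates $\{\lambda_n^d,\mu_n^d\}$. The measures $\phi^{(a)}$. For a natural measure $\psi$ on $[0,\infty)$ with $m_{-1}(\psi)<\infty$ define $\phi^{(0)}([0,x]):=\frac{1}{m_{-1}(\psi)}\int_{[0,x]}y^{-1}\psi(dy)$, $x\ge0$, and, for $a>0$, $\phi^{(a)}:=\frac{1}{a+1}\left(a\delta_0+\phi^{(0)}\right)$,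 where $\delta_0$ is the Dirac measure at $0$. *)

theory Defs
  imports "HOL-Probability.Probability" "HOL-Computational_Algebra.Polynomial"
begin

section \<open>Measures and the Stieltjes moment problem\<close>

definition msupport :: "real measure \<Rightarrow> real set" where
  "msupport M = {x. \<forall>U. open U \<and> x \<in> U \<longrightarrow> emeasure M U > 0}"

definition moment_measure :: "real measure \<Rightarrow> bool" where
  "moment_measure M \<longleftrightarrow>
     prob_space M \<and> sets M = sets borel \<and> infinite (msupport M) \<and>
     (\<forall>n. integrable M (\<lambda>x. x ^ n))"

definition stieltjes_measure :: "real measure \<Rightarrow> bool" where
  "stieltjes_measure M \<longleftrightarrow> moment_measure M \<and> msupport M \<subseteq> {0..}"

definition same_moments :: "real measure \<Rightarrow> real measure \<Rightarrow> bool" where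
  "same_moments M N \<longleftrightarrow> (\<forall>n. (\<integral>x. x ^ n \<partial>M) = (\<integral>x. x ^ n \<partial>N))"

definition stieltjes_solution :: "real measure \<Rightarrow> real measure \<Rightarrow> bool" where
  "stieltjes_solution \<nu> \<sigma> \<longleftrightarrow> stieltjes_measure \<sigma> \<and> same_moments \<sigma> \<nu>"

definition det_S :: "real measure \<Rightarrow> bool" where
  "det_S M \<longleftrightarrow> stieltjes_measure M \<and> (\<forall>N. stieltjes_solution M N \<longrightarrow> N = M)"

definition indet_S :: "real measure \<Rightarrow> bool" where
  "indet_S M \<longleftrightarrow> stieltjes_measure M \<and> \<not> det_S M"


section \<open>N-extremal solutions\<close>

text \<open>The orthonormal polynomials are made unique by a positive leading coefficient; the
  function \<open>rho\<close> below does not depend on this choice.\<close>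

definition orthonormal_sequence :: "real measure \<Rightarrow> (nat \<Rightarrow> real poly) \<Rightarrow> bool" where
  "orthonormal_sequence M p \<longleftrightarrow>
     (\<forall>n. degree (p n) = n \<and> lead_coeff (p n) > 0) \<and>
     (\<forall>m n. (\<integral>x. poly (p m) x * poly (p n) x \<partial>M) = (if m = n then 1 else 0))"

definition orthonormal_poly :: "real measure \<Rightarrow> nat \<Rightarrow> real poly" where
  "orthonormal_poly M = (THE p. orthonormal_sequence M p)"

text \<open>The series is taken in \<^typ>\<open>ennreal\<close>, so that divergence would give the value \<open>0\<close>.\<close>

definition rho :: "real measure \<Rightarrow> real \<Rightarrow> ennreal" where
  "rho \<nu> x = inverse (\<Sum>n. ennreal ((poly (orthonormal_poly \<nu> n) x)\<^sup>2))"

text \<open>\<open>N_extremal \<nu> \<sigma>\<close>: \<open>\<sigma>\<close> is an N-extremal solution of the (indeterminate)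
  Stieltjes moment problem associated with \<open>\<nu>\<close>.\<close>

definition N_extremal :: "real measure \<Rightarrow> real measure \<Rightarrow> bool" where
  "N_extremal \<nu> \<sigma> \<longleftrightarrow>
     indet_S \<nu> \<and> stieltjes_solution \<nu> \<sigma> \<and>
     (\<exists>x. emeasure \<sigma> {x} > 0 \<and> emeasure \<sigma> {x} = rho \<nu> x)"


section \<open>Rate sets\<close>

definition rate_set :: "(nat \<Rightarrow> real) \<Rightarrow> (nat \<Rightarrow> real) \<Rightarrow> bool" where
  "rate_set lam mu \<longleftrightarrow> (\<forall>n. lam n > 0) \<and> (\<forall>n. mu (Suc n) > 0) \<and> mu 0 \<ge> 0"

definition pi_coeff :: "(nat \<Rightarrow> real) \<Rightarrow> (nat \<Rightarrow> real) \<Rightarrow> nat \<Rightarrow> real" where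
  "pi_coeff lam mu n = (\<Prod>k<n. lam k) / (\<Prod>k=1..n. mu k)"

fun bd_poly :: "(nat \<Rightarrow> real) \<Rightarrow> (nat \<Rightarrow> real) \<Rightarrow> nat \<Rightarrow> real poly" where
  "bd_poly lam mu 0 = 1"
| "bd_poly lam mu (Suc 0) = [:- lam 0 - mu 0, 1:]"
| "bd_poly lam mu (Suc (Suc n)) =
     [:- lam (Suc n) - mu (Suc n), 1:] * bd_poly lam mu (Suc n)
     - smult (lam n * mu (Suc n)) (bd_poly lam mu n)"

definition dual_birth :: "(nat \<Rightarrow> real) \<Rightarrow> (nat \<Rightarrow> real) \<Rightarrow> nat \<Rightarrow> real" where
  "dual_birth lam mu n = mu n"

definition dual_death :: "(nat \<Rightarrow> real) \<Rightarrow> (nat \<Rightarrow> real) \<Rightarrow> nat \<Rightarrow> real" where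
  "dual_death lam mu n = (case n of 0 \<Rightarrow> 0 | Suc k \<Rightarrow> lam k)"


section \<open>Birth-death processes\<close>

definition Q_matrix :: "(nat \<Rightarrow> real) \<Rightarrow> (nat \<Rightarrow> real) \<Rightarrow> nat \<Rightarrow> nat \<Rightarrow> real" where
  "Q_matrix lam mu i j =
     (if j = Suc i then lam i
      else if j = i then - (lam i + mu i)
      else if i = Suc j then mu i
      else 0)"

text \<open>A process is a family \<open>P t i j\<close> of which only the part \<open>t \<ge> 0\<close> is constrained;
  derivatives at \<open>t = 0\<close> are one-sided. All series converge: those in the Kolmogorov
  equations have finitely many nonzero terms.\<close>

definition Q_process ::
  "(nat \<Rightarrow> real) \<Rightarrow> (nat \<Rightarrow> real) \<Rightarrow> (real \<Rightarrow> nat \<Rightarrow> nat \<Rightarrow> real) \<Rightarrow> bool" where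
  "Q_process lam mu P \<longleftrightarrow>
     (\<forall>t\<ge>0. \<forall>i j. P t i j \<ge> 0) \<and>
     (\<forall>t\<ge>0. \<forall>i. summable (\<lambda>j. P t i j) \<and> (\<Sum>j. P t i j) \<le> 1) \<and>
     (\<forall>s\<ge>0. \<forall>t\<ge>0. \<forall>i j. P (s + t) i j = (\<Sum>k. P s i k * P t k j)) \<and>
     (\<forall>i j. P 0 i j = (if i = j then 1 else 0)) \<and>
     (\<forall>t\<ge>0. \<forall>i j. ((\<lambda>s. P s i j) has_real_derivative (\<Sum>k. Q_matrix lam mu i k * P t k j))
        (at t within {0..})) \<and>
     (\<forall>t\<ge>0. \<forall>i j. ((\<lambda>s. P s i j) has_real_derivative (\<Sum>k. P t i k * Q_matrix lam mu k j))
        (at t within {0..}))"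

definition minimal_Q_process ::
  "(nat \<Rightarrow> real) \<Rightarrow> (nat \<Rightarrow> real) \<Rightarrow> (real \<Rightarrow> nat \<Rightarrow> nat \<Rightarrow> real) \<Rightarrow> bool" where
  "minimal_Q_process lam mu P \<longleftrightarrow>
     Q_process lam mu P \<and>
     (\<forall>R. Q_process lam mu R \<longrightarrow> (\<forall>t\<ge>0. \<forall>i j. P t i j \<le> R t i j))"

definition maximal_Q_process ::
  "(nat \<Rightarrow> real) \<Rightarrow> (nat \<Rightarrow> real) \<Rightarrow> (real \<Rightarrow> nat \<Rightarrow> nat \<Rightarrow> real) \<Rightarrow> bool" where
  "maximal_Q_process lam mu P \<longleftrightarrow>
     Q_process lam mu P \<and>
     (\<forall>R. Q_process lam mu R \<longrightarrow> (\<forall>t\<ge>0. \<forall>i j. R t i j \<le> P t i j))"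

text \<open>There is at most one such \<open>\<psi>\<close>, since the case \<open>i = j = 0\<close> prescribes its
  Laplace transform.\<close>

definition corresponding_measure ::
  "(nat \<Rightarrow> real) \<Rightarrow> (nat \<Rightarrow> real) \<Rightarrow> (real \<Rightarrow> nat \<Rightarrow> nat \<Rightarrow> real) \<Rightarrow> real measure \<Rightarrow> bool" where
  "corresponding_measure lam mu P \<psi> \<longleftrightarrow>
     stieltjes_measure \<psi> \<and>
     (\<forall>t\<ge>0. \<forall>i j. P t i j =
        (-1) ^ (i + j) / ((\<Prod>k<i. lam k) * (\<Prod>k=1..j. mu k)) *
        (LINT x:{0..}|\<psi>. exp (- x * t) * poly (bd_poly lam mu i) x * poly (bd_poly lam mu j) x))"


section \<open>The measures \<open>\<phi>\<^sup>(\<^sup>a\<^sup>)\<close>\<close>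

text \<open>In \<^typ>\<open>ennreal\<close> the integrand is \<open>\<infinity>\<close> at \<open>0\<close>, so an atom
  at \<open>0\<close> makes \<open>m_neg1\<close> infinite.\<close>

definition m_neg1 :: "real measure \<Rightarrow> ennreal" where
  "m_neg1 \<psi> = (\<integral>\<^sup>+x\<in>{0..}. inverse (ennreal x) \<partial>\<psi>)"

definition phi0 :: "real measure \<Rightarrow> real measure" where
  "phi0 \<psi> = density \<psi> (\<lambda>x. inverse (ennreal x) / m_neg1 \<psi> * indicator {0..} x)"

definition phi :: "real \<Rightarrow> real measure \<Rightarrow> real measure" where
  "phi a \<psi> = measure_of UNIV (sets borel)
     (\<lambda>A. (ennreal a * emeasure (return borel 0) A + emeasure (phi0 \<psi>) A) / ennreal (a + 1))"

lemma sets_phi [simp]: "sets (phi a \<psi>) = sets borel"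
  unfolding phi_def using sets.sigma_sets_eq[of "borel :: real measure"] by simp

lemma emeasure_phi:
  assumes "sets \<psi> = sets borel" and "A \<in> sets borel"
  shows "emeasure (phi a \<psi>) A =
    (ennreal a * indicator A 0 + emeasure (phi0 \<psi>) A) / ennreal (a + 1)"
proof -
  define m where "m = (\<lambda>A. (ennreal a * emeasure (return borel (0::real)) A
     + emeasure (phi0 \<psi>) A) / ennreal (a + 1))"
  have s: "sets (phi0 \<psi>) = sets borel" using assms by (simp add: phi0_def)
  have "countably_additive (sets borel) m"
  proof (rule countably_additiveI)
    fix F :: "nat \<Rightarrow> real set"
    assume F: "range F \<subseteq> sets borel" "disjoint_family F" "\<Union> (range F) \<in> sets borel"
    have 1: "(\<Sum>i. emeasure (return borel 0) (F i)) = emeasure (return borel 0) (\<Union> (range F))"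
      using F by (intro suminf_emeasure) auto
    have 2: "(\<Sum>i. emeasure (phi0 \<psi>) (F i)) = emeasure (phi0 \<psi>) (\<Union> (range F))"
      using F s by (intro suminf_emeasure) auto
    show "(\<Sum>i. m (F i)) = m (\<Union> (range F))"
      unfolding m_def divide_ennreal_def ennreal_suminf_multc
      by (simp add: 1[symmetric] 2[symmetric] suminf_add[symmetric])
  qed
  moreover have "positive (sets borel) m"
    by (simp add: positive_def m_def)
  ultimately have "emeasure (phi a \<psi>) A = m A"
    using assms(2) sets.sigma_algebra_axioms[of "borel :: real measure"]
    unfolding phi_def m_def[symmetric]
    by (intro emeasure_measure_of_sigma) auto
  then show ?thesis using assms(2) by (simp add: m_def)
qed

end

theory Submission
  imports Defs
begin

text \<open>
  Divided by the weights \<open>\<pi>\<^sub>j\<close>, a \<open>Q\<close>-process is a symmetric kernel solving the backward equation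
  in either index, and two such kernels are compared by Green's identity for the generator, whose
  only defect is a boundary term at \<open>N \<rightarrow> \<infinity>\<close>. For a spectral kernel the minimum principle yields
  positivity, and Green's identity the semigroup property, as soon as this boundary term vanishes.

  The minimal process is characterised by an absorbing boundary: a weak limit of Gauss quadrature
  measures has inverse moment at most \<open>S / (1 + \<mu>\<^sub>0 S)\<close>, where \<open>S = \<Sum> 1 / (\<lambda>\<^sub>n \<pi>\<^sub>n)\<close>, hence defines a
  \<open>Q\<close>-process, and minimality transfers the bound to \<open>\<psi>\<close>. Orthogonality gives the converse
  inequality, so \<open>m\<^sub>-\<^sub>1(\<psi>) = S / (1 + \<mu>\<^sub>0 S) < 1 / \<mu>\<^sub>0\<close> and \<open>\<integral> Q\<^sub>n(x)\<^sup>2 / x d\<psi> \<longrightarrow> 0\<close>. The latter makes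
  the flux of the dual kernel vanish at infinity, so the dual process is honest, and an honest
  process is maximal because the row sums of any competitor decrease in time. Its measure has mass
  \<open>1 / (1 + \<mu>\<^sub>0 S) = \<rho>(0)\<close> at the origin, while Gauss quadrature for the dual polynomials produces a
  second solution without mass there; mixing the two solutions shows that every \<open>\<phi>\<^sup>(\<^sup>a\<^sup>)\<close> is
  indeterminate.
\<close>

section \<open>Stieltjes measures\<close>

text \<open>The obstacle is that \<open>\<psi>\<close> is known only through the minimality of its
  process, an order property that says nothing direct about \<open>1 / x\<close>. The link is that
  the inverse moment is the time integral of the entry \<open>X t 0 0\<close>, so one competing
  process whose measure has a small inverse moment suffices. The constant comes from one formula. If
  \<open>m\<close> is the inverse moment and \<open>S_n\<close> the partial sum of \<open>S\<close>,
  orthogonality forces the integral of \<open>Q\<^sub>n / x\<close> to be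
  \<open>m - (1 - mu 0 * m) * S_n\<close>. It vanishes for a measure carried by the zeros of
  \<open>Q\<^sub>n\<close>, so that \<open>m = S_n / (1 + mu 0 * S_n)\<close>; it is nonnegative for
  every solution with finite inverse moment, which gives the reverse inequality in the limit. One
  boundary condition serves both processes: Green's identity leaves a product of flux and kernel,
  which tends to zero if the kernel decays and the flux is bounded (absorption), and also if the
  flux decays and the kernel is bounded (reflection). Duality exchanges the two cases, since the
  flux of the dual kernel is a difference of entries of the original kernel.\<close>

lemma AE_msupport:
  assumes "sets M = sets borel"
  shows "AE x in M. x \<in> msupport M"
proof -
  define F where "F = {U. open U \<and> emeasure M U = 0}"
  \<comment> \<open>By Lindelof, countably many null open sets already cover the complement of the
    support, so their union is still null.\<close>
  obtain F' where F': "F' \<subseteq> F" "countable F'" "\<Union>F' = \<Union>F"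
    by (rule Lindelof[of F]) (auto simp: F_def)
  have 1: "(\<Union>U\<in>F'. U) \<in> null_sets M"
    using F' assms by (intro null_sets_UN') (auto simp: F_def null_sets_def)
  have 2: "{x \<in> space M. x \<notin> msupport M} \<subseteq> (\<Union>U\<in>F'. U)"
    using F'(3) by (auto simp: F_def msupport_def zero_less_iff_neq_zero)
  show ?thesis
    by (rule AE_I'[OF 1 2])
qed

lemma integrable_poly:
  fixes M :: "real measure"
  assumes "\<And>n. integrable M (\<lambda>x. x ^ n)"
  shows "integrable M (poly p)"
  unfolding poly_altdef[abs_def] using assms by auto

lemma same_moments_poly:
  assumes "same_moments M N" "\<And>n. integrable M (\<lambda>x. x ^ n)" "\<And>n. integrable N (\<lambda>x. x ^ n)"
  shows "(\<integral>x. poly p x \<partial>M) = (\<integral>x. poly p x \<partial>N)"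
  using assms by (simp add: poly_altdef same_moments_def)

text \<open>Infinite support is replaced by a condition on moments: a finite support would be the
  zero set of a nonzero polynomial, whose square would then integrate to zero. In this form the
  property passes between measures with equal moments.\<close>

lemma stieltjes_measureI:
  assumes "prob_space M" "sets M = sets borel" "\<And>n. integrable M (\<lambda>x. x ^ n)"
    and nn: "AE x in M. 0 \<le> x"
    and pos: "\<And>p. p \<noteq> 0 \<Longrightarrow> (\<integral>x. (poly p x)\<^sup>2 \<partial>M) \<noteq> 0"
  shows "stieltjes_measure M"
proof -
  have "infinite (msupport M)"
  proof
    assume fin: "finite (msupport M)"
    define p where "p = (\<Prod>z\<in>msupport M. [:- z, 1:])"
    have "AE x in M. poly p x = 0"
      using AE_msupport[OF assms(2)]
      by eventually_elim (use fin in \<open>auto simp: p_def poly_prod\<close>)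
    then have "AE x in M. (poly p x)\<^sup>2 = 0"
      by auto
    then have "(\<integral>x. (poly p x)\<^sup>2 \<partial>M) = 0"
      by (rule integral_eq_zero_AE)
    moreover have "p \<noteq> 0" using fin by (auto simp: p_def)
    ultimately show False using pos by blast
  qed
  moreover have "msupport M \<subseteq> {0..}"
  proof
    fix x assume x: "x \<in> msupport M"
    have "AE y in M. \<not> y < 0"
      using nn by eventually_elim auto
    then have "emeasure M {..<0} = 0"
      using sets_eq_imp_space_eq[OF assms(2)]
      by (drule_tac emeasure_eq_0_AE) (auto simp: lessThan_def)
    with x have "x \<notin> {..<0}"
      unfolding msupport_def by (metis (mono_tags, lifting) less_irrefl mem_Collect_eq open_lessThan)
    then show "x \<in> {0..}"
      by auto
  qed
  ultimately show ?thesis using assms by (auto simp: stieltjes_measure_def moment_measure_def)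
qed

context
  fixes M :: "real measure"
  assumes st: "stieltjes_measure M"
begin

lemma stieltjes_prob: "prob_space M" 
  and stieltjes_sets [measurable_cong]: "sets M = sets borel"
  and stieltjes_space: "space M = UNIV"
  and stieltjes_power: "integrable M (\<lambda>x. x ^ n)"
  using st sets_eq_imp_space_eq[of M borel] by (auto simp: stieltjes_measure_def moment_measure_def)

lemma stieltjes_poly: "integrable M (poly p)"
  by (rule integrable_poly[OF stieltjes_power])

lemma stieltjes_nonneg: "AE x in M. 0 \<le> x"
  using AE_msupport[OF stieltjes_sets] by eventually_elim (use st in \<open>auto simp: stieltjes_measure_def\<close>)

text \<open>The complement of a finite root set is open; if it were null, the support would lie in
  the root set and be finite.\<close>

lemma stieltjes_AE_poly_eq_0:
  assumes "AE x in M. poly p x = 0"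
  shows "p = 0"
proof (rule ccontr)
  assume p: "p \<noteq> 0"
  define Z where "Z = {x. poly p x = 0}"
  have fin: "finite Z" using p poly_roots_finite by (simp add: Z_def)
  have "AE x in M. \<not> poly p x \<noteq> 0"
    using assms by eventually_elim auto
  then have "emeasure M (- Z) = 0"
    using stieltjes_space by (drule_tac emeasure_eq_0_AE) (auto simp: Z_def Compl_eq)
  moreover have "open (- Z)"
    using fin by (simp add: finite_imp_closed open_Compl)
  ultimately have "x \<notin> msupport M" if "x \<notin> Z" for x
    using that unfolding msupport_def by fastforce
  then have "msupport M \<subseteq> Z"
    by blast
  with fin st show False
    by (auto simp: stieltjes_measure_def moment_measure_def dest: finite_subset)
qed

lemma stieltjes_square_pos:
  assumes "p \<noteq> 0"
  shows "(\<integral>x. (poly p x)\<^sup>2 \<partial>M) > 0"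
proof -
  have i: "integrable M (\<lambda>x. (poly p x)\<^sup>2)"
    using stieltjes_poly[of "p\<^sup>2"] by (simp add: poly_power[abs_def])
  have "(\<integral>x. (poly p x)\<^sup>2 \<partial>M) \<noteq> 0"
    using integral_nonneg_eq_0_iff_AE[OF i] stieltjes_AE_poly_eq_0[of p] assms by auto
  moreover have "(\<integral>x. (poly p x)\<^sup>2 \<partial>M) \<ge> 0" by simp
  ultimately show ?thesis by linarith
qed

end

section \<open>Gauss quadrature and weak limits\<close>

text \<open>The intended \<open>Z\<close> consists of the positive roots of odd multiplicity.
  Splitting off one root \<open>z\<close> toggles its membership in \<open>Z\<close>: it is removed
  if the quotient already has it, and otherwise added, which contributes the harmless factor
  \<open>(x - z)\<^sup>2\<close>. Without positive roots the intermediate value theorem excludes a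
  sign change.\<close>

lemma poly_sign_factor:
  fixes p :: "real poly"
  assumes "p \<noteq> 0"
  shows "\<exists>Z. finite Z \<and> (\<forall>z\<in>Z. 0 < z \<and> poly p z = 0) \<and>
    ((\<forall>x\<ge>0. 0 \<le> poly (p * (\<Prod>z\<in>Z. [:- z, 1:])) x) \<or>
     (\<forall>x\<ge>0. poly (p * (\<Prod>z\<in>Z. [:- z, 1:])) x \<le> 0))"
  using assms
proof (induction "degree p" arbitrary: p rule: less_induct)
  case less
  show ?case
  proof (cases "\<exists>z>0. poly p z = 0")
    case False
    have "\<not> (poly p x < 0 \<and> 0 < poly p y)" if "0 \<le> x" "0 \<le> y" for x y
    proof
      assume *: "poly p x < 0 \<and> 0 < poly p y"
      then have "x < y \<or> y < x" by (cases x y rule: linorder_cases) auto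
      with * that False show False
        using poly_IVT_pos[of x y p] poly_IVT_neg[of y x p] by fastforce
    qed
    then have "(\<forall>x\<ge>0. 0 \<le> poly p x) \<or> (\<forall>x\<ge>0. poly p x \<le> 0)"
      by (meson not_less)
    then show ?thesis by (intro exI[of _ "{}"]) auto
  next
    case True
    then obtain z p' where z: "z > 0" "p = [:- z, 1:] * p'"
      using poly_eq_0_iff_dvd[of p] by (auto elim: dvdE)
    with less.prems have p': "p' \<noteq> 0" by auto
    have "degree p' < degree p"
      unfolding z using p' by (subst degree_mult_eq) auto
    from less.hyps[OF this p'] obtain Z where Z: "finite Z" "\<And>z. z \<in> Z \<Longrightarrow> 0 < z \<and> poly p' z = 0"
      and sgn: "(\<forall>x\<ge>0. 0 \<le> poly (p' * (\<Prod>z\<in>Z. [:- z, 1:])) x) \<or>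
        (\<forall>x\<ge>0. poly (p' * (\<Prod>z\<in>Z. [:- z, 1:])) x \<le> 0)" by blast
    show ?thesis
    proof (cases "z \<in> Z")
      case True
      have "p * (\<Prod>z\<in>Z - {z}. [:- z, 1:]) = p' * (\<Prod>z\<in>Z. [:- z, 1:])"
        unfolding z prod.remove[OF Z(1) True] by (simp only: mult_ac)
      then show ?thesis
        using Z sgn z by (intro exI[of _ "Z - {z}"]) auto
    next
      case False
      have "poly (p * (\<Prod>z\<in>insert z Z. [:- z, 1:])) x
          = (x - z)\<^sup>2 * poly (p' * (\<Prod>z\<in>Z. [:- z, 1:])) x" for x
        unfolding prod.insert[OF Z(1) False] z by (simp add: power2_eq_square algebra_simps)
      then have "(\<forall>x\<ge>0. 0 \<le> poly (p * (\<Prod>z\<in>insert z Z. [:- z, 1:])) x) \<or>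
        (\<forall>x\<ge>0. poly (p * (\<Prod>z\<in>insert z Z. [:- z, 1:])) x \<le> 0)"
        using sgn by (simp only: zero_le_mult_iff mult_le_0_iff) auto
      then show ?thesis
        using Z z by (intro exI[of _ "insert z Z"]) auto
    qed
  qed
qed

lemma
  assumes "\<And>p. integrable M (poly p :: real \<Rightarrow> real)"
  shows integral_poly_add: "(\<integral>x. poly (p + q) x \<partial>M) = (\<integral>x. poly p x \<partial>M) + (\<integral>x. poly q x \<partial>M)"
    and integral_poly_diff: "(\<integral>x. poly (p - q) x \<partial>M) = (\<integral>x. poly p x \<partial>M) - (\<integral>x. poly q x \<partial>M)"
    and integral_poly_smult: "(\<integral>x. poly (smult c p) x \<partial>M) = c * (\<integral>x. poly p x \<partial>M)"
    and integral_poly_sum: "(\<integral>x. poly (\<Sum>i\<in>A. f i) x \<partial>M) = (\<Sum>i\<in>A. \<integral>x. poly (f i) x \<partial>M)"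
  using assms by (simp_all add: poly_sum)

text \<open>Subtracting a multiple of \<open>q k\<close> cancels the leading term of a polynomial of
  degree \<open>k\<close>, so the \<open>q k\<close> span all lower degrees.\<close>

lemma orthogonal_lower_degree:
  fixes q :: "nat \<Rightarrow> real poly"
  assumes int: "\<And>p. integrable M (poly p)"
    and deg: "\<And>k. k \<le> n \<Longrightarrow> degree (q k) = k" and "q 0 \<noteq> 0"
    and orth: "\<And>k. k < n \<Longrightarrow> (\<integral>x. poly (q n * q k) x \<partial>M) = 0"
    and "degree p < n"
  shows "(\<integral>x. poly (q n * p) x \<partial>M) = 0"
proof -
  have "(\<integral>x. poly (q n * p) x \<partial>M) = 0" if "k \<le> n" "p = 0 \<or> degree p < k" for k p
    using that
  proof (induction k arbitrary: p)
    case (Suc k)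
    then show ?case
    proof (cases "p \<noteq> 0 \<and> degree p = k")
      case True
      define c where "c = lead_coeff p / lead_coeff (q k)"
      have qk: "q k \<noteq> 0" using deg[of k] Suc.prems assms(3) by (cases k) auto
      have "coeff (p - smult c (q k)) k = 0"
        using True qk deg[of k] Suc.prems leading_coeff_0_iff[of "q k"] by (simp add: c_def)
      moreover have "degree (p - smult c (q k)) \<le> k"
        using True deg[of k] Suc.prems by (intro degree_diff_le) auto
      ultimately have "p - smult c (q k) = 0 \<or> degree (p - smult c (q k)) < k"
        by (metis le_neq_implies_less leading_coeff_0_iff)
      from Suc.IH[OF _ this] Suc.prems have "(\<integral>x. poly (q n * (p - smult c (q k))) x \<partial>M) = 0"
        by simp
      then have "(\<integral>x. poly (q n * p - smult c (q n * q k)) x \<partial>M) = 0"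
        by (simp only: right_diff_distrib mult_smult_right)
      then show ?thesis
        using orth[of k] Suc.prems by (simp only: integral_poly_diff[OF int] integral_poly_smult[OF int])
    qed auto
  qed (simp add: poly_0[abs_def])
  from this[of n p] assms show ?thesis by simp
qed

lemma borel_measurable_poly [measurable]: "poly p \<in> borel_measurable (borel :: real measure)"
  by (intro borel_measurable_continuous_onI continuous_intros)

text \<open>The nodes are the zeros of \<open>q\<close>, which turn out to be simple and positive,
  and the weights are the integrals of the Lagrange polynomials. Division by \<open>q\<close>
  doubles the degree of exactness, because orthogonality annihilates the quotient part.\<close>

lemma gauss_quadrature:
  assumes st: "stieltjes_measure M" and dq: "degree q = n" and n: "n > 0"
    and orth: "\<And>p. degree p < n \<Longrightarrow> (\<integral>x. poly (q * p) x \<partial>M) = 0"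
  obtains G where "prob_space G" "sets G = sets (borel :: real measure)"
    "AE x in G. 0 < x \<and> poly q x = 0" "\<And>p. integrable G (poly p)"
    "\<And>p. degree p < 2 * n \<Longrightarrow> (\<integral>x. poly p x \<partial>G) = (\<integral>x. poly p x \<partial>M)"
proof -
  note int = stieltjes_poly[OF st]
  interpret M: prob_space M by (rule stieltjes_prob[OF st])
  have q0: "q \<noteq> 0" using dq n by auto
  obtain Z where Z: "finite Z" "\<And>z. z \<in> Z \<Longrightarrow> 0 < z \<and> poly q z = 0"
    and sgn: "(\<forall>x\<ge>0. 0 \<le> poly (q * (\<Prod>z\<in>Z. [:- z, 1:])) x) \<or>
        (\<forall>x\<ge>0. poly (q * (\<Prod>z\<in>Z. [:- z, 1:])) x \<le> 0)"
    using poly_sign_factor[OF q0] by blast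
  define r where "r = (\<Prod>z\<in>Z. [:- z, 1:])"
  have r0: "r \<noteq> 0" using Z(1) by (auto simp: r_def)
  have dr: "degree r = card Z"
    unfolding r_def by (subst degree_prod_sum_eq) auto
  \<comment> \<open>With fewer than \<open>n\<close> sign changes, \<open>q * r\<close> would have
    constant sign on the support, yet integrate to zero by orthogonality; then it would vanish
    almost everywhere.\<close>
  have "\<not> card Z < n"
  proof
    assume "card Z < n"
    then have z: "(\<integral>x. poly (q * r) x \<partial>M) = 0" using orth dr by simp
    have "AE x in M. poly (q * r) x = 0"
      using sgn
    proof
      assume "\<forall>x\<ge>0. 0 \<le> poly (q * (\<Prod>z\<in>Z. [:- z, 1:])) x"
      then have "AE x in M. 0 \<le> poly (q * r) x"
        using stieltjes_nonneg[OF st] by (auto simp: r_def)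
      then show ?thesis using integral_nonneg_eq_0_iff_AE[OF int] z by blast
    next
      assume "\<forall>x\<ge>0. poly (q * (\<Prod>z\<in>Z. [:- z, 1:])) x \<le> 0"
      then have "AE x in M. 0 \<le> poly (- (q * r)) x"
        using stieltjes_nonneg[OF st] by (auto simp: r_def)
      moreover have "(\<integral>x. poly (- (q * r)) x \<partial>M) = 0"
        using z integral_poly_smult[OF int, of "-1" "q * r"] by simp
      ultimately have "AE x in M. poly (- (q * r)) x = 0"
        using integral_nonneg_eq_0_iff_AE[OF int] by blast
      then show ?thesis by simp
    qed
    from stieltjes_AE_poly_eq_0[OF st this] q0 r0 show False by simp
  qed
  moreover have "card Z \<le> degree q"
    using card_mono[of "{x. poly q x = 0}" Z] poly_roots_finite[OF q0] Z card_poly_roots_bound[OF q0]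
    by fastforce
  ultimately have card: "card Z = n" using dq by simp
  define l where "l z = (\<Prod>y\<in>Z - {z}. smult (1 / (z - y)) [:- y, 1:])" for z
  have l_val: "poly (l z) y = (if y = z then 1 else 0)" if "z \<in> Z" "y \<in> Z" for y z
  proof (cases "y = z")
    case True
    have "poly (l z) z = (\<Prod>y\<in>Z - {z}. 1)"
      unfolding l_def poly_prod by (intro prod.cong) (auto simp: diff_divide_distrib[symmetric])
    with True show ?thesis by simp
  next
    case False
    with that Z(1) show ?thesis
      unfolding l_def poly_prod by (auto intro!: bexI[of _ y])
  qed
  have l_deg: "degree (l z) \<le> n - 1" if "z \<in> Z" for z
  proof -
    have "degree (l z) \<le> (\<Sum>y\<in>Z - {z}. degree (smult (1 / (z - y)) [:- y, 1:]))"
      using degree_prod_sum_le[of "Z - {z}" "\<lambda>y. smult (1 / (z - y)) [:- y, 1:]"] Z(1)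
      by (simp only: l_def o_def finite_Diff)
    also have "\<dots> \<le> (\<Sum>y\<in>Z - {z}. 1)"
      by (intro sum_mono) auto
    finally show ?thesis using that Z(1) card by simp
  qed
  define w where "w z = (\<integral>x. poly (l z) x \<partial>M)" for z
  \<comment> \<open>Modulo \<open>q\<close>, a polynomial is its Lagrange interpolant at the nodes;
    the degree bound \<open>2 * n\<close> keeps the quotient \<open>p div q\<close> below degree
    \<open>n\<close>.\<close>
  have exact: "(\<integral>x. poly p x \<partial>M) = (\<Sum>z\<in>Z. w z * poly p z)" if p: "degree p < 2 * n" for p
  proof -
    have "p div q = 0 \<or> degree (p div q) < n"
    proof (rule disjCI)
      assume nz: "\<not> degree (p div q) < n"
      show "p div q = 0"
      proof -
        have "degree (p div q * q) \<le> max (degree p) (degree (p mod q))"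
          using degree_diff_le_max[of p "p mod q"] by (simp add: minus_mod_eq_div_mult)
        moreover have "degree (p mod q) \<le> n"
          using degree_mod_less'[of q p] dq q0 by (cases "p mod q = 0") auto
        ultimately show ?thesis
          using degree_mult_eq[of "p div q" q] q0 nz dq p by fastforce
      qed
    qed
    then have 1: "(\<integral>x. poly (q * (p div q)) x \<partial>M) = 0"
      using orth by (auto simp del: poly_mult)
    have "p mod q = (\<Sum>z\<in>Z. smult (poly p z) (l z))" (is "_ = ?R")
    proof (rule poly_eqI_degree[of Z])
      fix y assume y: "y \<in> Z"
      have "poly p y = poly (q * (p div q) + p mod q) y"
        by simp
      also have "\<dots> = poly (p mod q) y"
        by (simp only: poly_add poly_mult conjunct2[OF Z(2)[OF y]] mult_zero_left add_0_left)
      finally have "poly (p mod q) y = poly p y" ..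
      moreover have "poly ?R y = poly p y"
      proof -
        have "poly ?R y = (\<Sum>z\<in>Z. if y = z then poly p z else 0)"
          using y by (auto simp: poly_sum l_val intro!: sum.cong)
        then show ?thesis using Z(1) y by simp
      qed
      ultimately show "poly (p mod q) y = poly ?R y" by simp
    next
      show "degree (p mod q) < card Z"
        using degree_mod_less[OF q0, of p] dq n card by auto
      have "degree ?R \<le> n - 1"
        using Z(1) l_deg by (intro degree_sum_le) (auto intro: order.trans[OF degree_smult_le])
      then show "degree ?R < card Z" using card n by simp
    qed
    then have 2: "(\<integral>x. poly (p mod q) x \<partial>M) = (\<Sum>z\<in>Z. w z * poly p z)"
      by (simp only: integral_poly_sum[OF int] integral_poly_smult[OF int] w_def mult.commute)
    have "(\<integral>x. poly p x \<partial>M) = (\<integral>x. poly (q * (p div q) + p mod q) x \<partial>M)"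
      by simp
    also have "\<dots> = (\<Sum>z\<in>Z. w z * poly p z)"
      unfolding integral_poly_add[OF int] 1 2 by simp
    finally show ?thesis .
  qed
  \<comment> \<open>Exactness applies to the square of a Lagrange polynomial, of degree at most
    \<open>2 * (n - 1)\<close>, and its quadrature sum is the single weight
    \<open>w z\<close>.\<close>
  have w_pos: "0 < w z" if z: "z \<in> Z" for z
  proof -
    have "degree (l z ^ 2) \<le> 2 * (n - 1)"
      using degree_power_le[of "l z" 2] l_deg[OF z] by simp
    then have "(\<integral>x. poly (l z ^ 2) x \<partial>M) = (\<Sum>y\<in>Z. w y * poly (l z ^ 2) y)"
      using n by (intro exact) auto
    also have "\<dots> = (\<Sum>y\<in>Z. if y = z then w y else 0)"
      using z by (intro sum.cong) (auto simp: l_val poly_power)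
    also have "\<dots> = w z" using z Z(1) by simp
    finally have "w z = (\<integral>x. (poly (l z) x)\<^sup>2 \<partial>M)" by (simp add: poly_power)
    moreover have "l z \<noteq> 0" using l_val[OF z z] by auto
    ultimately show ?thesis using stieltjes_square_pos[OF st] by simp
  qed
  \<comment> \<open>The discrete measure lives on the finite space \<open>Z\<close>; pushing it
    forward gives it the Borel sets of the line.\<close>
  define P where "P = point_measure Z (\<lambda>z. ennreal (w z))"
  define G where "G = distr P borel (\<lambda>x. x)"
  have m: "(\<lambda>x. x) \<in> measurable P borel"
    by (auto simp: P_def point_measure_def)
  have intP: "integrable P f" for f :: "real \<Rightarrow> real"
    unfolding P_def by (rule integrable_point_measure_finite[OF Z(1)])
  have intG: "integrable G (poly p)" for p
    unfolding G_def by (subst integrable_distr_eq[OF m borel_measurable_poly]) (rule intP)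
  have G: "(\<integral>x. poly p x \<partial>G) = (\<Sum>z\<in>Z. w z * poly p z)" for p
    unfolding G_def using Z(1) w_pos
    by (subst integral_distr[OF m borel_measurable_poly])
      (simp add: P_def lebesgue_integral_point_measure_finite less_imp_le)
  have "emeasure P Z = (\<Sum>z\<in>Z. ennreal (w z))"
    unfolding P_def by (rule emeasure_point_measure_finite[OF Z(1)]) simp
  also have "\<dots> = ennreal (\<Sum>z\<in>Z. w z)"
    using w_pos by (intro sum_ennreal) (auto intro: less_imp_le)
  also have "(\<Sum>z\<in>Z. w z) = 1"
    using exact[of 1] n M.prob_space by simp
  finally have "emeasure P (space P) = 1" by (simp add: P_def space_point_measure)
  then have "prob_space P" by (rule prob_spaceI)
  then have "prob_space G" unfolding G_def by (rule prob_space.prob_space_distr) (rule m)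
  moreover have "AE x in G. 0 < x \<and> poly q x = 0"
    unfolding G_def using Z m
    by (subst AE_distr_iff) (auto simp: P_def space_point_measure intro!: AE_I2)
  ultimately show ?thesis
    using intG exact G by (intro that[of G]) (auto simp: G_def)
qed

lemma weak_conv_integral:
  fixes f :: "real \<Rightarrow> real"
  assumes "weak_conv_m G N" "\<And>n. real_distribution (G n)" "real_distribution N"
    and "\<And>x. isCont f x" "\<And>x. \<bar>f x\<bar> \<le> B"
  shows "(\<lambda>n. integral\<^sup>L (G n) f) \<longlonglongrightarrow> integral\<^sup>L N f"
  using weak_conv_imp_integral_bdd_continuous_conv[of G N f B] assms by simp

text \<open>Weak convergence controls only bounded functions, so powers are truncated at height
  \<open>K\<close>. The truncation error of the moment of order \<open>k\<close> is at most the
  moment of order \<open>2 * k\<close> divided by \<open>K\<close>, and this is uniform along the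
  sequence because those moments are eventually constant.\<close>

lemma weak_limit_moments:
  assumes st: "stieltjes_measure M"
    and G: "\<And>n. real_distribution (G n)" "\<And>n. AE x in G n. 0 \<le> x"
      "\<And>n k. integrable (G n) (\<lambda>x. x ^ k)"
    and mom: "\<And>k. eventually (\<lambda>n. (\<integral>x. x ^ k \<partial>G n) = (\<integral>x. x ^ k \<partial>M)) sequentially"
    and N: "weak_conv_m G N" "real_distribution N"
  shows "stieltjes_solution M N"
proof -
  interpret N: real_distribution N by (rule N(2))
  note lim = weak_conv_integral[OF N(1) G(1) N(2)]
  define m where "m k = (\<integral>x. x ^ k \<partial>M)" for k
  have nn: "AE x in N. 0 \<le> x"
  proof -
    \<comment> \<open>A bounded continuous test function that vanishes exactly on the nonnegative
      half line.\<close>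
    let ?f = "\<lambda>x::real. min 1 (max 0 (- x))"
    have "(\<lambda>n. integral\<^sup>L (G n) ?f) \<longlonglongrightarrow> integral\<^sup>L N ?f"
      by (rule lim[where B = 1]) (auto intro!: continuous_intros)
    moreover have "integral\<^sup>L (G n) ?f = 0" for n
      by (rule integral_eq_zero_AE) (use G(2)[of n] in eventually_elim, auto)
    ultimately have "integral\<^sup>L N ?f = 0"
      by (simp add: LIMSEQ_const_iff)
    moreover have "integrable N ?f"
      by (rule N.integrable_const_bound[where B = 1]) auto
    ultimately have "AE x in N. ?f x = 0"
      by (subst (asm) integral_nonneg_eq_0_iff_AE) auto
    then show ?thesis by eventually_elim (auto simp: min_def max_def split: if_splits)
  qed
  define h where "h k K x = min K (\<bar>x\<bar> ^ k)" for k and K x :: real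
  have h_cont: "isCont (h k K) x" for k K x
    unfolding h_def by (intro continuous_intros)
  have h_bd: "\<bar>h k K x\<bar> \<le> K" if "0 \<le> K" for k K x
    using that by (auto simp: h_def min_def)
  have h_lim: "(\<lambda>n. integral\<^sup>L (G n) (h k K)) \<longlonglongrightarrow> integral\<^sup>L N (h k K)" if "0 \<le> K" for k K
    using h_bd[OF that] by (intro lim h_cont)
  have hN: "integrable N (h k K)" if "0 \<le> K" for k K
    using h_bd[OF that] by (intro N.integrable_const_bound[where B = K]) (auto simp: h_def[abs_def])
  have hG: "integrable (G n) (h k K)" if "0 \<le> K" for k K n
  proof -
    interpret G: real_distribution "G n" by (rule G(1))
    show ?thesis
      using h_bd[OF that] by (intro G.integrable_const_bound[where B = K]) (auto simp: h_def[abs_def])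
  qed
  have h_le: "integral\<^sup>L N (h k K) \<le> m k" if K: "0 \<le> K" for k K
  proof (rule LIMSEQ_le_const2[OF h_lim[OF K]])
    have "integral\<^sup>L (G n) (h k K) \<le> (\<integral>x. x ^ k \<partial>G n)" for n
      by (intro integral_mono_AE hG[OF K] G(3)) (use G(2)[of n] in eventually_elim, auto simp: h_def)
    then show "\<exists>n0. \<forall>n\<ge>n0. integral\<^sup>L (G n) (h k K) \<le> m k"
      using mom[of k] unfolding eventually_sequentially m_def by metis
  qed
  have pw: "integrable N (\<lambda>x. x ^ k)" for k
  proof -
    have "(\<integral>\<^sup>+x. ennreal (\<bar>x\<bar> ^ k) \<partial>N) = (\<integral>\<^sup>+x. (SUP j. ennreal (h k (real j) x)) \<partial>N)"
    proof (rule nn_integral_cong)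
      fix x :: real
      have "(\<lambda>j. ennreal (h k (real j) x)) \<longlonglongrightarrow> ennreal (\<bar>x\<bar> ^ k)"
      proof (rule tendsto_eventually)
        obtain j0 where "\<bar>x\<bar> ^ k \<le> real j0" using real_arch_simple by blast
        then show "\<forall>\<^sub>F j in sequentially. ennreal (h k (real j) x) = ennreal (\<bar>x\<bar> ^ k)"
          unfolding eventually_sequentially h_def by (intro exI[of _ j0]) (auto simp: min_def)
      qed
      moreover have "incseq (\<lambda>j. ennreal (h k (real j) x))"
        by (auto simp: incseq_def h_def intro!: ennreal_leI)
      ultimately show "ennreal (\<bar>x\<bar> ^ k) = (SUP j. ennreal (h k (real j) x))"
        using LIMSEQ_SUP LIMSEQ_unique by blast
    qed
    also have "\<dots> = (SUP j. \<integral>\<^sup>+x. ennreal (h k (real j) x) \<partial>N)"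
      by (rule nn_integral_monotone_convergence_SUP)
        (auto simp: incseq_def le_fun_def h_def intro!: ennreal_leI)
    also have "\<dots> \<le> ennreal (m k)"
    proof (rule SUP_least)
      fix j
      have "(\<integral>\<^sup>+x. ennreal (h k (real j) x) \<partial>N) = ennreal (integral\<^sup>L N (h k (real j)))"
        by (rule nn_integral_eq_integral[OF hN]) (auto simp: h_def)
      also have "\<dots> \<le> ennreal (m k)" by (intro ennreal_leI h_le) auto
      finally show "(\<integral>\<^sup>+x. ennreal (h k (real j) x) \<partial>N) \<le> ennreal (m k)" .
    qed
    finally have "(\<integral>\<^sup>+x. ennreal (norm (x ^ k)) \<partial>N) < \<infinity>"
      by (simp add: power_abs le_less_trans)
    then show ?thesis by (intro integrableI_bounded) auto
  qed
  \<comment> \<open>Where the truncation is active, \<open>x ^ k\<close> exceeds \<open>K\<close>,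
    hence \<open>x ^ k \<le> x ^ k * (x ^ k / K)\<close>.\<close>
  have tail: "\<bar>x ^ k - h k K x\<bar> \<le> x ^ (2 * k) / K" if "0 < K" "0 \<le> x" for k K x
  proof (cases "x ^ k \<le> K")
    case False
    then have "x ^ k * K \<le> x ^ k * x ^ k"
      using that by (intro mult_left_mono) auto
    then have "x ^ k \<le> x ^ (2 * k) / K"
      using that by (simp add: pos_le_divide_eq mult_2 power_add)
    with False that show ?thesis by (auto simp: h_def)
  qed (use that in \<open>auto simp: h_def\<close>)
  have tail_int: "\<bar>(\<integral>x. x ^ k \<partial>L) - integral\<^sup>L L (h k K)\<bar> \<le> (\<integral>x. x ^ (2 * k) \<partial>L) / K"
    if "0 < K" "\<And>k. integrable L (\<lambda>x. x ^ k)" "integrable L (h k K)" "AE x in L. 0 \<le> x" for k K L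
  proof -
    have "\<bar>(\<integral>x. x ^ k \<partial>L) - integral\<^sup>L L (h k K)\<bar> = \<bar>\<integral>x. x ^ k - h k K x \<partial>L\<bar>"
      by (subst Bochner_Integration.integral_diff) (intro that refl)+
    also have "\<dots> \<le> (\<integral>x. \<bar>x ^ k - h k K x\<bar> \<partial>L)" by (rule integral_abs_bound)
    also have "\<dots> \<le> (\<integral>x. x ^ (2 * k) / K \<partial>L)"
    proof (rule integral_mono_AE)
      show "AE x in L. \<bar>x ^ k - h k K x\<bar> \<le> x ^ (2 * k) / K"
        using that(4) by eventually_elim (rule tail[OF that(1)])
          show "integrable L (\<lambda>x. \<bar>x ^ k - h k K x\<bar>)"
        by (intro integrable_abs Bochner_Integration.integrable_diff that)
      show "integrable L (\<lambda>x. x ^ (2 * k) / K)"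
        by (intro integrable_divide_zero that)
    qed
    finally show ?thesis by simp
  qed
  have mom_eq: "(\<integral>x. x ^ k \<partial>N) = m k" for k
  proof -
    define A where "A = (\<integral>x. x ^ (2 * k) \<partial>N) + m (2 * k)"
    have bd: "\<bar>(\<integral>x. x ^ k \<partial>N) - m k\<bar> \<le> A / K" if K: "0 < K" for K
    proof (rule LIMSEQ_le_const)
      have "(\<lambda>n. \<bar>integral\<^sup>L N (h k K) - integral\<^sup>L (G n) (h k K)\<bar> + A / K) \<longlonglongrightarrow>
          \<bar>integral\<^sup>L N (h k K) - integral\<^sup>L N (h k K)\<bar> + A / K"
        using K by (intro tendsto_intros h_lim) auto
      then show "(\<lambda>n. \<bar>integral\<^sup>L N (h k K) - integral\<^sup>L (G n) (h k K)\<bar> + A / K) \<longlonglongrightarrow> A / K"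
        by simp
      have ev: "eventually (\<lambda>n. \<bar>(\<integral>x. x ^ k \<partial>N) - m k\<bar> \<le>
          \<bar>integral\<^sup>L N (h k K) - integral\<^sup>L (G n) (h k K)\<bar> + A / K) sequentially"
        using mom[of k] mom[of "2 * k"]
      proof eventually_elim
        case (elim n)
        have "\<bar>(\<integral>x. x ^ k \<partial>N) - integral\<^sup>L N (h k K)\<bar> \<le> (\<integral>x. x ^ (2 * k) \<partial>N) / K"
          using K by (intro tail_int pw hN nn) auto
        moreover have "\<bar>(\<integral>x. x ^ k \<partial>G n) - integral\<^sup>L (G n) (h k K)\<bar> \<le> (\<integral>x. x ^ (2 * k) \<partial>G n) / K"
          using K by (intro tail_int G(2,3) hG) auto
        ultimately show ?case
          unfolding elim A_def m_def add_divide_distrib by linarith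
      qed
      then show "\<exists>n0. \<forall>n\<ge>n0. \<bar>(\<integral>x. x ^ k \<partial>N) - m k\<bar> \<le>
          \<bar>integral\<^sup>L N (h k K) - integral\<^sup>L (G n) (h k K)\<bar> + A / K"
        unfolding eventually_sequentially .
    qed
    have "(\<lambda>j. A / real j) \<longlonglongrightarrow> 0" by (rule lim_const_over_n)
    then have "\<bar>(\<integral>x. x ^ k \<partial>N) - m k\<bar> \<le> 0"
      by (rule LIMSEQ_le_const) (auto intro!: exI[of _ 1] bd)
    then show ?thesis by simp
  qed
  have sm: "same_moments N M" by (simp add: same_moments_def mom_eq m_def)
  have "stieltjes_measure N"
  proof (rule stieltjes_measureI[OF _ _ pw nn])
    fix p :: "real poly" assume "p \<noteq> 0"
    from stieltjes_square_pos[OF st this] show "(\<integral>x. (poly p x)\<^sup>2 \<partial>N) \<noteq> 0"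
      using same_moments_poly[OF sm pw stieltjes_power[OF st], of "p\<^sup>2"] by (simp add: poly_power)
  qed (auto simp: N.prob_space_axioms)
  with sm show ?thesis by (simp add: stieltjes_solution_def)
qed

text \<open>All quadrature measures share the first moment of \<open>M\<close>, so Markov's
  inequality makes them tight and a subsequence converges weakly. The degrees \<open>r n\<close>
  remain visible because the nodes, zeros of \<open>q (r n)\<close>, are used to estimate the limit
  near the origin.\<close>

lemma gauss_limit:
  fixes q :: "nat \<Rightarrow> real poly"
  assumes st: "stieltjes_measure M" and deg: "\<And>n. degree (q n) = n" and q0: "q 0 \<noteq> 0"
    and orth: "\<And>m n. m \<noteq> n \<Longrightarrow> (\<integral>x. poly (q m * q n) x \<partial>M) = 0"
  obtains G r N where "\<And>n. real_distribution (G n)"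
    "\<And>n. AE x in G n. 0 < x \<and> poly (q (r n)) x = 0" "\<And>n p. integrable (G n) (poly p)"
    "\<And>n p. degree p < 2 * r n \<Longrightarrow> (\<integral>x. poly p x \<partial>G n) = (\<integral>x. poly p x \<partial>M)"
    "\<And>n. 0 < r n" "weak_conv_m G N" "stieltjes_solution M N"
proof -
  note int = stieltjes_poly[OF st]
  have "\<exists>G. prob_space G \<and> sets G = sets (borel :: real measure) \<and>
    (AE x in G. 0 < x \<and> poly (q (Suc n)) x = 0) \<and> (\<forall>p. integrable G (poly p)) \<and>
    (\<forall>p. degree p < 2 * Suc n \<longrightarrow> (\<integral>x. poly p x \<partial>G) = (\<integral>x. poly p x \<partial>M))" for n
    by (rule gauss_quadrature[OF st deg[of "Suc n"] zero_less_Suc,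
          OF orthogonal_lower_degree[where q = q and n = "Suc n" and M = M]])
      (use int deg q0 orth in auto)
  then obtain G where G: "\<And>n. prob_space (G n)" "\<And>n. sets (G n) = sets (borel :: real measure)"
    "\<And>n. AE x in G n. 0 < x \<and> poly (q (Suc n)) x = 0" "\<And>n p. integrable (G n) (poly p)"
    "\<And>n p. degree p < 2 * Suc n \<Longrightarrow> (\<integral>x. poly p x \<partial>G n) = (\<integral>x. poly p x \<partial>M)"
    by metis
  have rd: "real_distribution (G n)" for n
    using G(1,2)[of n] by (simp add: real_distribution_def real_distribution_axioms_def)
  have "tight G"
    unfolding tight_def
  proof (intro conjI allI impI rd)
    fix e :: real assume e: "e > 0"
    define m where "m = (\<integral>x. x \<partial>M)"
    have m: "0 \<le> m" unfolding m_def using stieltjes_nonneg[OF st] by (rule integral_nonneg_AE)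
    \<comment> \<open>Markov bounds the mass above \<open>b\<close> by \<open>m / b\<close>; this
      choice makes it strictly less than \<open>e\<close> even when \<open>m = 0\<close>. The nodes
      are positive, so \<open>-1\<close> serves as left end point.\<close>
    define b where "b = m / e + 1"
    have b: "b > 0" using m e by (simp add: b_def add_nonneg_pos)
    have "measure (G n) {-1<..b} > 1 - e" for n
    proof -
      interpret G: real_distribution "G n" by (rule rd)
      have "integrable (G n) (\<lambda>x. x)"
        using G(4)[of n "[:0, 1:]"] by (rule Bochner_Integration.integrable_cong[THEN iffD1, rotated -1]) auto
      then have "measure (G n) {x \<in> space (G n). b \<le> x} \<le> (\<integral>x. x \<partial>G n) / b"
        using G(3)[of n] b
        by (intro integral_Markov_inequality_measure[of _ _ "{}"]) (auto elim: eventually_mono)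
      also have "(\<integral>x. x \<partial>G n) = m"
        using G(5)[of "[:0, 1:]" n] by (simp add: m_def)
      also have "m / b < e"
        using m e b by (simp add: b_def field_simps)
      finally have "measure (G n) {x \<in> space (G n). b \<le> x} < e" .
      moreover have "1 - measure (G n) {x \<in> space (G n). b \<le> x} = measure (G n) (space (G n) - {x \<in> space (G n). b \<le> x})"
        by (rule G.prob_compl[symmetric]) simp
      moreover have "\<dots> \<le> measure (G n) {-1<..b}"
      proof (rule G.finite_measure_mono_AE)
        show "AE x in G n. x \<in> space (G n) - {x \<in> space (G n). b \<le> x} \<longrightarrow> x \<in> {-1<..b}"
          using G(3)[of n] by eventually_elim auto
      qed simp
      ultimately show ?thesis by linarith
    qed
    then show "\<exists>a b. a < b \<and> (\<forall>n. measure (G n) {a<..b} > 1 - e)"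
      using b by (intro exI[of _ "-1"] exI[of _ b]) auto
  qed
  from tight_imp_convergent_subsubsequence[OF this, of "\<lambda>x. x"] obtain s N where
    s: "strict_mono s" and N: "real_distribution N" "weak_conv_m (\<lambda>n. G (s n)) N"
    by (auto simp: strict_mono_def o_def)
  have "stieltjes_solution M N"
  proof (rule weak_limit_moments[OF st rd _ _ _ N(2,1)])
    fix k n
    show "AE x in G (s n). 0 \<le> x" using G(3)[of "s n"] by eventually_elim simp
    show "integrable (G (s n)) (\<lambda>x. x ^ k)"
      using G(4)[of "s n" "monom 1 k"] by (simp add: poly_monom[abs_def])
    show "\<forall>\<^sub>F n in sequentially. (\<integral>x. x ^ k \<partial>G (s n)) = (\<integral>x. x ^ k \<partial>M)"
      unfolding eventually_sequentially
    proof (intro exI[of _ k] allI impI)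
      fix n assume "k \<le> n"
      with seq_suble[OF s, of n] have "degree (monom (1 :: real) k) < 2 * Suc (s n)"
        by (simp add: degree_monom_eq)
      from G(5)[OF this] show "(\<integral>x. x ^ k \<partial>G (s n)) = (\<integral>x. x ^ k \<partial>M)"
        by (simp add: poly_monom)
    qed
  qed
  with that[of "\<lambda>n. G (s n)" "\<lambda>n. Suc (s n)" N] rd G(3-5) N(2) show ?thesis by blast
qed

section \<open>Laplace transforms of polynomial densities\<close>

text \<open>With a polynomial as argument, polynomial identities become identities of transforms by
  linearity, and multiplication by \<open>x\<close> becomes minus the time derivative.\<close>

definition lap :: "real measure \<Rightarrow> real \<Rightarrow> real poly \<Rightarrow> real" where
  "lap M t p = (LINT x:{0..}|M. exp (- x * t) * poly p x)"

lemma lap_smult: "lap M t (smult c p) = c * lap M t p"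
  using set_integral_mult_right[of M "{0..}" c "\<lambda>x. exp (- x * t) * poly p x"]
  by (simp add: lap_def mult_ac)

text \<open>A second-order remainder for the exponential: convexity gives the lower bound
  \<open>0\<close>, and the tangent inequality combined with the Lipschitz bound gives the upper
  one.\<close>

lemma exp_neg_linear_bound:
  fixes u v :: real
  assumes "0 \<le> u" "0 \<le> v"
  shows "\<bar>exp (- u) - exp (- v) + (u - v) * exp (- v)\<bar> \<le> (u - v)\<^sup>2"
proof -
  have tangent: "exp (- b) * (1 + (b - a)) \<le> exp (- a)" for a b :: real
  proof -
    have "exp (- b) * (1 + (b - a)) \<le> exp (- b) * exp (b - a)"
      using exp_ge_add_one_self[of "b - a"] by (intro mult_left_mono) auto
    then show ?thesis by (simp flip: exp_add)
  qed
  have lip: "\<bar>exp (- a) - exp (- b)\<bar> \<le> \<bar>a - b\<bar>" if "0 \<le> a" "0 \<le> b" for a b :: real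
  proof -
    have *: "exp (- a) - exp (- b) \<le> b - a" if "0 \<le> a" "a \<le> b" for a b :: real
    proof -
      have "exp (- a) - exp (- b) \<le> (b - a) * exp (- a)"
        using tangent[of a b] by (simp add: algebra_simps)
      also have "\<dots> \<le> (b - a) * 1" using that by (intro mult_left_mono) auto
      finally show ?thesis by simp
    qed
    show ?thesis
      using that *[of a b] *[of b a] by (cases "a \<le> b") auto
  qed
  have "exp (- u) - exp (- v) + (u - v) * exp (- v) \<le> (u - v) * (exp (- v) - exp (- u))"
    using tangent[of u v] by (simp add: algebra_simps)
  also have "\<dots> \<le> \<bar>u - v\<bar> * \<bar>exp (- v) - exp (- u)\<bar>"
    by (simp flip: abs_mult)
  also have "\<dots> \<le> \<bar>u - v\<bar> * \<bar>u - v\<bar>"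
    using lip[OF assms] by (intro mult_left_mono) auto
  finally have "exp (- u) - exp (- v) + (u - v) * exp (- v) \<le> (u - v)\<^sup>2"
    by (simp add: power2_eq_square)
  moreover have "0 \<le> exp (- u) - exp (- v) + (u - v) * exp (- v)"
    using tangent[of v u] by (simp add: algebra_simps)
  ultimately show ?thesis by simp
qed

context
  fixes M :: "real measure"
  assumes st: "stieltjes_measure M"
begin

lemma lap_integrable:
  assumes "0 \<le> t"
  shows "set_integrable M {0..} (\<lambda>x. exp (- x * t) * poly p x)"
  unfolding set_integrable_def
proof (rule Bochner_Integration.integrable_bound[OF stieltjes_poly[OF st, of p]])
  show "(\<lambda>x. indicator {0..} x *\<^sub>R (exp (- x * t) * poly p x)) \<in> borel_measurable M"
    unfolding measurable_cong_sets[OF stieltjes_sets[OF st] refl] by measurable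
  show "AE x in M. norm (indicator {0..} x *\<^sub>R (exp (- x * t) * poly p x)) \<le> norm (poly p x)"
    using assms by (intro AE_I2) (auto simp: indicator_def abs_mult intro!: mult_left_le_one_le)
qed

lemma lap_add: "0 \<le> t \<Longrightarrow> lap M t (p + q) = lap M t p + lap M t q"
  using set_integral_add(2)[OF lap_integrable[of t p] lap_integrable[of t q]]
  by (simp add: lap_def distrib_left)

lemma lap_diff: "0 \<le> t \<Longrightarrow> lap M t (p - q) = lap M t p - lap M t q"
  using set_integral_diff(2)[OF lap_integrable[of t p] lap_integrable[of t q]]
  by (simp add: lap_def right_diff_distrib)

lemma lap_zero: "lap M 0 p = (\<integral>x. poly p x \<partial>M)"
proof -
  have "lap M 0 p = (\<integral>x. indicator {0..} x * poly p x \<partial>M)"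
    by (simp add: lap_def set_lebesgue_integral_def)
  also have "\<dots> = (\<integral>x. poly p x \<partial>M)"
  proof (rule integral_cong_AE)
    show "AE x in M. indicator {0..} x * poly p x = poly p x"
      using stieltjes_nonneg[OF st] by eventually_elim auto
  qed (unfold measurable_cong_sets[OF stieltjes_sets[OF st] refl], measurable)
  finally show ?thesis .
qed

lemma lap_bound:
  assumes t: "0 \<le> t" and f: "integrable M f" and "AE x in M. 0 \<le> x \<longrightarrow> \<bar>poly p x\<bar> \<le> f x"
  shows "\<bar>lap M t p\<bar> \<le> (\<integral>x. f x \<partial>M)"
proof -
  have "\<bar>lap M t p\<bar> \<le> (\<integral>x. \<bar>indicator {0..} x * (exp (- x * t) * poly p x)\<bar> \<partial>M)"
    unfolding lap_def set_lebesgue_integral_def real_scaleR_def by (rule integral_abs_bound)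
  also have "\<dots> \<le> (\<integral>x. f x \<partial>M)"
  proof (rule integral_mono_AE)
    show "integrable M (\<lambda>x. \<bar>indicator {0..} x * (exp (- x * t) * poly p x)\<bar>)"
      using lap_integrable[OF t, of p] by (simp add: set_integrable_def)
    show "AE x in M. \<bar>indicator {0..} x * (exp (- x * t) * poly p x)\<bar> \<le> f x"
      using stieltjes_nonneg[OF st] assms(3)
    proof eventually_elim
      case (elim x)
      have "exp (- (x * t)) * \<bar>poly p x\<bar> \<le> 1 * \<bar>poly p x\<bar>"
        using elim t by (intro mult_right_mono) auto
      with elim show ?case by (simp add: abs_mult)
    qed
  qed (rule f)
  finally show ?thesis .
qed

text \<open>The second-order remainder of the integrand is at most
  \<open>(s - t)\<^sup>2 * x\<^sup>2 * \<bar>poly p x\<bar>\<close>, which is integrable because all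
  moments are finite. The estimate holds up to the end point, so it yields the one-sided derivative
  at \<open>t = 0\<close> as well.\<close>

lemma lap_has_derivative:
  assumes t: "0 \<le> t"
  shows "((\<lambda>s. lap M s p) has_real_derivative - lap M t ([:0, 1:] * p)) (at t within {0..})"
proof -
  define K where "K = (\<integral>x. \<bar>poly ([:0, 1:]\<^sup>2 * p) x\<bar> \<partial>M)"
  have bd: "\<bar>lap M s p - lap M t p + (s - t) * lap M t ([:0, 1:] * p)\<bar> \<le> (s - t)\<^sup>2 * K" if s: "0 \<le> s" for s
  proof -
    let ?f = "\<lambda>x. (exp (- x * s) - exp (- x * t) + (s - t) * x * exp (- x * t)) * poly p x"
    have "lap M s p - lap M t p + (s - t) * lap M t ([:0, 1:] * p) =
      (LINT x:{0..}|M. exp (- x * s) * poly p x - exp (- x * t) * poly p x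
         + (s - t) * (exp (- x * t) * poly ([:0, 1:] * p) x))"
      unfolding lap_def
      by (subst set_integral_add(2)[OF set_integral_diff(1)[OF lap_integrable[OF s] lap_integrable[OF t]]],
          rule set_integrable_mult_right[OF lap_integrable[OF t]],
          subst set_integral_diff(2)[OF lap_integrable[OF s] lap_integrable[OF t]],
          subst set_integral_mult_right) (rule refl)
    also have "\<dots> = (\<integral>x. indicator {0..} x * ?f x \<partial>M)"
      unfolding set_lebesgue_integral_def by (intro Bochner_Integration.integral_cong refl) (simp add: algebra_simps)
    finally have "\<bar>lap M s p - lap M t p + (s - t) * lap M t ([:0, 1:] * p)\<bar> =
      \<bar>\<integral>x. indicator {0..} x * ?f x \<partial>M\<bar>" by (rule arg_cong)
    also have "\<dots> \<le> (\<integral>x. \<bar>indicator {0..} x * ?f x\<bar> \<partial>M)"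
      by (rule integral_abs_bound)
    also have "\<dots> \<le> (\<integral>x. (s - t)\<^sup>2 * \<bar>poly ([:0, 1:]\<^sup>2 * p) x\<bar> \<partial>M)"
    proof (rule Bochner_Integration.integral_mono')
      show "integrable M (\<lambda>x. (s - t)\<^sup>2 * \<bar>poly ([:0, 1:]\<^sup>2 * p) x\<bar>)"
        by (rule integrable_mult_right, rule integrable_abs, rule stieltjes_poly[OF st])
      fix x :: real
      show "\<bar>indicator {0..} x * ?f x\<bar> \<le> (s - t)\<^sup>2 * \<bar>poly ([:0, 1:]\<^sup>2 * p) x\<bar>"
      proof (cases "0 \<le> x")
        case True
        have "\<bar>exp (- x * s) - exp (- x * t) + (s - t) * x * exp (- x * t)\<bar> \<le> (x * s - x * t)\<^sup>2"
          using exp_neg_linear_bound[of "x * s" "x * t"] True s t by (simp add: algebra_simps)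
        also have "\<dots> = (s - t)\<^sup>2 * x\<^sup>2" by (simp add: power2_eq_square algebra_simps)
        finally have "\<bar>?f x\<bar> \<le> ((s - t)\<^sup>2 * x\<^sup>2) * \<bar>poly p x\<bar>"
          unfolding abs_mult by (rule mult_right_mono) simp
        with True show ?thesis by (simp add: abs_mult power2_eq_square mult_ac)
      qed simp
      show "0 \<le> (s - t)\<^sup>2 * \<bar>poly ([:0, 1:]\<^sup>2 * p) x\<bar>"
        by (intro mult_nonneg_nonneg zero_le_power2 abs_ge_zero)
    qed
    finally show ?thesis by (simp add: K_def)
  qed
  have "((\<lambda>s. (lap M s p - lap M t p) / (s - t)) \<longlongrightarrow> - lap M t ([:0, 1:] * p)) (at t within {0..})"
  proof (rule LIM_zero_cancel, rule Lim_null_comparison)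
    have "((\<lambda>s. \<bar>s - t\<bar> * K) \<longlongrightarrow> \<bar>t - t\<bar> * K) (at t within {0..})"
      by (intro tendsto_intros)
    then show "((\<lambda>s. \<bar>s - t\<bar> * K) \<longlongrightarrow> 0) (at t within {0..})"
      by simp
    show "\<forall>\<^sub>F s in at t within {0..}. norm ((lap M s p - lap M t p) / (s - t) - - lap M t ([:0, 1:] * p))
        \<le> \<bar>s - t\<bar> * K"
      unfolding eventually_at
    proof (intro exI[of _ 1] conjI ballI impI)
      fix s assume s: "s \<in> {0..}" "s \<noteq> t \<and> dist s t < 1"
      define d where "d = s - t"
      define A where "A = lap M s p - lap M t p"
      define B where "B = lap M t ([:0, 1:] * p)"
      have d: "d \<noteq> 0" using s by (simp add: d_def)
      have "A / d - - B = (A + d * B) / d"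
        using d by (simp add: field_simps)
      then have "\<bar>A / d - - B\<bar> = \<bar>A + d * B\<bar> / \<bar>d\<bar>"
        by (simp only: abs_divide)
      also have "\<dots> \<le> d\<^sup>2 * K / \<bar>d\<bar>"
        unfolding A_def B_def d_def using s by (intro divide_right_mono bd) auto
      also have "\<dots> = \<bar>d\<bar> * K"
        using d by (cases "d > 0") (auto simp: power2_eq_square field_simps)
      finally show "norm ((lap M s p - lap M t p) / (s - t) - - lap M t ([:0, 1:] * p)) \<le> \<bar>s - t\<bar> * K"
        by (simp only: A_def B_def d_def real_norm_def)
    qed simp
  qed
  then show ?thesis by (simp add: has_field_derivative_iff)
qed

end

section \<open>Birth-death generators and symmetric kernels\<close>

lemma deriv_lower_bound:
  fixes f :: "real \<Rightarrow> real"
  assumes "0 \<le> t"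
    and "\<And>s. 0 \<le> s \<Longrightarrow> s \<le> t \<Longrightarrow> (f has_real_derivative D s) (at s within {0..t})"
    and "\<And>s. 0 \<le> s \<Longrightarrow> s \<le> t \<Longrightarrow> - e \<le> D s"
  shows "f 0 - e * t \<le> f t"
proof -
  obtain s where s: "s \<in> {0..t}" "f t - f 0 = D s * (t - 0)"
    using mvt_very_simple[of 0 t f "\<lambda>s. (*) (D s)"] assms(1,2) unfolding has_field_derivative_def by blast
  have "- e * t \<le> D s * t" using assms(1,3) s(1) by (intro mult_right_mono) auto
  with s(2) show ?thesis by simp
qed

lemma deriv_upper_bound:
  fixes f :: "real \<Rightarrow> real"
  assumes "0 \<le> t"
    and "\<And>s. 0 \<le> s \<Longrightarrow> s \<le> t \<Longrightarrow> (f has_real_derivative D s) (at s within {0..t})"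
    and "\<And>s. 0 \<le> s \<Longrightarrow> s \<le> t \<Longrightarrow> D s \<le> e"
  shows "f t \<le> f 0 + e * t"
proof -
  have "- f 0 - e * t \<le> - f t"
    using assms by (intro deriv_lower_bound[where D = "\<lambda>s. - D s"]) (auto intro: DERIV_minus)
  then show ?thesis by simp
qed

lemma nontrivial_at_within_atLeast:
  fixes t :: real
  assumes "0 \<le> t"
  shows "at t within {0..} \<noteq> bot"
proof -
  have "at t within {t<..} \<noteq> bot"
    using trivial_limit_at_right_real[of t] .
  moreover have "at t within {t<..} \<le> at t within {0..}"
    using assms by (intro at_le) auto
  ultimately show ?thesis by (metis bot.extremum_uniqueI)
qed

lemma DERIV_within_unique:
  fixes f g :: "real \<Rightarrow> real"
  assumes "0 \<le> t" and "\<And>s. 0 \<le> s \<Longrightarrow> f s = g s"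
    and "(f has_real_derivative a) (at t within {0..})" "(g has_real_derivative b) (at t within {0..})"
  shows "a = b"
proof -
  have "(f has_real_derivative b) (at t within {0..})"
    by (rule has_field_derivative_transform_within[OF assms(4) zero_less_one]) (use assms in auto)
  with assms(3) nontrivial_at_within_atLeast[OF assms(1)] show ?thesis
    by (blast dest: has_field_derivative_unique)
qed

text \<open>The squared negative part is continuously differentiable even across \<open>0\<close>,
  so an energy built from it can be differentiated in time.\<close>

lemma min_zero_square_deriv:
  "((\<lambda>x::real. (min x 0)\<^sup>2) has_real_derivative 2 * min x 0) (at x)"
proof (cases "x = 0")
  case True
  have "((\<lambda>h::real. (min (0 + h) 0)\<^sup>2 / h) \<longlongrightarrow> 0) (at 0)"
  proof (rule Lim_null_comparison)
    show "((\<lambda>h::real. \<bar>h\<bar>) \<longlongrightarrow> 0) (at 0)"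
      using tendsto_rabs_zero[OF tendsto_ident_at] .
    show "\<forall>\<^sub>F h in at 0. norm ((min (0 + h) 0)\<^sup>2 / h) \<le> \<bar>h\<bar>"
      by (rule always_eventually) (auto simp: min_def power2_eq_square)
  qed
  with True show ?thesis by (simp add: DERIV_def)
next
  case False
  show ?thesis
  proof (cases "x > 0")
    case True
    have "((\<lambda>x::real. 0) has_real_derivative 2 * min x 0) (at x)" using True by simp
    then show ?thesis
      by (rule has_field_derivative_transform_within_open[of _ _ _ "{0<..}"]) (use True in \<open>auto simp: min_def\<close>)
  next
    case False
    with \<open>x \<noteq> 0\<close> have "((\<lambda>x::real. x\<^sup>2) has_real_derivative 2 * min x 0) (at x)"
      by (auto intro!: derivative_eq_intros)
    then show ?thesis
      by (rule has_field_derivative_transform_within_open[of _ _ _ "{..<0}"])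
        (use False \<open>x \<noteq> 0\<close> in \<open>auto simp: min_def\<close>)
  qed
qed

lemma min_zero_square_chain:
  fixes f :: "real \<Rightarrow> real"
  assumes "(f has_real_derivative D) (at s within A)"
  shows "((\<lambda>s. (min (f s) 0)\<^sup>2) has_real_derivative 2 * min (f s) 0 * D) (at s within A)"
  by (rule DERIV_chain2[OF min_zero_square_deriv assms])

section \<open>The generator, reversibility and discrete Green identities\<close>

locale birth_death =
  fixes lam mu :: "nat \<Rightarrow> real"
  assumes rates: "rate_set lam mu"
begin

lemma lam_pos [simp]: "0 < lam n" and mu_Suc_pos [simp]: "0 < mu (Suc n)" and mu_nonneg [simp]: "0 \<le> mu n"
  using rates by (auto simp: rate_set_def intro: less_imp_le) (metis less_imp_le not0_implies_Suc)

abbreviation wt :: "nat \<Rightarrow> real" where "wt \<equiv> pi_coeff lam mu"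

text \<open>The conductance of the edge between \<open>n\<close> and \<open>n + 1\<close>; the
  numbers \<open>1 / cond n\<close> are its resistances, the increments of the natural
  scale.\<close>

definition cond :: "nat \<Rightarrow> real" where "cond n = lam n * wt n"

lemma wt_0 [simp]: "wt 0 = 1"
  by (simp add: pi_coeff_def)

lemma wt_pos [simp]: "0 < wt n"
  unfolding pi_coeff_def
  by (intro divide_pos_pos prod_pos) (auto simp: Suc_le_eq gr0_conv_Suc)

lemma cond_pos [simp]: "0 < cond n"
  by (simp add: cond_def)

text \<open>Detailed balance: the flow across an edge is the same in both directions, which makes
  the generator symmetric with respect to \<open>wt\<close>.\<close>

lemma wt_Suc: "mu (Suc n) * wt (Suc n) = cond n"
  using mu_Suc_pos[of n, THEN less_imp_neq] unfolding cond_def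
  by (simp add: pi_coeff_def prod.nat_ivl_Suc')

text \<open>The value \<open>0\<close> is assigned to the fictitious state \<open>-1\<close> in
  which the killed process is absorbed, so that \<open>gen\<close> treats state \<open>0\<close>
  like any other.\<close>

definition prev :: "(nat \<Rightarrow> real) \<Rightarrow> nat \<Rightarrow> real" where
  "prev u n = (case n of 0 \<Rightarrow> 0 | Suc k \<Rightarrow> u k)"

lemma prev_simps [simp]: "prev u 0 = 0" "prev u (Suc n) = u n"
  by (simp_all add: prev_def)

definition gen :: "(nat \<Rightarrow> real) \<Rightarrow> nat \<Rightarrow> real" where
  "gen u n = lam n * (u (Suc n) - u n) - mu n * (u n - prev u n)"

lemma wt_gen_0: "wt 0 * gen u 0 = cond 0 * (u 1 - u 0) - mu 0 * u 0"
  by (simp add: gen_def cond_def)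

lemma wt_gen_Suc:
  "wt (Suc n) * gen u (Suc n) = cond (Suc n) * (u (Suc (Suc n)) - u (Suc n)) - cond n * (u (Suc n) - u n)"
  unfolding gen_def wt_Suc[of n, symmetric] by (simp add: cond_def algebra_simps)

lemma sum_gen: "(\<Sum>k\<le>N. wt k * gen u k) = cond N * (u (Suc N) - u N) - mu 0 * u 0"
proof (induction N)
  case 0 then show ?case using wt_gen_0[of u] by simp
next
  case (Suc N) then show ?case using wt_gen_Suc[of N u] by simp
qed

text \<open>The edge terms telescope and the killing terms at state \<open>0\<close> cancel, leaving
  a discrete Wronskian at the upper end.\<close>

lemma green_identity:
  "(\<Sum>k\<le>N. wt k * (gen u k * v k - u k * gen v k)) =
    cond N * (u (Suc N) - u N) * v N - u N * (cond N * (v (Suc N) - v N))"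
proof (induction N)
  case 0 then show ?case
    by (simp add: gen_def cond_def algebra_simps)
next
  case (Suc N)
  have "wt (Suc N) * (gen u (Suc N) * v (Suc N) - u (Suc N) * gen v (Suc N))
    = (wt (Suc N) * gen u (Suc N)) * v (Suc N) - u (Suc N) * (wt (Suc N) * gen v (Suc N))"
    by (simp add: algebra_simps)
  with Suc show ?case unfolding wt_gen_Suc by (simp add: algebra_simps)
qed

text \<open>Summation by parts produces the Dirichlet form of \<open>v\<close> against its negative
  part. It is nonnegative because \<open>min x 0\<close> is monotone in \<open>x\<close>, and the
  killing term at \<open>0\<close> has the favourable sign too.\<close>

lemma dirichlet_negative_part:
  "(\<Sum>k\<le>N. wt k * (min (v k) 0 * gen v k)) \<le> cond N * (v (Suc N) - v N) * min (v N) 0"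
proof (induction N)
  case 0
  have "wt 0 * (min (v 0) 0 * gen v 0) = min (v 0) 0 * (cond 0 * (v 1 - v 0) - mu 0 * v 0)"
    unfolding wt_gen_0[symmetric] by simp
  also have "\<dots> = cond 0 * (v 1 - v 0) * min (v 0) 0 - mu 0 * (v 0 * min (v 0) 0)"
    by (simp add: algebra_simps)
  also have "\<dots> \<le> cond 0 * (v 1 - v 0) * min (v 0) 0"
    by (simp add: min_def mult_nonneg_nonneg)
  finally show ?case by simp
next
  case (Suc N)
  have "wt (Suc N) * (min (v (Suc N)) 0 * gen v (Suc N)) =
      min (v (Suc N)) 0 * (cond (Suc N) * (v (Suc (Suc N)) - v (Suc N)) - cond N * (v (Suc N) - v N))"
    unfolding wt_gen_Suc[symmetric] by simp
  moreover have "0 \<le> (b - a) * (min b 0 - min a 0)" for a b :: real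
    by (cases "a \<le> b") (auto simp: min_def mult_nonneg_nonneg mult_nonpos_nonpos)
  then have "0 \<le> cond N * ((v (Suc N) - v N) * (min (v (Suc N)) 0 - min (v N) 0))"
    by (rule mult_nonneg_nonneg[OF less_imp_le[OF cond_pos]])
  ultimately show ?case using Suc by (simp add: algebra_simps)
qed

lemma suminf_Q_row: "(\<Sum>k. Q_matrix lam mu i k * u k) = gen u i"
proof -
  \<comment> \<open>For \<open>i = 0\<close> truncated subtraction gives \<open>i - 1 = i\<close>,
    so the set collapses and no entry is counted twice.\<close>
  have "(\<Sum>k. Q_matrix lam mu i k * u k) = (\<Sum>k\<in>{Suc i, i, i - 1}. Q_matrix lam mu i k * u k)"
    by (rule suminf_finite) (auto simp: Q_matrix_def)
  also have "\<dots> = gen u i"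
    by (cases i) (auto simp: Q_matrix_def gen_def algebra_simps)
  finally show ?thesis .
qed

lemma suminf_Q_column: "(\<Sum>k. u k * wt k * Q_matrix lam mu k j) = wt j * gen u j"
proof -
  have "(\<Sum>k. u k * wt k * Q_matrix lam mu k j) = (\<Sum>k\<in>{Suc j, j, j - 1}. u k * wt k * Q_matrix lam mu k j)"
    by (rule suminf_finite) (auto simp: Q_matrix_def)
  also have "\<dots> = wt j * gen u j"
  proof (cases j)
    case 0
    with wt_Suc[of 0] show ?thesis
      by (simp add: Q_matrix_def gen_def cond_def algebra_simps)
  next
    case (Suc i)
    have "(\<Sum>k\<in>{Suc j, j, j - 1}. u k * wt k * Q_matrix lam mu k j) =
      u (Suc j) * (mu (Suc j) * wt (Suc j)) - u j * wt j * (lam j + mu j) + u i * cond i"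
      using Suc by (simp add: Q_matrix_def cond_def algebra_simps)
    also have "\<dots> = wt j * gen u j"
      unfolding wt_Suc[of j] wt_Suc[of i, symmetric] Suc[symmetric] using Suc
      by (simp add: gen_def cond_def algebra_simps)
    finally show ?thesis .
  qed
  finally show ?thesis .
qed

text \<open>The entries of a \<open>Q\<close>-process divided by the weights \<open>wt\<close>; this makes them symmetric in
  \<open>i\<close> and \<open>j\<close>, and both Kolmogorov equations coincide.\<close>

definition kernel :: "(real \<Rightarrow> nat \<Rightarrow> nat \<Rightarrow> real) \<Rightarrow> bool" where
  "kernel S \<longleftrightarrow>
    (\<forall>t\<ge>0. \<forall>i j. ((\<lambda>s. S s i j) has_real_derivative gen (\<lambda>k. S t k j) i) (at t within {0..})) \<and>
    (\<forall>t\<ge>0. \<forall>i j. S t i j = S t j i) \<and>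
    (\<forall>i j. S 0 i j = (if i = j then 1 / wt j else 0))"

text \<open>For the kernel of a process started in \<open>i\<close>, this is the net rate at which
  probability enters \<open>{0..N}\<close> from above.\<close>

definition flux :: "(real \<Rightarrow> nat \<Rightarrow> nat \<Rightarrow> real) \<Rightarrow> nat \<Rightarrow> nat \<Rightarrow> real \<Rightarrow> real" where
  "flux S N i t = cond N * (S t (Suc N) i - S t N i)"

context
  fixes S :: "real \<Rightarrow> nat \<Rightarrow> nat \<Rightarrow> real"
  assumes S: "kernel S"
begin

lemma kernel_deriv:
  "0 \<le> t \<Longrightarrow> ((\<lambda>s. S s i j) has_real_derivative gen (\<lambda>k. S t k j) i) (at t within {0..})"
  and kernel_sym: "0 \<le> t \<Longrightarrow> S t i j = S t j i"
  and kernel_0: "S 0 i j = (if i = j then 1 / wt j else 0)"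
  using S unfolding kernel_def by blast+

lemma kernel_deriv':
  "0 \<le> s \<Longrightarrow> s \<le> t \<Longrightarrow> ((\<lambda>s. S s i j) has_real_derivative gen (\<lambda>k. S s k j) i) (at s within {0..t})"
  using kernel_deriv by (rule has_field_derivative_subset) auto

lemma kernel_deriv_reflected:
  assumes "0 \<le> s" "s \<le> t"
  shows "((\<lambda>s. S (t - s) i j) has_real_derivative - gen (\<lambda>k. S (t - s) k j) i) (at s within {0..t})"
proof -
  have "((\<lambda>s. S s i j) \<circ> (\<lambda>s. t - s) has_real_derivative gen (\<lambda>k. S (t - s) k j) i * (- 1)) (at s within {0..t})"
  proof (rule DERIV_image_chain)
    show "((\<lambda>s. S s i j) has_real_derivative gen (\<lambda>k. S (t - s) k j) i) (at (t - s) within (-) t ` {0..t})"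
      using assms by (intro has_field_derivative_subset[OF kernel_deriv]) auto
    show "((-) t has_real_derivative - 1) (at s within {0..t})"
      by (auto intro!: derivative_eq_intros)
  qed
  then show ?thesis by (simp add: o_def)
qed

text \<open>By symmetry both sides are time derivatives of the same function. This turns the
  backward equation into the forward one.\<close>

lemma kernel_gen_sym:
  assumes "0 \<le> t"
  shows "gen (\<lambda>k. S t k j) i = gen (\<lambda>k. S t i k) j"
proof -
  have "gen (\<lambda>k. S t k j) i = gen (\<lambda>k. S t k i) j"
    using assms kernel_sym by (intro DERIV_within_unique[OF _ _ kernel_deriv kernel_deriv])
  also have "(\<lambda>k. S t k i) = (\<lambda>k. S t i k)" using kernel_sym assms by auto
  finally show ?thesis .
qed

lemma sum_deriv:
  assumes "0 \<le> t"
  shows "((\<lambda>s. \<Sum>k\<le>N. wt k * S s k i) has_real_derivative flux S N i t - mu 0 * S t 0 i) (at t within {0..})"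
proof -
  have "((\<lambda>s. \<Sum>k\<le>N. wt k * S s k i) has_real_derivative (\<Sum>k\<le>N. wt k * gen (\<lambda>k. S t k i) k)) (at t within {0..})"
    by (intro DERIV_sum DERIV_cmult kernel_deriv assms)
  then show ?thesis by (simp add: sum_gen flux_def)
qed

lemma sum_at_0:
  assumes "i \<le> N"
  shows "(\<Sum>k\<le>N. wt k * S 0 k i * u k) = u i"
proof -
  have "(\<Sum>k\<le>N. wt k * S 0 k i * u k) = (\<Sum>k\<le>N. if k = i then u k else 0)"
    using wt_pos by (intro sum.cong) (auto simp: kernel_0 less_imp_neq[symmetric])
  with assms show ?thesis by simp
qed

text \<open>The sum interpolates between \<open>T\<close> at \<open>s = 0\<close> and
  \<open>S\<close> at \<open>s = t\<close>. Green's identity removes all interior contributions to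
  its derivative.\<close>

lemma compare_deriv:
  assumes T: "\<And>k. ((\<lambda>s. T (t - s) k j) has_real_derivative - gen (\<lambda>k. T (t - s) k j) k) (at s within {0..t})"
    and "0 \<le> s" "s \<le> t"
  shows "((\<lambda>s. \<Sum>k\<le>N. wt k * (S s k i * T (t - s) k j)) has_real_derivative
    flux S N i s * T (t - s) N j - S s N i * flux T N j (t - s)) (at s within {0..t})"
proof -
  have "((\<lambda>s. \<Sum>k\<le>N. wt k * (S s k i * T (t - s) k j)) has_real_derivative
    (\<Sum>k\<le>N. wt k * (S s k i * - gen (\<lambda>k. T (t - s) k j) k + gen (\<lambda>k. S s k i) k * T (t - s) k j)))
    (at s within {0..t})"
    using assms by (intro DERIV_sum DERIV_cmult DERIV_mult' kernel_deriv') auto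
  moreover have "(\<Sum>k\<le>N. wt k * (S s k i * - gen (\<lambda>k. T (t - s) k j) k + gen (\<lambda>k. S s k i) k * T (t - s) k j))
    = flux S N i s * T (t - s) N j - S s N i * flux T N j (t - s)"
    using green_identity[of "\<lambda>k. S s k i" "\<lambda>k. T (t - s) k j" N] by (simp add: flux_def)
  ultimately show ?thesis by simp
qed

end

section \<open>Consequences of a vanishing boundary term\<close>

definition flux_vanishing :: "(real \<Rightarrow> nat \<Rightarrow> nat \<Rightarrow> real) \<Rightarrow> bool" where
  "flux_vanishing S \<longleftrightarrow> (\<forall>i j. \<exists>e. e \<longlonglongrightarrow> 0 \<and>
    (\<forall>N. \<forall>s\<ge>0. \<forall>t\<ge>0. \<bar>flux S N i s * S t N j\<bar> \<le> e N))"

lemma flux_vanishingE: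
  assumes "flux_vanishing S"
  obtains e where "e \<longlonglongrightarrow> 0" "\<And>N s t. 0 \<le> s \<Longrightarrow> 0 \<le> t \<Longrightarrow> \<bar>flux S N i s * S t N j\<bar> \<le> e N"
proof -
  have "\<exists>e. e \<longlonglongrightarrow> 0 \<and> (\<forall>N. \<forall>s\<ge>0. \<forall>t\<ge>0. \<bar>flux S N i s * S t N j\<bar> \<le> e N)"
    using assms by (simp add: flux_vanishing_def)
  then show ?thesis using that by auto
qed

text \<open>Energy form of the minimum principle: the weighted sum of squared negative parts over
  \<open>{0..N}\<close> starts at zero and, by \<open>dirichlet_negative_part\<close>, grows at most
  at rate \<open>2 * e N\<close>.\<close>

lemma kernel_nonneg:
  assumes S: "kernel S" "flux_vanishing S" and t: "0 \<le> t"
  shows "0 \<le> S t i j"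
proof -
  obtain e where e: "e \<longlonglongrightarrow> 0" "\<And>N s t. 0 \<le> s \<Longrightarrow> 0 \<le> t \<Longrightarrow> \<bar>flux S N j s * S t N j\<bar> \<le> e N"
    using flux_vanishingE[OF S(2), of j j] by blast
  define E where "E N s = (\<Sum>k\<le>N. wt k * (min (S s k j) 0)\<^sup>2)" for N s
  have E_le: "E N t \<le> E N 0 + (2 * e N) * t" for N
  proof (rule deriv_upper_bound[OF t])
    fix s assume s: "0 \<le> s" "s \<le> t"
    show "(E N has_real_derivative (\<Sum>k\<le>N. wt k * (2 * min (S s k j) 0 * gen (\<lambda>k. S s k j) k)))
      (at s within {0..t})"
      unfolding E_def[abs_def]
      by (intro DERIV_sum DERIV_cmult min_zero_square_chain kernel_deriv'[OF S(1)] s)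
    have "(\<Sum>k\<le>N. wt k * (2 * min (S s k j) 0 * gen (\<lambda>k. S s k j) k))
      = 2 * (\<Sum>k\<le>N. wt k * (min (S s k j) 0 * gen (\<lambda>k. S s k j) k))"
      by (simp add: sum_distrib_left mult_ac)
    also have "\<dots> \<le> 2 * (flux S N j s * min (S s N j) 0)"
      using dirichlet_negative_part[where v = "\<lambda>k. S s k j"] by (simp add: flux_def)
    also have "\<dots> \<le> 2 * \<bar>flux S N j s * S s N j\<bar>"
      by (cases "S s N j \<le> 0") (simp_all add: min_def)
    also have "\<dots> \<le> 2 * e N" using e(2)[of s s N] s by simp
    finally show "(\<Sum>k\<le>N. wt k * (2 * min (S s k j) 0 * gen (\<lambda>k. S s k j) k)) \<le> 2 * e N" .
  qed
  have E0: "E N 0 = 0" for N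
    unfolding E_def by (intro sum.neutral) (auto simp: kernel_0[OF S(1)] less_imp_le)
  have "wt i * (min (S t i j) 0)\<^sup>2 \<le> 0"
  proof (rule LIMSEQ_le_const)
    show "(\<lambda>N. (2 * e N) * t) \<longlonglongrightarrow> 0"
      using tendsto_mult_right[OF tendsto_mult_left[OF e(1), of 2], of t] by simp
    have "wt i * (min (S t i j) 0)\<^sup>2 \<le> E N t" if "i \<le> N" for N
      unfolding E_def using that by (intro member_le_sum) (auto simp: less_imp_le)
    then show "\<exists>N0. \<forall>N\<ge>N0. wt i * (min (S t i j) 0)\<^sup>2 \<le> (2 * e N) * t"
      using E_le E0 by (intro exI[of _ i]) (auto intro: order.trans)
  qed
  then have "(min (S t i j) 0)\<^sup>2 \<le> 0"
    using mult_le_cancel_left_pos[OF wt_pos[of i], of _ 0] by simp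
  then show ?thesis by (simp add: min_def split: if_splits)
qed

text \<open>The kernel is compared with itself. As \<open>u\<close> runs from \<open>0\<close> to
  \<open>s\<close>, the sum \<open>F N u\<close> moves from \<open>S (s + t) i j\<close> to a
  partial sum of the Chapman-Kolmogorov series, and its derivative consists of boundary terms
  only.\<close>

lemma kernel_semigroup:
  assumes S: "kernel S" "flux_vanishing S" and s: "0 \<le> s" and t: "0 \<le> t"
  shows "(\<lambda>k. wt k * (S s k i * S t k j)) sums S (s + t) i j"
proof -
  obtain e where e: "e \<longlonglongrightarrow> 0" "\<And>N s t. 0 \<le> s \<Longrightarrow> 0 \<le> t \<Longrightarrow> \<bar>flux S N i s * S t N j\<bar> \<le> e N"
    using flux_vanishingE[OF S(2), of i j] by blast
  obtain e' where e': "e' \<longlonglongrightarrow> 0" "\<And>N s t. 0 \<le> s \<Longrightarrow> 0 \<le> t \<Longrightarrow> \<bar>flux S N j s * S t N i\<bar> \<le> e' N"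
    using flux_vanishingE[OF S(2), of j i] by blast
  define F where "F N u = (\<Sum>k\<le>N. wt k * (S u k i * S (s + t - u) k j))" for N u
  define D where "D N u = flux S N i u * S (s + t - u) N j - S u N i * flux S N j (s + t - u)" for N u
  have F_deriv: "(F N has_real_derivative D N u) (at u within {0..s})" if "0 \<le> u" "u \<le> s" for N u
  proof -
    have "(F N has_real_derivative D N u) (at u within {0..s + t})"
      unfolding F_def[abs_def] D_def using that t
      by (intro compare_deriv[OF S(1)] kernel_deriv_reflected[OF S(1)]) auto
    then show ?thesis by (rule has_field_derivative_subset) (use t in auto)
  qed
  have D: "\<bar>D N u\<bar> \<le> e N + e' N" if "0 \<le> u" "u \<le> s" for N u
    using e(2)[of u "s + t - u" N] e'(2)[of "s + t - u" u N] that t unfolding D_def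
    by (simp add: mult.commute)
  have "\<bar>F N s - S (s + t) i j\<bar> \<le> (e N + e' N) * s" if "i \<le> N" for N
  proof -
    have "F N 0 = S (s + t) i j"
      using sum_at_0[OF S(1) that, of "\<lambda>k. S (s + t) k j"] by (simp add: F_def mult.assoc)
    moreover have "F N 0 - (e N + e' N) * s \<le> F N s"
    proof (rule deriv_lower_bound[OF s F_deriv])
      show "- (e N + e' N) \<le> D N u" if "0 \<le> u" "u \<le> s" for u
        using D[OF that, of N] by linarith
    qed
    moreover have "F N s \<le> F N 0 + (e N + e' N) * s"
    proof (rule deriv_upper_bound[OF s F_deriv])
      show "D N u \<le> e N + e' N" if "0 \<le> u" "u \<le> s" for u
        using D[OF that, of N] by linarith
    qed
    ultimately show ?thesis by linarith
  qed
  then have "\<forall>\<^sub>F N in sequentially. norm (F N s - S (s + t) i j) \<le> (e N + e' N) * s"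
    unfolding eventually_sequentially by auto
  moreover have "(\<lambda>N. (e N + e' N) * s) \<longlonglongrightarrow> 0"
    using tendsto_mult_right[OF tendsto_add[OF e(1) e'(1)], of s] by simp
  ultimately have "(\<lambda>N. F N s - S (s + t) i j) \<longlonglongrightarrow> 0"
    by (rule Lim_null_comparison)
  then have "(\<lambda>N. F N s) \<longlonglongrightarrow> S (s + t) i j"
    by (rule LIM_zero_cancel)
  then show ?thesis
    unfolding sums_def_le F_def by simp
qed

text \<open>The last hypothesis is one-sided on purpose: row sums stay below \<open>1\<close> once
  no probability enters from infinity, while loss of probability to infinity is allowed.\<close>

lemma kernel_Q_process:
  assumes S: "kernel S" "flux_vanishing S"
    and fl: "\<And>i. \<exists>e. e \<longlonglongrightarrow> 0 \<and> (\<forall>N. \<forall>t\<ge>0. flux S N i t \<le> e N)"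
  shows "Q_process lam mu (\<lambda>t i j. S t i j * wt j)"
proof -
  note nn = kernel_nonneg[OF S]
  have row_le: "(\<Sum>k\<le>N. wt k * S t k i) \<le> 1" if t: "0 \<le> t" for N t i
  proof -
    obtain e where e: "e \<longlonglongrightarrow> 0" "\<And>N t. 0 \<le> t \<Longrightarrow> flux S N i t \<le> e N"
      using fl[of i] by blast
    show ?thesis
    proof (rule LIMSEQ_le_const)
      show "(\<lambda>M. 1 + e M * t) \<longlonglongrightarrow> 1"
        using tendsto_add[OF tendsto_const tendsto_mult_right[OF e(1), of t], of 1] by simp
      have "(\<Sum>k\<le>N. wt k * S t k i) \<le> 1 + e M * t" if M: "max N i \<le> M" for M
      proof -
        have "(\<Sum>k\<le>M. wt k * S t k i) \<le> (\<Sum>k\<le>M. wt k * S 0 k i) + e M * t"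
        proof (rule deriv_upper_bound[OF t])
          fix s assume s: "0 \<le> s" "s \<le> t"
          show "((\<lambda>s. \<Sum>k\<le>M. wt k * S s k i) has_real_derivative flux S M i s - mu 0 * S s 0 i) (at s within {0..t})"
            using s by (intro has_field_derivative_subset[OF sum_deriv[OF S(1)]]) auto
          have "0 \<le> mu 0 * S s 0 i" using nn[OF s(1)] by simp
          then show "flux S M i s - mu 0 * S s 0 i \<le> e M" using e(2)[OF s(1), of M] by simp
        qed
        also have "(\<Sum>k\<le>M. wt k * S 0 k i) = 1"
          using sum_at_0[OF S(1), of i M "\<lambda>_. 1"] M by simp
        moreover have "(\<Sum>k\<le>N. wt k * S t k i) \<le> (\<Sum>k\<le>M. wt k * S t k i)"
          using M nn[OF t] by (intro sum_mono2) (auto simp: less_imp_le)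
        ultimately show ?thesis by linarith
      qed
      then show "\<exists>M0. \<forall>M\<ge>M0. (\<Sum>k\<le>N. wt k * S t k i) \<le> 1 + e M * t" by blast
    qed
  qed
  have row: "summable (\<lambda>j. S t i j * wt j) \<and> (\<Sum>j. S t i j * wt j) \<le> 1" if t: "0 \<le> t" for t i
  proof -
    have *: "(\<Sum>k<N. S t i k * wt k) \<le> 1" for N
    proof -
      have "(\<Sum>k<N. S t i k * wt k) = (\<Sum>k<N. wt k * S t k i)"
        using kernel_sym[OF S(1) t] by (intro sum.cong) (auto simp: mult.commute)
      also have "\<dots> \<le> (\<Sum>k\<le>N. wt k * S t k i)"
        using nn[OF t] by (intro sum_mono2) (auto simp: less_imp_le)
      also have "\<dots> \<le> 1" by (rule row_le[OF t])
      finally show ?thesis .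
    qed
    have "summable (\<lambda>j. S t i j * wt j)"
      using *[of "Suc _"] nn[OF t] by (intro bounded_imp_summable[where B = 1])
        (auto simp: less_imp_le lessThan_Suc_atMost simp del: sum.lessThan_Suc)
    then show ?thesis using * by (auto intro: suminf_le_const)
  qed
  have ck: "S (s + t) i j * wt j = (\<Sum>k. S s i k * wt k * (S t k j * wt j))" if "0 \<le> s" "0 \<le> t" for s t i j
  proof -
    have "(\<lambda>k. wt k * (S s k i * S t k j) * wt j) sums (S (s + t) i j * wt j)"
      by (intro sums_mult2 kernel_semigroup[OF S that])
    then have "(\<lambda>k. S s i k * wt k * (S t k j * wt j)) sums (S (s + t) i j * wt j)"
      using kernel_sym[OF S(1) that(1)] by (simp add: mult_ac)
    then show ?thesis by (simp add: sums_iff)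
  qed
  have bw: "((\<lambda>s. S s i j * wt j) has_real_derivative (\<Sum>k. Q_matrix lam mu i k * (S t k j * wt j)))
      (at t within {0..})" if t: "0 \<le> t" for t i j
  proof -
    have "(\<Sum>k. Q_matrix lam mu i k * (S t k j * wt j)) = gen (\<lambda>k. S t k j) i * wt j"
      unfolding suminf_Q_row by (cases i) (simp_all add: gen_def algebra_simps)
    then show ?thesis using DERIV_cmult_right[OF kernel_deriv[OF S(1) t]] by simp
  qed
  have fw: "((\<lambda>s. S s i j * wt j) has_real_derivative (\<Sum>k. S t i k * wt k * Q_matrix lam mu k j))
      (at t within {0..})" if t: "0 \<le> t" for t i j
    using DERIV_cmult_right[OF kernel_deriv[OF S(1) t], of i j "wt j"]
    unfolding suminf_Q_column kernel_gen_sym[OF S(1) t] by (simp add: mult.commute)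
  show ?thesis
    unfolding Q_process_def
  proof (intro conjI allI impI)
    show "S 0 i j * wt j = (if i = j then 1 else 0)" for i j
      using wt_pos[of j, THEN less_imp_neq] by (simp add: kernel_0[OF S(1)])
  qed (use nn row ck bw fw in \<open>simp_all add: less_imp_le\<close>)
qed

end

section \<open>Kernels of \<open>Q\<close>-processes\<close>

context birth_death
begin

lemma gen_determines:
  assumes "u i = v i" "prev u i = prev v i" "gen u i = gen v i"
  shows "u (Suc i) = v (Suc i)"
  using assms lam_pos[of i, THEN less_imp_neq] by (simp add: gen_def)

lemma gen_divide: "gen (\<lambda>k. u k / c) i = gen u i / c"
proof -
  have "gen (\<lambda>k. u k * inverse c) i = gen u i * inverse c"
    by (cases i) (simp_all add: gen_def algebra_simps)
  then show ?thesis by (simp add: divide_inverse)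
qed

text \<open>Symmetry has to be derived. Since \<open>lam i\<close> is positive, the backward
  equation determines the entries in row \<open>i + 1\<close> from those in rows \<open>i\<close>
  and \<open>i - 1\<close>, and the forward equation determines columns by the same recurrence.
  Column \<open>0\<close> is compared with row \<open>0\<close> before the remaining indices, as it
  supplies the start of their induction.\<close>

lemma Q_process_kernel:
  assumes "Q_process lam mu P"
  shows "kernel (\<lambda>t i j. P t i j / wt j)"
proof -
  define S where "S t i j = P t i j / wt j" for t i j
  have P: "P t i j = S t i j * wt j" for t i j
    using wt_pos[of j, THEN less_imp_neq] by (simp add: S_def)
  have Pb: "((\<lambda>s. P s i j) has_real_derivative (\<Sum>k. Q_matrix lam mu i k * P t k j)) (at t within {0..})"
    and Pf: "((\<lambda>s. P s i j) has_real_derivative (\<Sum>k. P t i k * Q_matrix lam mu k j)) (at t within {0..})"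
    if "0 \<le> t" for t i j
    using assms that unfolding Q_process_def by blast+
  have bw: "((\<lambda>s. S s i j) has_real_derivative gen (\<lambda>k. S t k j) i) (at t within {0..})" if "0 \<le> t" for t i j
    using DERIV_cdivide[OF Pb[OF that], of i j "wt j"] by (simp add: suminf_Q_row S_def gen_divide)
  have fw: "((\<lambda>s. S s i j) has_real_derivative gen (\<lambda>k. S t i k) j) (at t within {0..})" if "0 \<le> t" for t i j
  proof -
    have "(\<Sum>k. P t i k * Q_matrix lam mu k j) / wt j = gen (\<lambda>k. S t i k) j"
      using wt_pos[of j, THEN less_imp_neq] by (simp add: P suminf_Q_column)
    then show ?thesis
      using DERIV_cdivide[OF Pf[OF that], of i j "wt j"] by (simp add: S_def)
  qed
  have step: "S t (Suc i) j = S t j (Suc i)"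
    if "\<And>t. 0 \<le> t \<Longrightarrow> S t i j = S t j i \<and> prev (\<lambda>k. S t k j) i = prev (\<lambda>k. S t j k) i" "0 \<le> t" for i j t
  proof (rule gen_determines[of "\<lambda>k. S t k j" i "\<lambda>k. S t j k"])
    show "gen (\<lambda>k. S t k j) i = gen (\<lambda>k. S t j k) i"
      using that by (intro DERIV_within_unique[OF _ _ bw fw]) auto
  qed (use that in auto)
  have sym0: "S t i 0 = S t 0 i \<and> prev (\<lambda>k. S t k 0) i = prev (\<lambda>k. S t 0 k) i" if "0 \<le> t" for t i
    using that by (induction i arbitrary: t) (auto intro: step)
  have sym: "S t i j = S t j i \<and> prev (\<lambda>k. S t k j) i = prev (\<lambda>k. S t j k) i" if "0 \<le> t" for t i j
    using that by (induction i arbitrary: t) (auto intro: step simp: sym0)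
  have "S 0 i j = (if i = j then 1 / wt j else 0)" for i j
    using assms by (simp add: S_def Q_process_def)
  with bw sym show ?thesis unfolding kernel_def S_def by blast
qed

text \<open>The rates at \<open>n\<close> may be unbounded, but by symmetry the generator can act on
  the fixed index \<open>j\<close> instead, which gives a bound independent of \<open>n\<close> and
  \<open>t\<close>.\<close>

lemma gen_bounded:
  assumes S: "kernel S" and B: "\<And>t n k. 0 \<le> t \<Longrightarrow> \<bar>S t n k\<bar> \<le> B k"
  shows "\<exists>C\<ge>0. \<forall>t\<ge>0. \<forall>n. \<bar>gen (\<lambda>k. S t k j) n\<bar> \<le> C"
proof -
  have B0: "0 \<le> B k" for k using B[of 0 0 k] by linarith
  have pB: "0 \<le> prev B j" using B0 by (cases j) auto
  define C where "C = lam j * (B (Suc j) + B j) + mu j * (B j + prev B j)"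
  have "0 \<le> C"
    unfolding C_def using B0 pB by (intro add_nonneg_nonneg mult_nonneg_nonneg) (auto simp: less_imp_le)
  moreover have "\<bar>gen (\<lambda>k. S t k j) n\<bar> \<le> C" if t: "0 \<le> t" for t n
  proof -
    have "\<bar>prev (\<lambda>k. S t n k) j\<bar> \<le> prev B j" using B[OF t] by (cases j) auto
    then have "\<bar>lam j * (S t n (Suc j) - S t n j)\<bar> \<le> lam j * (B (Suc j) + B j)"
      "\<bar>mu j * (S t n j - prev (\<lambda>k. S t n k) j)\<bar> \<le> mu j * (B j + prev B j)"
      using B[OF t, of n j] B[OF t, of n "Suc j"]
      by (auto simp: abs_mult less_imp_le intro!: mult_left_mono)
    then show ?thesis
      unfolding kernel_gen_sym[OF S t] unfolding C_def gen_def by linarith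
  qed
  ultimately show ?thesis by blast
qed

lemma flux_eq_sum:
  "flux S N i t = (\<Sum>k\<le>N. wt k * gen (\<lambda>k. S t k i) k) + mu 0 * S t 0 i"
  by (simp add: sum_gen flux_def)

definition wt_tail :: "nat \<Rightarrow> real" where "wt_tail N = (\<Sum>k. wt (k + Suc N))"

section \<open>Summable weights: boundary behaviour at infinity\<close>

context
  assumes summable_wt: "summable wt"
begin

lemma wt_tail_tendsto: "wt_tail \<longlonglongrightarrow> 0"
  unfolding wt_tail_def
  using LIMSEQ_Suc[OF suminf_exist_split2[OF summable_wt]] by simp

lemma sum_wt_le_tail: "(\<Sum>k\<in>{N<..M}. wt k) \<le> wt_tail N"
proof -
  have "(\<Sum>k\<in>{N<..M}. wt k) = (\<Sum>k<M - N. wt (k + Suc N))"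
    by (rule sum.reindex_bij_witness[of _ "\<lambda>k. k + Suc N" "\<lambda>k. k - Suc N"]) auto
  also have "\<dots> \<le> wt_tail N"
    unfolding wt_tail_def
    by (intro sum_le_suminf summable_ignore_initial_segment summable_wt) (auto simp: less_imp_le)
  finally show ?thesis .
qed

text \<open>The flux changes between \<open>N\<close> and \<open>M\<close> by a weighted sum of
  values of the generator; if these are bounded, the tail of the weights controls the
  change.\<close>

lemma flux_difference:
  assumes "\<And>n. \<bar>gen (\<lambda>k. S t k i) n\<bar> \<le> C" "N \<le> M"
  shows "\<bar>flux S M i t - flux S N i t\<bar> \<le> C * wt_tail N"
proof -
  have C: "0 \<le> C" using assms(1)[of 0] by linarith
  have M: "{..M} = {..N} \<union> {N<..M}" using assms(2) by auto
  have "(\<Sum>k\<le>M. wt k * gen (\<lambda>k. S t k i) k) =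
    (\<Sum>k\<le>N. wt k * gen (\<lambda>k. S t k i) k) + (\<Sum>k\<in>{N<..M}. wt k * gen (\<lambda>k. S t k i) k)"
    unfolding M by (rule sum.union_disjoint) auto
  then have "flux S M i t - flux S N i t = (\<Sum>k\<in>{N<..M}. wt k * gen (\<lambda>k. S t k i) k)"
    unfolding flux_eq_sum by simp
  then have "\<bar>flux S M i t - flux S N i t\<bar> = \<bar>\<Sum>k\<in>{N<..M}. wt k * gen (\<lambda>k. S t k i) k\<bar>"
    by simp
  also have "\<dots> \<le> (\<Sum>k\<in>{N<..M}. wt k * C)"
    using assms(1) by (intro order.trans[OF sum_abs] sum_mono) (auto simp: abs_mult less_imp_le intro!: mult_left_mono)
  also have "\<dots> = C * (\<Sum>k\<in>{N<..M}. wt k)" by (simp add: sum_distrib_left mult.commute)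
  also have "\<dots> \<le> C * wt_tail N" by (intro mult_left_mono sum_wt_le_tail C)
  finally show ?thesis .
qed

text \<open>Here the boundary is absorbing: the kernel decays at infinity while the flux merely
  stays bounded, so their product vanishes.\<close>

lemma dirichlet_Q_process:
  assumes S: "kernel S" and lim: "\<And>j. \<exists>e. e \<longlonglongrightarrow> 0 \<and> (\<forall>N. \<forall>t\<ge>0. \<bar>S t N j\<bar> \<le> e N)"
  shows "Q_process lam mu (\<lambda>t i j. S t i j * wt j)"
proof -
  obtain e where e: "\<And>j. e j \<longlonglongrightarrow> 0" "\<And>j N t. 0 \<le> t \<Longrightarrow> \<bar>S t N j\<bar> \<le> e j N"
    using lim by metis
  have e0: "0 \<le> e j N" for j N using e(2)[of 0 N j] by linarith
  have "\<exists>B. \<forall>N. e j N \<le> B" for j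
  proof -
    have "Bseq (e j)" using e(1)[of j] by (intro convergent_imp_Bseq convergentI)
    then show ?thesis unfolding Bseq_def by (metis abs_le_D1 real_norm_def)
  qed
  then obtain B where "\<And>j N. e j N \<le> B j" by metis
  with e(2) have B: "\<bar>S t n k\<bar> \<le> B k" if "0 \<le> t" for t n k using that by (meson order.trans)
  have "\<exists>C. \<forall>j. 0 \<le> C j \<and> (\<forall>t\<ge>0. \<forall>n. \<bar>gen (\<lambda>k. S t k j) n\<bar> \<le> C j)"
    using gen_bounded[OF S B] by metis
  then obtain C where C: "\<And>j. 0 \<le> C j" "\<And>j t n. 0 \<le> t \<Longrightarrow> \<bar>gen (\<lambda>k. S t k j) n\<bar> \<le> C j" by blast
  have van: "flux_vanishing S"
    unfolding flux_vanishing_def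
  proof (intro allI)
    fix i j
    \<comment> \<open>Bounds the flux at \<open>0\<close> by a generator value and the killing term,
      and adds the largest possible change on the way to \<open>N\<close>.\<close>
    define K where "K = C i * wt_tail 0 + C i * wt 0 + mu 0 * B i"
    have fl: "\<bar>flux S N i t\<bar> \<le> K" if t: "0 \<le> t" for N t
    proof -
      have "\<bar>mu 0 * S t 0 i\<bar> \<le> mu 0 * B i"
        using B[OF t] by (simp add: abs_mult mult_left_mono)
      moreover have "\<bar>wt 0 * gen (\<lambda>k. S t k i) 0\<bar> \<le> C i * wt 0"
        using C(2)[OF t, of i 0] by simp
      moreover have "flux S 0 i t = wt 0 * gen (\<lambda>k. S t k i) 0 + mu 0 * S t 0 i"
        by (simp add: flux_eq_sum)
      moreover have "\<bar>flux S N i t - flux S 0 i t\<bar> \<le> C i * wt_tail 0"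
        by (intro flux_difference C t) simp
      ultimately show ?thesis unfolding K_def by linarith
    qed
    have K: "0 \<le> K" using fl[of 0 0] by linarith
    have "\<bar>flux S N i s * S t N j\<bar> \<le> K * e j N" if "0 \<le> s" "0 \<le> t" for s t N
      unfolding abs_mult using fl[OF that(1)] e(2)[OF that(2)] K by (intro mult_mono) auto
    moreover have "(\<lambda>N. K * e j N) \<longlonglongrightarrow> 0"
      using tendsto_mult_left[OF e(1)[of j], of K] by simp
    ultimately show "\<exists>e. e \<longlonglongrightarrow> 0 \<and> (\<forall>N. \<forall>s\<ge>0. \<forall>t\<ge>0. \<bar>flux S N i s * S t N j\<bar> \<le> e N)"
      by blast
  qed
  have "flux S N i t \<le> C i * wt_tail N" if t: "0 \<le> t" for N i t
  proof (rule ccontr)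
    \<comment> \<open>Then the flux would be positive at every \<open>M \<ge> N\<close>, so the
      kernel would increase strictly towards its limit \<open>0\<close> and be negative at
      \<open>N\<close>.\<close>
    assume "\<not> flux S N i t \<le> C i * wt_tail N"
    then have pos: "0 < flux S M i t" if "N \<le> M" for M
      using flux_difference[where S = S and i = i and t = t and C = "C i", OF C(2)[OF t] that] by linarith
    have less: "S t M i < S t (Suc M) i" if "N \<le> M" for M
      using pos[OF that] cond_pos[of M] by (simp add: flux_def zero_less_mult_iff)
    have "(\<lambda>M. S t M i) \<longlonglongrightarrow> 0"
      using e(2)[OF t] by (intro Lim_null_comparison[OF always_eventually e(1)]) auto
    then have "(\<lambda>M. S t (M + Suc N) i) \<longlonglongrightarrow> 0"
      by (rule LIMSEQ_ignore_initial_segment)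
    moreover have "incseq (\<lambda>M. S t (M + Suc N) i)"
      using less by (intro incseq_SucI) (simp add: less_imp_le)
    ultimately have "S t (0 + Suc N) i \<le> 0" by (rule incseq_le[rotated])
    with less[of N] kernel_nonneg[OF S van t, of N i] show False by simp
  qed
  moreover have "(\<lambda>N. C i * wt_tail N) \<longlonglongrightarrow> 0" for i
    using tendsto_mult_left[OF wt_tail_tendsto, of "C i"] by simp
  ultimately show ?thesis by (intro kernel_Q_process[OF S van]) blast
qed

text \<open>Without killing, the derivative of a row sum is the limit of the flux. Row sums cannot
  increase, by Chapman-Kolmogorov and substochasticity, so this limit is nonpositive, and the flux
  at \<open>N\<close> differs from it by at most \<open>C * wt_tail N\<close>.\<close>

lemma Q_process_flux_le:
  assumes R: "Q_process lam mu R" and mu0: "mu 0 = 0"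
  defines "S \<equiv> \<lambda>t i j. R t i j / wt j"
  shows "\<exists>e. e \<longlonglongrightarrow> 0 \<and> (\<forall>N. \<forall>t\<ge>0. flux S N j t \<le> e N)"
proof -
  have S: "kernel S" unfolding S_def by (rule Q_process_kernel[OF R])
  have R_nn: "0 \<le> R t i j" if "0 \<le> t" for t i j using R that by (simp add: Q_process_def)
  have R_row: "summable (R t i)" "(\<Sum>j. R t i j) \<le> 1" if "0 \<le> t" for t i
    using R that unfolding Q_process_def by blast+
  have R_le: "R t i j \<le> 1" if "0 \<le> t" for t i j
    using sum_le_suminf[OF R_row(1)[OF that], of "{j}" i] R_row(2)[OF that, of i] R_nn[OF that] by auto
  have R_S: "R t i j = wt j * S t j i" if "0 \<le> t" for t i j
    using kernel_sym[OF S that, of j i] wt_pos[of j, THEN less_imp_neq] by (simp add: S_def)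
  have B: "\<bar>S t n k\<bar> \<le> 1 / wt k" if "0 \<le> t" for t n k
    using R_nn[OF that] R_le[OF that] by (simp add: S_def divide_right_mono less_imp_le)
  obtain C where C: "0 \<le> C" "\<And>t n. 0 \<le> t \<Longrightarrow> \<bar>gen (\<lambda>k. S t k j) n\<bar> \<le> C"
    using gen_bounded[OF S B] by metis
  define g' where "g' t = (\<Sum>n. wt n * gen (\<lambda>k. S t k j) n)" for t
  have bd: "norm (wt n * gen (\<lambda>k. S t k j) n) \<le> wt n * C" if "0 \<le> t" for n t
    using C(2)[OF that, of n] by (simp add: abs_mult mult_left_mono less_imp_le)
  \<comment> \<open>The series of derivatives is dominated by \<open>wt n * C\<close> uniformly in
    time, which permits termwise differentiation of the row sum.\<close>
  have "uniform_limit {0..} (\<lambda>n t. \<Sum>i<n. wt i * gen (\<lambda>k. S t k j) i) g' sequentially"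
    unfolding g'_def by (rule Weierstrass_m_test[OF _ summable_mult2[OF summable_wt, of C]]) (use bd in auto)
  then have "\<exists>g. \<forall>t\<in>{0..}. (\<lambda>n. wt n * S t n j) sums g t \<and> (g has_real_derivative g' t) (at t within {0..})"
    using summable_cong[THEN iffD1, OF always_eventually R_row(1)[of 0 j], of "\<lambda>n. wt n * S 0 n j"]
    by (intro has_field_derivative_series[where ?x0.0 = 0]) (auto intro: DERIV_cmult kernel_deriv[OF S] simp: R_S)
  then obtain g where
    g: "\<And>t. 0 \<le> t \<Longrightarrow> (\<lambda>n. wt n * S t n j) sums g t"
       "\<And>t. 0 \<le> t \<Longrightarrow> (g has_real_derivative g' t) (at t within {0..})"
    by auto
  have g_eq: "g t = (\<Sum>k. R t j k)" if "0 \<le> t" for t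
    using g(1)[OF that] by (simp add: R_S[OF that] sums_iff)
  have g_mono: "g (s + t) \<le> g s" if "0 \<le> s" "0 \<le> t" for s t
  proof -
    have "(\<Sum>k<N. R (s + t) j k) \<le> g s" for N
    proof -
      have sm: "summable (\<lambda>l. R s j l * R t l k)" for k
        using R_nn that R_le[OF that(2)] by (intro summable_comparison_test[OF _ R_row(1)[OF that(1), of j]])
          (auto intro!: exI[of _ 0] mult_left_le simp: abs_mult)
      have "(\<Sum>k<N. R (s + t) j k) = (\<Sum>k<N. \<Sum>l. R s j l * R t l k)"
        using R that by (simp add: Q_process_def)
      also have "\<dots> = (\<Sum>l. \<Sum>k<N. R s j l * R t l k)"
        using sm by (rule suminf_sum[symmetric])
      also have "\<dots> \<le> (\<Sum>l. R s j l)"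
      proof (rule suminf_le)
        fix l
        have "(\<Sum>k<N. R t l k) \<le> 1"
          using sum_le_suminf[OF R_row(1)[OF that(2), of l], of "{..<N}"] R_nn[OF that(2)] R_row(2)[OF that(2), of l]
          by auto
        then show "(\<Sum>k<N. R s j l * R t l k) \<le> R s j l"
          using R_nn[OF that(1), of j l] by (simp add: sum_distrib_left[symmetric] mult_left_le)
      qed (use sm R_row(1)[OF that(1)] in \<open>auto intro: summable_sum\<close>)
      finally show ?thesis using g_eq[OF that(1)] by simp
    qed
    then show ?thesis
      unfolding g_eq[OF add_nonneg_nonneg[OF that]]
      by (intro suminf_le_const R_row) (use that in auto)
  qed
  have g'_le: "g' t \<le> 0" if t: "0 \<le> t" for t
  proof (rule tendsto_upperbound)
    show "((\<lambda>s. (g s - g t) / (s - t)) \<longlongrightarrow> g' t) (at t within {0..})"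
      using g(2)[OF t] by (simp add: has_field_derivative_iff)
    have "(g s - g t) / (s - t) \<le> 0" if "0 \<le> s" for s
      using g_mono[of t "s - t"] g_mono[of s "t - s"] t that
      by (cases s t rule: linorder_cases) (auto simp: divide_nonpos_pos divide_nonneg_neg)
    then show "\<forall>\<^sub>F s in at t within {0..}. (g s - g t) / (s - t) \<le> 0"
      by (auto simp: eventually_at intro!: exI[of _ 1])
  qed (rule nontrivial_at_within_atLeast[OF t])
  have "flux S N j t \<le> C * wt_tail N" if t: "0 \<le> t" for N t
  proof -
    let ?f = "\<lambda>n. wt n * gen (\<lambda>k. S t k j) n"
    have sm: "summable ?f"
      using bd[OF t] by (intro summable_comparison_test[OF _ summable_mult2[OF summable_wt, of C]]) auto
    have "g' t = (\<Sum>k. ?f (k + Suc N)) + flux S N j t"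
      unfolding g'_def flux_eq_sum mu0 using suminf_split_initial_segment[OF sm, of "Suc N"]
      by (simp only: lessThan_Suc_atMost)
    moreover have "(\<Sum>k. - ?f (k + Suc N)) \<le> (\<Sum>k. wt (k + Suc N) * C)"
    proof (rule suminf_le)
      show "- ?f (k + Suc N) \<le> wt (k + Suc N) * C" for k
        using bd[OF t, of "k + Suc N"] by (simp only: real_norm_def abs_le_iff)
      show "summable (\<lambda>k. - ?f (k + Suc N))"
        by (intro summable_minus summable_ignore_initial_segment sm)
      show "summable (\<lambda>k. wt (k + Suc N) * C)"
        by (intro summable_mult2 summable_ignore_initial_segment summable_wt)
    qed
    moreover have "(\<Sum>k. - ?f (k + Suc N)) = - (\<Sum>k. ?f (k + Suc N))"
      by (intro suminf_minus summable_ignore_initial_segment sm)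
    moreover have "(\<Sum>k. wt (k + Suc N) * C) = wt_tail N * C"
      unfolding wt_tail_def by (intro suminf_mult2[symmetric] summable_ignore_initial_segment summable_wt)
    ultimately show ?thesis using g'_le[OF t] by (simp add: mult.commute)
  qed
  moreover have "(\<lambda>N. C * wt_tail N) \<longlonglongrightarrow> 0"
    using tendsto_mult_left[OF wt_tail_tendsto, of C] by simp
  ultimately show ?thesis by blast
qed

text \<open>Comparing \<open>R\<close> with \<open>T\<close> through \<open>\<Sum>\<^sub>k wt k * T s k i * S (t - s) k j\<close>: the boundary terms are the
  flux of \<open>T\<close>, which vanishes at infinity, and the flux of \<open>S\<close>, which is asymptotically nonpositive
  because the row sums of a \<open>Q\<close>-process decrease in time.\<close>

lemma honest_maximal:
  assumes T: "kernel T" and nn: "\<And>t i j. 0 \<le> t \<Longrightarrow> 0 \<le> T t i j"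
    and B: "\<And>t N i. 0 \<le> t \<Longrightarrow> T t N i \<le> B i"
    and fl: "\<And>i. \<exists>e. e \<longlonglongrightarrow> 0 \<and> (\<forall>N. \<forall>t\<ge>0. \<bar>flux T N i t\<bar> \<le> e N)"
    and mu0: "mu 0 = 0" and R: "Q_process lam mu R" and t: "0 \<le> t"
  shows "R t i j \<le> T t i j * wt j"
proof -
  define S where "S t i j = R t i j / wt j" for t i j
  have S: "kernel S" unfolding S_def by (rule Q_process_kernel[OF R])
  have R_nn: "0 \<le> R t i j" if "0 \<le> t" for t i j using R that by (simp add: Q_process_def)
  have R_row: "summable (R t i)" "(\<Sum>j. R t i j) \<le> 1" if "0 \<le> t" for t i
    using R that unfolding Q_process_def by blast+
  have R_le: "R t i j \<le> 1" if "0 \<le> t" for t i j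
    using sum_le_suminf[OF R_row(1)[OF that], of "{j}" i] R_row(2)[OF that, of i] R_nn[OF that] by auto
  obtain e where e: "e \<longlonglongrightarrow> 0" "\<And>N t. 0 \<le> t \<Longrightarrow> \<bar>flux T N i t\<bar> \<le> e N"
    using fl[of i] by blast
  obtain d0 where d0: "d0 \<longlonglongrightarrow> 0" "\<And>N t. 0 \<le> t \<Longrightarrow> flux S N j t \<le> d0 N"
    using Q_process_flux_le[OF R mu0, of j] unfolding S_def by blast
  \<comment> \<open>The absolute value makes the bound nonnegative, so that the factor
    \<open>T s N i\<close> may be enlarged to \<open>B i\<close>.\<close>
  define d where "d N = \<bar>d0 N\<bar>" for N
  have d: "d \<longlonglongrightarrow> 0" "\<And>N t. 0 \<le> t \<Longrightarrow> flux S N j t \<le> d N" "\<And>N. 0 \<le> d N"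
    using tendsto_rabs_zero[OF d0(1)] unfolding d_def by (auto intro: order.trans[OF d0(2) abs_ge_self])
  have B0: "0 \<le> B i" using nn[of 0 0 i] B[of 0 0 i] by simp
  define a where "a N = e N * (1 / wt j) + B i * d N" for N
  have le: "S t i j - a N * t \<le> T t i j" if N: "max i j \<le> N" for N
  proof -
    let ?F = "\<lambda>s. \<Sum>k\<le>N. wt k * (T s k i * S (t - s) k j)"
    have "?F 0 - a N * t \<le> ?F t"
    proof (rule deriv_lower_bound[OF t])
      fix s assume s: "0 \<le> s" "s \<le> t"
      show "(?F has_real_derivative flux T N i s * S (t - s) N j - T s N i * flux S N j (t - s)) (at s within {0..t})"
        using s by (intro compare_deriv[OF T] kernel_deriv_reflected[OF S]) auto
      have "\<bar>flux T N i s * S (t - s) N j\<bar> \<le> e N * (1 / wt j)"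
        unfolding abs_mult using e(2)[OF s(1), of N] R_nn[of "t - s" N j] R_le[of "t - s" N j] s
        by (intro mult_mono) (auto simp: S_def divide_right_mono less_imp_le)
      moreover have "T s N i * flux S N j (t - s) \<le> T s N i * d N"
        using s d(2) nn by (intro mult_left_mono) auto
      moreover have "T s N i * d N \<le> B i * d N"
        using s d(3) B by (intro mult_right_mono) auto
      ultimately show "- a N \<le> flux T N i s * S (t - s) N j - T s N i * flux S N j (t - s)"
        unfolding a_def by linarith
    qed
    moreover have "?F 0 = S t i j"
      using sum_at_0[OF T, of i N "\<lambda>k. S t k j"] N by (simp add: mult.assoc)
    moreover have "?F t = T t i j"
      using sum_at_0[OF S, of j N "\<lambda>k. T t k i"] N kernel_sym[OF T t] by (simp add: mult_ac)
    ultimately show ?thesis by simp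
  qed
  have "S t i j \<le> T t i j"
  proof (rule LIMSEQ_le_const2)
    have "(\<lambda>N. S t i j - a N * t) \<longlonglongrightarrow> S t i j - (0 * (1 / wt j) + B i * 0) * t"
      unfolding a_def by (intro tendsto_intros e d)
    then show "(\<lambda>N. S t i j - a N * t) \<longlonglongrightarrow> S t i j" by simp
    show "\<exists>N0. \<forall>N\<ge>N0. S t i j - a N * t \<le> T t i j" using le by blast
  qed
  then show ?thesis by (simp add: S_def pos_divide_le_eq)
qed

end

text \<open>The reflecting counterpart of \<open>dirichlet_Q_process\<close>: now the flux decays
  and the kernel is merely bounded.\<close>

lemma neumann_Q_process:
  assumes S: "kernel S" and B: "\<And>t N i. 0 \<le> t \<Longrightarrow> \<bar>S t N i\<bar> \<le> B i"
    and fl: "\<And>i. \<exists>e. e \<longlonglongrightarrow> 0 \<and> (\<forall>N. \<forall>t\<ge>0. \<bar>flux S N i t\<bar> \<le> e N)"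
  shows "Q_process lam mu (\<lambda>t i j. S t i j * wt j)" "flux_vanishing S"
proof -
  show van: "flux_vanishing S"
    unfolding flux_vanishing_def
  proof (intro allI)
    fix i j
    obtain e where e: "e \<longlonglongrightarrow> 0" "\<And>N t. 0 \<le> t \<Longrightarrow> \<bar>flux S N i t\<bar> \<le> e N"
      using fl[of i] by blast
    have "\<bar>flux S N i s * S t N j\<bar> \<le> e N * B j" if "0 \<le> s" "0 \<le> t" for N s t
      unfolding abs_mult using e(2)[OF that(1), of N] B[OF that(2), of N j] by (intro mult_mono) auto
    moreover have "(\<lambda>N. e N * B j) \<longlonglongrightarrow> 0"
      using tendsto_mult_right[OF e(1), of "B j"] by simp
    ultimately show "\<exists>e. e \<longlonglongrightarrow> 0 \<and> (\<forall>N. \<forall>s\<ge>0. \<forall>t\<ge>0. \<bar>flux S N i s * S t N j\<bar> \<le> e N)"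
      by blast
  qed
  have "\<exists>e. e \<longlonglongrightarrow> 0 \<and> (\<forall>N. \<forall>t\<ge>0. flux S N i t \<le> e N)" for i
  proof -
    obtain e where "e \<longlonglongrightarrow> 0" "\<forall>N. \<forall>t\<ge>0. \<bar>flux S N i t\<bar> \<le> e N"
      using fl[of i] by blast
    then show ?thesis by (intro exI[of _ e]) (auto dest: abs_le_D1)
  qed
  then show "Q_process lam mu (\<lambda>t i j. S t i j * wt j)"
    by (intro kernel_Q_process[OF S van])
qed

end

section \<open>Birth-death polynomials and duality\<close>

lemma bd_poly_monic: "degree (bd_poly lam mu n) = n \<and> lead_coeff (bd_poly lam mu n) = 1"
proof (induction lam mu n rule: bd_poly.induct)
  case (3 lam mu n)
  let ?p = "[:- lam (Suc n) - mu (Suc n), 1:] * bd_poly lam mu (Suc n)"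
  have "bd_poly lam mu (Suc n) \<noteq> 0" using 3(1) by auto
  then have p1: "degree ?p = Suc (Suc n)"
    using 3(1) by (subst degree_mult_eq) auto
  have p2: "lead_coeff ?p = 1"
    unfolding lead_coeff_mult using conjunct1[OF 3(1)] conjunct2[OF 3(1)] by simp
  have less: "degree (- smult (lam n * mu (Suc n)) (bd_poly lam mu n)) < degree ?p"
    using 3(2) unfolding p1 degree_minus by (intro le_less_trans[OF degree_smult_le]) simp
  have eq: "bd_poly lam mu (Suc (Suc n)) = ?p + - smult (lam n * mu (Suc n)) (bd_poly lam mu n)"
    by simp
  have "degree (bd_poly lam mu (Suc (Suc n))) = Suc (Suc n)"
    unfolding eq degree_add_eq_left[OF less] by (rule p1)
  moreover have "coeff (bd_poly lam mu (Suc (Suc n))) (Suc (Suc n)) = 1"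
    using p2 coeff_eq_0[OF less] unfolding eq coeff_add p1 by simp
  ultimately show ?case by (simp del: bd_poly.simps)
qed auto

context birth_death
begin

text \<open>The Karlin-McGregor normalisation of the monic polynomials, in which \<open>gen\<close>
  acts as multiplication by \<open>-x\<close> and the squared norms are
  \<open>1 / wt n\<close>.\<close>

definition bdq :: "nat \<Rightarrow> real poly" where
  "bdq n = smult ((-1) ^ n / (\<Prod>k<n. lam k)) (bd_poly lam mu n)"

lemma prod_lam_pos [simp]: "0 < (\<Prod>k<n. lam k)"
  by (intro prod_pos) auto

lemma degree_bdq [simp]: "degree (bdq n) = n"
  using bd_poly_monic[of lam mu n] prod_lam_pos[of n, THEN less_imp_neq] by (simp add: bdq_def)

lemma bdq_0 [simp]: "bdq 0 = 1"
  by (simp add: bdq_def)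

lemma poly_eqI_eval: "(\<And>x. poly p x = poly q x) \<Longrightarrow> p = (q :: real poly)"
  by (subst poly_eq_poly_eq_iff[symmetric]) (rule ext)

lemma gen_bdq: "gen (\<lambda>k. poly (bdq k) x) n = - x * poly (bdq n) x"
proof (induction n rule: nat.induct)
  case zero
  show ?case using lam_pos[of 0, THEN less_imp_neq] by (simp add: gen_def bdq_def field_simps)
next
  case (Suc n)
  define c where "c = (-1) ^ n / (\<Prod>k<n. lam k)"
  define l where "l = lam n"
  define l' where "l' = lam (Suc n)"
  have ne: "l \<noteq> 0" "l' \<noteq> 0" using lam_pos[THEN less_imp_neq] by (auto simp: l_def l'_def)
  have q: "bdq n = smult c (bd_poly lam mu n)" "bdq (Suc n) = smult (- c / l) (bd_poly lam mu (Suc n))"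
    "bdq (Suc (Suc n)) = smult (c / (l * l')) (bd_poly lam mu (Suc (Suc n)))"
    by (simp_all add: bdq_def c_def l_def l'_def mult.assoc del: bd_poly.simps)
  show ?case
    using ne unfolding gen_def prev_simps q l'_def[symmetric]
    by (simp add: l_def[symmetric] l'_def[symmetric] field_simps)
qed

definition orthogonal :: "real measure \<Rightarrow> bool" where
  "orthogonal M \<longleftrightarrow> (\<forall>i j. (\<integral>x. poly (bdq i * bdq j) x \<partial>M) = (if i = j then 1 / wt j else 0))"

definition lap_kernel :: "real measure \<Rightarrow> real \<Rightarrow> nat \<Rightarrow> nat \<Rightarrow> real" where
  "lap_kernel M t i j = lap M t (bdq i * bdq j)"

lemma corresponding_formula:
  "(-1) ^ (i + j) / ((\<Prod>k<i. lam k) * (\<Prod>k=1..j. mu k)) *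
     (LINT x:{0..}|M. exp (- x * t) * poly (bd_poly lam mu i) x * poly (bd_poly lam mu j) x)
   = lap_kernel M t i j * wt j"
proof -
  have "bdq i * bdq j = smult ((-1) ^ (i + j) / ((\<Prod>k<i. lam k) * (\<Prod>k<j. lam k)))
      (bd_poly lam mu i * bd_poly lam mu j)"
    by (simp add: bdq_def power_add mult.commute)
  then have "lap_kernel M t i j = (-1) ^ (i + j) / ((\<Prod>k<i. lam k) * (\<Prod>k<j. lam k)) *
      lap M t (bd_poly lam mu i * bd_poly lam mu j)"
    unfolding lap_kernel_def by (simp add: lap_smult)
  then show ?thesis
    using prod_lam_pos[of j, THEN less_imp_neq]
    by (simp add: lap_def pi_coeff_def mult.assoc)
qed

lemma corresponding_measure_iff:
  "corresponding_measure lam mu P M \<longleftrightarrow>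
    stieltjes_measure M \<and> (\<forall>t\<ge>0. \<forall>i j. P t i j = lap_kernel M t i j * wt j)"
  unfolding corresponding_measure_def corresponding_formula by simp

lemma gen_lap:
  assumes st: "stieltjes_measure M" and t: "0 \<le> t"
  shows "gen (\<lambda>k. lap M t (bdq k * p)) n = - lap M t ([:0, 1:] * (bdq n * p))"
proof -
  define f where "f r = lap M t (r * p)" for r
  have f_diff: "f (a - b) = f a - f b" for a b
    unfolding f_def left_diff_distrib by (rule lap_diff[OF st t])
  have f_smult: "f (smult c a) = c * f a" for c a
    unfolding f_def mult_smult_left by (rule lap_smult)
  have "gen (\<lambda>k. f (bdq k)) n = f (smult (- 1) ([:0, 1:] * bdq n))"
  proof (cases n)
    case 0
    have "smult (lam 0) (bdq 1 - bdq 0) - smult (mu 0) (bdq 0) = smult (- 1) ([:0, 1:] * bdq 0)"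
      using gen_bdq[of _ 0] by (intro poly_eqI_eval) (simp add: gen_def)
    then have "f (smult (lam 0) (bdq 1 - bdq 0) - smult (mu 0) (bdq 0)) = f (smult (- 1) ([:0, 1:] * bdq 0))"
      by (rule arg_cong)
    then show ?thesis
      unfolding 0 gen_def prev_simps by (simp only: f_diff f_smult One_nat_def diff_zero)
  next
    case (Suc k)
    have "smult (lam n) (bdq (Suc n) - bdq n) - smult (mu n) (bdq n - bdq k) = smult (- 1) ([:0, 1:] * bdq n)"
      using gen_bdq[of _ n] Suc by (intro poly_eqI_eval) (simp add: gen_def)
    then have "f (smult (lam n) (bdq (Suc n) - bdq n) - smult (mu n) (bdq n - bdq k))
        = f (smult (- 1) ([:0, 1:] * bdq n))"
      by (rule arg_cong)
    then show ?thesis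
      unfolding Suc gen_def prev_simps by (simp only: f_diff f_smult)
  qed
  also have "\<dots> = - lap M t ([:0, 1:] * (bdq n * p))"
    unfolding f_smult by (simp only: f_def mult.assoc)
  finally show ?thesis by (simp only: f_def)
qed

text \<open>Differentiating in time and applying \<open>gen\<close> to \<open>bdq\<close> both
  produce the factor \<open>-x\<close> under the integral; orthogonality supplies the initial
  condition.\<close>

lemma kernel_lap:
  assumes st: "stieltjes_measure M" and orth: "orthogonal M"
  shows "kernel (lap_kernel M)"
  unfolding kernel_def
proof (intro conjI allI impI)
  fix t :: real and i j assume t: "0 \<le> t"
  show "((\<lambda>s. lap_kernel M s i j) has_real_derivative gen (\<lambda>k. lap_kernel M t k j) i) (at t within {0..})"
    using lap_has_derivative[OF st t, of "bdq i * bdq j"] unfolding lap_kernel_def gen_lap[OF st t] .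
  show "lap_kernel M t i j = lap_kernel M t j i" by (simp add: lap_kernel_def mult.commute)
next
  fix i j
  show "lap_kernel M 0 i j = (if i = j then 1 / wt j else 0)"
    using orth by (simp add: lap_kernel_def lap_zero[OF st] orthogonal_def)
qed

lemma orthogonal_corresponding:
  assumes "Q_process lam mu P" "corresponding_measure lam mu P M"
  shows "orthogonal M"
  unfolding orthogonal_def
proof (intro allI)
  fix i j
  have "stieltjes_measure M" using assms(2) by (simp add: corresponding_measure_iff)
  moreover have "P 0 i j = lap_kernel M 0 i j * wt j"
    using assms(2) by (simp add: corresponding_measure_iff)
  moreover have "P 0 i j = (if i = j then 1 else 0)"
    using assms(1) by (simp add: Q_process_def)
  ultimately show "(\<integral>x. poly (bdq i * bdq j) x \<partial>M) = (if i = j then 1 / wt j else 0)"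
    using wt_pos[of j, THEN less_imp_neq] unfolding lap_kernel_def by (auto simp: lap_zero field_simps split: if_splits)
qed

lemma orthogonal_same_moments:
  assumes "orthogonal M" "stieltjes_measure M" "stieltjes_solution M N"
  shows "orthogonal N"
proof -
  have "(\<integral>x. poly (bdq i * bdq j) x \<partial>N) = (\<integral>x. poly (bdq i * bdq j) x \<partial>M)" for i j
    using assms by (intro same_moments_poly) (auto simp: stieltjes_solution_def intro: stieltjes_power)
  with assms(1) show ?thesis unfolding orthogonal_def by metis
qed

lemma integral_bdq:
  assumes "orthogonal M"
  shows "(\<integral>x. poly (bdq k) x \<partial>M) = (if k = 0 then 1 else 0)"
  using assms[unfolded orthogonal_def, rule_format, of k 0] by simp

end

section \<open>Dual rates and dual polynomials\<close>

locale killed_birth_death = birth_death +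
  assumes mu0_pos: "0 < mu 0"
begin

sublocale dual: birth_death "dual_birth lam mu" "dual_death lam mu"
proof
  show "rate_set (dual_birth lam mu) (dual_death lam mu)"
    unfolding rate_set_def
  proof (intro conjI allI)
    show "0 < dual_birth lam mu n" for n
      using mu0_pos mu_Suc_pos by (cases n) (simp_all add: dual_birth_def)
  qed (simp_all add: dual_death_def)
qed

text \<open>An invariant that follows from detailed balance for both rate sets. It shows that, up to
  the factor \<open>mu 0\<close>, dual weights are resistances of the original chain and dual
  conductances are reciprocals of its weights.\<close>

lemma dual_wt_mult: "dual.wt n * (mu n * wt n) = mu 0"
proof (induction n)
  case (Suc n)
  have "dual.wt (Suc n) * (mu (Suc n) * wt (Suc n)) = (lam n * dual.wt (Suc n)) * wt n"
    unfolding wt_Suc by (simp add: cond_def)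
  also have "lam n * dual.wt (Suc n) = mu n * dual.wt n"
    using dual.wt_Suc[of n] by (simp add: dual.cond_def dual_birth_def[of _ _ n] dual_death_def[of _ _ "Suc n"])
  finally show ?case using Suc by (simp add: mult_ac)
qed simp

lemma dual_wt_Suc: "dual.wt (Suc n) = mu 0 / cond n"
  using dual_wt_mult[of "Suc n"] cond_pos[of n, THEN less_imp_neq] unfolding wt_Suc by (simp add: field_simps)

lemma dual_cond: "dual.cond n = mu 0 / wt n"
  using dual_wt_mult[of n] wt_pos[of n, THEN less_imp_neq] by (simp add: dual.cond_def dual_birth_def[of _ _ n] field_simps)

text \<open>The second-order recurrences of both families factor into two first-order relations:
  each family is, up to weights and a factor \<open>x\<close>, the increment of the other. Neither
  relation is inductive alone, so both are proved together.\<close>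

lemma dual_bdq_eval:
  "dual.wt n * poly (dual.bdq n) x = poly (bdq n) x - prev (\<lambda>k. poly (bdq k) x) n \<and>
   poly (dual.bdq (Suc n)) x = poly (dual.bdq n) x - x * (wt n / mu 0 * poly (bdq n) x)"
proof (induction n)
  case 0
  show ?case
    using dual.gen_bdq[of x 0] mu0_pos
    by (simp add: dual.gen_def dual_birth_def[of _ _ 0] dual_death_def[of _ _ 0] field_simps)
next
  case (Suc n)
  note IH = Suc.IH
  have "cond n * (poly (bdq (Suc n)) x - poly (bdq n) x) = mu 0 * poly (dual.bdq (Suc n)) x"
  proof (cases n)
    case 0
    then show ?thesis
      using Suc wt_gen_0[of "\<lambda>k. poly (bdq k) x"] mu0_pos by (simp add: gen_bdq field_simps)
  next
    case (Suc m)
    have "wt n * gen (\<lambda>k. poly (bdq k) x) n = cond n * (poly (bdq (Suc n)) x - poly (bdq n) x)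
        - cond m * (poly (bdq n) x - poly (bdq m) x)"
      unfolding Suc by (rule wt_gen_Suc)
    moreover have "cond m * (dual.wt n * poly (dual.bdq n) x) = mu 0 * poly (dual.bdq n) x"
      using cond_pos[of m, THEN less_imp_neq] unfolding Suc dual_wt_Suc by simp
    moreover have "dual.wt n * poly (dual.bdq n) x = poly (bdq n) x - poly (bdq m) x"
      using conjunct1[OF IH] unfolding Suc by simp
    moreover have "mu 0 * poly (dual.bdq (Suc n)) x = mu 0 * poly (dual.bdq n) x - x * wt n * poly (bdq n) x"
      using conjunct2[OF IH] mu0_pos by (simp add: field_simps)
    ultimately show ?thesis
      by (simp add: gen_bdq mult_ac)
  qed
  then have A: "dual.wt (Suc n) * poly (dual.bdq (Suc n)) x = poly (bdq (Suc n)) x - poly (bdq n) x"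
    using cond_pos[of n, THEN less_imp_neq] unfolding dual_wt_Suc by (simp add: field_simps)
  have d: "poly (dual.bdq (Suc n)) x - poly (dual.bdq n) x = - x * (wt n / mu 0 * poly (bdq n) x)"
    using conjunct2[OF IH] by simp
  have "mu (Suc n) * (poly (dual.bdq (Suc (Suc n))) x - poly (dual.bdq (Suc n)) x)
    = - x * poly (dual.bdq (Suc n)) x + lam n * (poly (dual.bdq (Suc n)) x - poly (dual.bdq n) x)"
    using dual.gen_bdq[of x "Suc n"]
    by (simp add: dual.gen_def dual_birth_def[of _ _ "Suc n"] dual_death_def[of _ _ "Suc n"])
  also have "\<dots> = - x * (poly (dual.bdq (Suc n)) x + cond n / mu 0 * poly (bdq n) x)"
    unfolding d by (simp add: cond_def algebra_simps)
  also have "\<dots> = - x * (cond n / mu 0 * (poly (bdq (Suc n)) x - poly (bdq n) x) + cond n / mu 0 * poly (bdq n) x)"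
    using A cond_pos[of n, THEN less_imp_neq] mu0_pos unfolding dual_wt_Suc by (simp add: field_simps)
  finally have "mu (Suc n) * (poly (dual.bdq (Suc (Suc n))) x - poly (dual.bdq (Suc n)) x)
    = mu (Suc n) * (- x * (wt (Suc n) / mu 0 * poly (bdq (Suc n)) x))"
    unfolding wt_Suc[of n, symmetric] by (simp add: algebra_simps)
  then have "poly (dual.bdq (Suc (Suc n))) x - poly (dual.bdq (Suc n)) x
    = - x * (wt (Suc n) / mu 0 * poly (bdq (Suc n)) x)"
    using mu_Suc_pos[of n, THEN less_imp_neq] by (simp only: mult_cancel_left) auto
  with A show ?case by simp
qed

lemma bdq_Suc: "bdq (Suc n) = bdq n + smult (dual.wt (Suc n)) (dual.bdq (Suc n))"
proof (rule poly_eqI_eval)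
  show "poly (bdq (Suc n)) x = poly (bdq n + smult (dual.wt (Suc n)) (dual.bdq (Suc n))) x" for x
    using conjunct1[OF dual_bdq_eval[of "Suc n" x]] by simp
qed

lemma dual_bdq_Suc: "dual.bdq (Suc n) = dual.bdq n - smult (wt n / mu 0) ([:0, 1:] * bdq n)"
proof (rule poly_eqI_eval)
  show "poly (dual.bdq (Suc n)) x = poly (dual.bdq n - smult (wt n / mu 0) ([:0, 1:] * bdq n)) x" for x
    using conjunct2[OF dual_bdq_eval[of n x]] by simp
qed

lemma dual_bdq_at_0 [simp]: "poly (dual.bdq n) 0 = 1"
proof (induction n)
  case (Suc n)
  then show ?case unfolding dual_bdq_Suc by simp
qed simp

lemma bdq_at_0: "poly (bdq n) 0 = (\<Sum>k\<le>n. dual.wt k)"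
proof (induction n)
  case (Suc n)
  have "poly (bdq (Suc n)) 0 = poly (bdq n) 0 + dual.wt (Suc n) * poly (dual.bdq (Suc n)) 0"
    by (simp only: bdq_Suc[of n] poly_add poly_smult)
  then show ?case by (simp only: Suc dual_bdq_at_0 mult_1_right sum.atMost_Suc)
qed simp

end

section \<open>Inverse moments and the minimal process\<close>

lemma emeasure_lborel_atLeast: "emeasure lborel {a::real..} = \<infinity>"
proof -
  have "ennreal (real n) \<le> emeasure lborel {a..}" for n :: nat
  proof -
    have "emeasure lborel {a..a + real n} \<le> emeasure lborel {a..}" by (rule emeasure_mono) auto
    then show ?thesis by simp
  qed
  then have "emeasure lborel {a..} = top"
    by (metis ennreal_of_nat_eq_real_of_nat ennreal_Ex_less_of_nat not_le top.not_eq_extremum)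
  then show ?thesis by simp
qed

text \<open>At \<open>x = 0\<close> both sides are infinite, in agreement with the treatment of an
  atom at the origin in \<open>m_neg1\<close>.\<close>

lemma nn_integral_exp_decay:
  assumes "0 \<le> x"
  shows "(\<integral>\<^sup>+t. ennreal (exp (- x * t)) * indicator {0..} t \<partial>lborel) = inverse (ennreal x)"
proof (cases "x = 0")
  case True
  then show ?thesis by (simp add: emeasure_lborel_atLeast)
next
  case False
  with assms have x: "x > 0" by simp
  have "(\<integral>\<^sup>+t. ennreal (exp (- x * t)) * indicator {0..} t \<partial>lborel) = ennreal (0 - (- exp (- x * 0) / x))"
  proof (rule nn_integral_FTC_atLeast)
    show "DERIV (\<lambda>t. - exp (- x * t) / x) t :> exp (- x * t)" for t
      using x by (auto intro!: derivative_eq_intros)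
    have "((\<lambda>t. exp (- (x * t))) \<longlongrightarrow> 0) at_top"
      using x by (intro filterlim_compose[OF exp_at_bot] filterlim_compose[OF filterlim_uminus_at_bot_at_top]
          filterlim_tendsto_pos_mult_at_top[OF tendsto_const _ filterlim_ident])
    then have "((\<lambda>t. - exp (- (x * t)) / x) \<longlongrightarrow> - 0 / x) at_top"
      using x by (intro tendsto_intros) auto
    then show "((\<lambda>t. - exp (- x * t) / x) \<longlongrightarrow> 0) at_top"
      by simp
  qed auto
  also have "\<dots> = inverse (ennreal x)"
    using x by (simp add: inverse_ennreal inverse_eq_divide)
  finally show ?thesis .
qed

text \<open>Tonelli's theorem. For the measure of a process, \<open>lap M t 1\<close> is the
  probability of being in state \<open>0\<close> at time \<open>t\<close> after starting there, so
  the inverse moment is the expected time spent in that state; this makes it monotone in the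
  process.\<close>

lemma m_neg1_laplace:
  assumes st: "stieltjes_measure M"
  shows "m_neg1 M = (\<integral>\<^sup>+t. ennreal (lap M t 1) * indicator {0..} t \<partial>lborel)"
proof -
  interpret M: prob_space M by (rule stieltjes_prob[OF st])
  interpret P: pair_sigma_finite M lborel by standard
  have [measurable_cong]: "sets M = sets borel" by (rule stieltjes_sets[OF st])
  define f where "f x t = indicator {0..} x * (ennreal (exp (- x * t)) * indicator {0..} t)" for x t :: real
  have "m_neg1 M = (\<integral>\<^sup>+x. (\<integral>\<^sup>+t. f x t \<partial>lborel) \<partial>M)"
    unfolding m_neg1_def
  proof (rule nn_integral_cong)
    fix x
    have "(\<integral>\<^sup>+t. f x t \<partial>lborel) = indicator {0..} x * (\<integral>\<^sup>+t. ennreal (exp (- x * t)) * indicator {0..} t \<partial>lborel)"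
      unfolding f_def by (rule nn_integral_cmult) simp
    also have "\<dots> = inverse (ennreal x) * indicator {0..} x"
    proof (cases "0 \<le> x")
      case True
      show ?thesis unfolding nn_integral_exp_decay[OF True] by (rule mult.commute)
    qed simp
    finally show "inverse (ennreal x) * indicator {0..} x = (\<integral>\<^sup>+t. f x t \<partial>lborel)" ..
  qed
  also have "\<dots> = (\<integral>\<^sup>+t. (\<integral>\<^sup>+x. f x t \<partial>M) \<partial>lborel)"
  proof (rule P.Fubini'[symmetric])
    show "(\<lambda>(x, t). f x t) \<in> borel_measurable (M \<Otimes>\<^sub>M lborel)"
      unfolding f_def measurable_cong_sets[OF sets_pair_measure_cong[OF stieltjes_sets[OF st] sets_lborel] refl]
      by measurable
  qed
  also have "\<dots> = (\<integral>\<^sup>+t. ennreal (lap M t 1) * indicator {0..} t \<partial>lborel)"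
  proof (rule nn_integral_cong)
    fix t :: real
    show "(\<integral>\<^sup>+x. f x t \<partial>M) = ennreal (lap M t 1) * indicator {0..} t"
    proof (cases "0 \<le> t")
      case True
      have "(\<integral>\<^sup>+x. f x t \<partial>M) = (\<integral>\<^sup>+x. ennreal (indicator {0..} x * (exp (- x * t) * poly 1 x)) \<partial>M)"
        using True by (intro nn_integral_cong) (simp add: f_def split: split_indicator)
      also have "\<dots> = ennreal (\<integral>x. indicator {0..} x * (exp (- x * t) * poly 1 x) \<partial>M)"
        using lap_integrable[OF st True, of 1]
        by (intro nn_integral_eq_integral) (auto simp: set_integrable_def)
      finally show ?thesis using True by (simp add: lap_def set_lebesgue_integral_def)
    qed (simp add: f_def)
  qed
  finally show ?thesis .
qed

text \<open>A finite inverse moment excludes an atom at \<open>0\<close>. From here on the real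
  quotient \<open>1 / x\<close>, which is \<open>0\<close> at the origin, may replace the extended
  one.\<close>

lemma m_neg1_finite:
  assumes st: "stieltjes_measure M" and fin: "m_neg1 M < \<infinity>"
  shows "AE x in M. 0 < x" "integrable M (\<lambda>x. 1 / x)" "m_neg1 M = ennreal (\<integral>x. 1 / x \<partial>M)"
proof -
  have [measurable_cong]: "sets M = sets borel" by (rule stieltjes_sets[OF st])
  have "(\<lambda>x. inverse (ennreal x) * indicator {0..} x) \<in> borel_measurable M"
    unfolding measurable_cong_sets[OF stieltjes_sets[OF st] refl]
    by (intro borel_measurable_times_ennreal measurable_compose[OF _ borel_measurable_inverse_ennreal]) measurable
  then have "AE x in M. inverse (ennreal x) * indicator {0..} x \<noteq> \<infinity>"
    using fin unfolding m_neg1_def by (intro nn_integral_noteq_infinite) auto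
  then show pos: "AE x in M. 0 < x"
    using stieltjes_nonneg[OF st] by eventually_elim (auto simp: less_le)
  have eq: "m_neg1 M = (\<integral>\<^sup>+x. ennreal (1 / x) \<partial>M)"
    unfolding m_neg1_def
    by (rule nn_integral_cong_AE) (use pos in eventually_elim, simp add: inverse_ennreal inverse_eq_divide)
  show int: "integrable M (\<lambda>x. 1 / x)"
  proof (rule integrableI_nonneg)
    show "AE x in M. 0 \<le> 1 / x" using pos by eventually_elim simp
    show "(\<integral>\<^sup>+x. ennreal (1 / x) \<partial>M) < \<infinity>" using fin eq by simp
    show "(\<lambda>x. 1 / x) \<in> borel_measurable M"
      unfolding measurable_cong_sets[OF stieltjes_sets[OF st] refl] by measurable
  qed
  show "m_neg1 M = ennreal (\<integral>x. 1 / x \<partial>M)"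
    unfolding eq using int pos by (intro nn_integral_eq_integral) (auto elim: eventually_mono)
qed

text \<open>The quotient \<open>poly p x / x\<close> is \<open>0\<close> at \<open>x = 0\<close>; below, \<open>0\<close> is a null set.\<close>

definition invint :: "real measure \<Rightarrow> real poly \<Rightarrow> real" where
  "invint M p = (\<integral>x. poly p x / x \<partial>M)"

context
  fixes M :: "real measure"
  assumes int: "\<And>p. integrable M (poly p)" and pos: "AE x in M. 0 < x" and inv: "integrable M (\<lambda>x. 1 / x)"
    and sets: "sets M = sets borel"
begin

lemma pCons_over: "AE x in M. poly (pCons c q) x / x = c * (1 / x) + poly q x"
  using pos by eventually_elim (simp add: field_simps)

lemma invint_integrable: "integrable M (\<lambda>x. poly p x / x)"
proof (cases p)
  case (pCons c q)
  have "integrable M (\<lambda>x. c * (1 / x) + poly q x)"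
    by (intro Bochner_Integration.integrable_add integrable_mult_right inv int)
  moreover have "(\<lambda>x. poly p x / x) \<in> borel_measurable M"
    unfolding measurable_cong_sets[OF sets refl] by measurable
  ultimately show ?thesis
    unfolding pCons using pCons_over[of c q]
    by (subst integrable_cong_AE) (auto intro: borel_measurable_integrable)
qed

lemma invint_pCons: "invint M (pCons c q) = c * (\<integral>x. 1 / x \<partial>M) + (\<integral>x. poly q x \<partial>M)"
proof -
  have "invint M (pCons c q) = (\<integral>x. c * (1 / x) + poly q x \<partial>M)"
    unfolding invint_def
  proof (rule integral_cong_AE[OF _ _ pCons_over])
    show "(\<lambda>x. poly (pCons c q) x / x) \<in> borel_measurable M"
      by (rule borel_measurable_integrable[OF invint_integrable])
    show "(\<lambda>x. c * (1 / x) + poly q x) \<in> borel_measurable M"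
      unfolding measurable_cong_sets[OF sets refl] by measurable
  qed
  also have "\<dots> = c * (\<integral>x. 1 / x \<partial>M) + (\<integral>x. poly q x \<partial>M)"
    unfolding Bochner_Integration.integral_add[OF integrable_mult_right[OF inv] int] by (simp del: times_divide_eq_right)
  finally show ?thesis .
qed

lemma invint_add: "invint M (p + q) = invint M p + invint M q"
  and invint_diff: "invint M (p - q) = invint M p - invint M q"
  and invint_smult: "invint M (smult c p) = c * invint M p"
  using invint_integrable unfolding invint_def
  by (simp_all add: add_divide_distrib diff_divide_distrib flip: times_divide_eq_right)

lemma invint_square: "0 \<le> invint M (p * p)"
  unfolding invint_def using pos by (intro integral_nonneg_AE) (auto elim!: eventually_mono)

end

section \<open>The value of the inverse moment for a convergent series\<close>

locale regular_birth_death = killed_birth_death +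
  assumes summ: "summable (\<lambda>n. wt n + 1 / (lam n * wt n))"
begin

lemma summable_wt: "summable wt"
  by (rule summable_comparison_test[OF _ summ]) (auto simp: less_imp_le)

lemma summable_cond: "summable (\<lambda>n. 1 / cond n)"
  by (rule summable_comparison_test[OF _ summ]) (auto simp: less_imp_le cond_def)

definition scale :: real where "scale = (\<Sum>n. 1 / cond n)"

lemma scale_pos: "0 < scale"
  unfolding scale_def by (intro suminf_pos summable_cond) auto

lemma partial_scale_le: "(\<Sum>k<n. 1 / cond k) \<le> scale"
  unfolding scale_def by (intro sum_le_suminf summable_cond) (auto simp: less_imp_le)

text \<open>The Green function at state \<open>0\<close> of the chain absorbed at infinity: the
  conductances \<open>mu 0\<close> towards \<open>-1\<close> and \<open>1 / scale\<close> towards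
  infinity act in parallel.\<close>

definition green :: real where "green = scale / (1 + mu 0 * scale)"

lemma green_pos: "0 < green" and green_less: "mu 0 * green < 1"
  using scale_pos mu0_pos by (auto simp: green_def field_simps add_pos_pos)

text \<open>Sum the increments given by duality. Each increment of \<open>dual.bdq\<close> contains
  a factor \<open>x\<close> that cancels the denominator, so only \<open>k = 0\<close> contributes,
  and the integral of \<open>dual.bdq k / x\<close> is constant from \<open>k = 1\<close> on. Only
  the integrals of \<open>bdq k\<close> with \<open>k < i\<close> enter, so the formula also covers
  quadrature measures.\<close>

lemma invint_bdq:
  assumes M: "\<And>p. integrable M (poly p)" "AE x in M. 0 < x" "integrable M (\<lambda>x. 1 / x)" "sets M = sets borel"
    and orth: "\<And>k. k < i \<Longrightarrow> (\<integral>x. poly (bdq k) x \<partial>M) = (if k = 0 then 1 else 0)"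
  shows "invint M (bdq i) = (\<integral>x. 1 / x \<partial>M) - (1 - mu 0 * (\<integral>x. 1 / x \<partial>M)) * (\<Sum>k<i. 1 / cond k)"
  using orth
proof (induction i)
  case 0
  show ?case using invint_pCons[OF M, of 1 0] by (simp add: one_pCons poly_0[abs_def] flip: one_pCons)
next
  case (Suc n)
  define m where "m = (\<integral>x. 1 / x \<partial>M)"
  have dual_step: "invint M (dual.bdq (Suc k)) = invint M (dual.bdq k) - wt k / mu 0 * (\<integral>x. poly (bdq k) x \<partial>M)" for k
    unfolding dual_bdq_Suc invint_diff[OF M] invint_smult[OF M] by (simp add: invint_pCons[OF M])
  have dual_0: "invint M (dual.bdq 0) = m"
    using invint_pCons[OF M, of 1 0] by (simp add: m_def poly_0[abs_def] flip: one_pCons)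
  have dual: "invint M (dual.bdq (Suc k)) = m - 1 / mu 0" if "k \<le> n" for k
    using that
  proof (induction k)
    case 0 then show ?case using Suc.prems[of 0] by (simp only: dual_step dual_0) simp
  next
    case (Suc k) then show ?case using Suc.prems \<open>\<And>k. k < Suc n \<Longrightarrow> _\<close>[of "Suc k"] by (simp only: dual_step[of "Suc k"]) simp
  qed
  have "invint M (bdq (Suc n)) = invint M (bdq n) + mu 0 / cond n * (m - 1 / mu 0)"
    unfolding bdq_Suc[of n] invint_add[OF M] invint_smult[OF M] dual[OF order.refl] dual_wt_Suc ..
  also have "mu 0 / cond n * (m - 1 / mu 0) = (mu 0 * m - mu 0 * (1 / mu 0)) / cond n"
    by (simp add: right_diff_distrib diff_divide_distrib)
  also have "\<dots> = (mu 0 * m - 1) / cond n"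
    using mu0_pos by simp
  finally show ?case
    using Suc by (simp add: m_def[symmetric] diff_divide_distrib algebra_simps)
qed

lemma bdq_orthogonal_lower:
  assumes st: "stieltjes_measure M" and orth: "orthogonal M" and "degree p < n"
  shows "(\<integral>x. poly (bdq n * p) x \<partial>M) = 0"
  by (rule orthogonal_lower_degree[where q = bdq, OF stieltjes_poly[OF st]])
    (use orth assms(3) in \<open>simp_all add: orthogonal_def del: poly_mult\<close>)

lemma bdq_at_0_pos: "0 < poly (bdq n) 0"
  unfolding bdq_at_0 by (intro sum_pos) auto

lemma bdq_at_0_le: "poly (bdq n) 0 \<le> 1 + mu 0 * scale"
proof -
  have "(\<Sum>k\<le>n. dual.wt k) = 1 + mu 0 * (\<Sum>k<n. 1 / cond k)"
    by (induction n) (simp_all add: dual_wt_Suc algebra_simps)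
  then show ?thesis
    unfolding bdq_at_0 using partial_scale_le[of n] mu0_pos by simp
qed

context
  fixes M :: "real measure"
  assumes st: "stieltjes_measure M" and orth: "orthogonal M" and fin: "m_neg1 M < \<infinity>"
begin

lemmas M_facts = stieltjes_poly[OF st] m_neg1_finite(1,2)[OF st fin] stieltjes_sets[OF st]

text \<open>Write one factor as its value at \<open>0\<close> plus \<open>x * r\<close>. The
  denominator cancels in the second part, which then vanishes by orthogonality, as \<open>r\<close>
  has degree below \<open>i\<close>.\<close>

lemma invint_square_eq: "invint M (bdq i * bdq i) = poly (bdq i) 0 * invint M (bdq i)"
proof (cases "bdq i")
  case (pCons c r)
  have z: "(\<integral>x. poly (bdq i * r) x \<partial>M) = 0"
  proof (cases "r = 0")
    case False
    then have "degree r < i" using degree_bdq[of i] unfolding pCons by simp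
    then show ?thesis by (rule bdq_orthogonal_lower[OF st orth])
  qed (simp add: poly_0[abs_def])
  have "bdq i * bdq i = smult c (bdq i) + pCons 0 (bdq i * r)"
    using pCons by (metis mult_pCons_right)
  then show ?thesis
    using z pCons by (simp only: invint_add[OF M_facts] invint_smult[OF M_facts] invint_pCons[OF M_facts]) simp
qed

text \<open>By \<open>invint_square_eq\<close> the integral of \<open>bdq i / x\<close> has the sign
  of a square, since \<open>bdq i\<close> is positive at \<open>0\<close>. The bound is this sign
  condition in the limit of large \<open>i\<close>.\<close>

lemma green_le: "green \<le> (\<integral>x. 1 / x \<partial>M)"
proof -
  define m where "m = (\<integral>x. 1 / x \<partial>M)"
  have G: "invint M (bdq i) = m - (1 - mu 0 * m) * (\<Sum>k<i. 1 / cond k)" for i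
    unfolding m_def by (rule invint_bdq[OF M_facts]) (simp add: integral_bdq[OF orth])
  have nn: "0 \<le> invint M (bdq i)" for i
    using invint_square_eq[of i] invint_square[OF M_facts, of "bdq i"] bdq_at_0_pos[of i]
    by (simp add: zero_le_mult_iff)
  have "(1 - mu 0 * m) * (\<Sum>k<i. 1 / cond k) \<le> m" for i
    using G[of i] nn[of i] by linarith
  moreover have "(\<lambda>i. (1 - mu 0 * m) * (\<Sum>k<i. 1 / cond k)) \<longlonglongrightarrow> (1 - mu 0 * m) * scale"
    unfolding scale_def by (intro tendsto_intros summable_LIMSEQ summable_cond)
  ultimately have "(1 - mu 0 * m) * scale \<le> m"
    by (intro LIMSEQ_le_const2) auto
  then have "scale \<le> m * (1 + mu 0 * scale)" by (simp add: algebra_simps)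
  then show ?thesis
    using scale_pos mu0_pos unfolding green_def m_def[symmetric] by (simp add: pos_divide_le_eq add_pos_pos)
qed

text \<open>When the inverse moment equals \<open>green\<close>, the formula of
  \<open>invint_bdq\<close> tends to zero, and so do the integrals \<open>A N\<close> of the squares
  over \<open>x\<close>. A Cauchy-Schwarz argument, in the form of a weighted arithmetic-geometric
  mean inequality, bounds the kernel by \<open>A N\<close> and the fixed integral \<open>B\<close>,
  uniformly in time.\<close>

lemma lap_kernel_decay:
  assumes eq: "(\<integral>x. 1 / x \<partial>M) = green"
  shows "\<exists>e. e \<longlonglongrightarrow> 0 \<and> (\<forall>N. \<forall>t\<ge>0. \<bar>lap_kernel M t N j\<bar> \<le> e N)"
proof -
  define A where "A N = invint M (bdq N * bdq N)" for N
  define B where "B = (\<integral>x. poly ([:0, 1:] * (bdq j * bdq j)) x \<partial>M)"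
  \<comment> \<open>The optimal weight is of order \<open>sqrt (A N)\<close>; the added null
    sequence keeps it positive, so that it can be divided by.\<close>
  define s where "s N = sqrt (A N + inverse (real (Suc N)))" for N
  have A0: "0 \<le> A N" for N unfolding A_def by (rule invint_square[OF M_facts])
  have G: "invint M (bdq i) = green - (1 - mu 0 * green) * (\<Sum>k<i. 1 / cond k)" for i
    unfolding eq[symmetric] by (rule invint_bdq[OF M_facts]) (simp add: integral_bdq[OF orth])
  have "(\<lambda>i. green - (1 - mu 0 * green) * (\<Sum>k<i. 1 / cond k)) \<longlonglongrightarrow> green - (1 - mu 0 * green) * scale"
    unfolding scale_def by (intro tendsto_intros summable_LIMSEQ summable_cond)
  moreover have "green - (1 - mu 0 * green) * scale = green * (1 + mu 0 * scale) - scale"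
    by (simp add: algebra_simps)
  moreover have "\<dots> = 0"
    using scale_pos mu0_pos by (simp add: green_def add_pos_pos less_imp_neq[symmetric])
  ultimately have G_lim: "(\<lambda>i. invint M (bdq i)) \<longlonglongrightarrow> 0" unfolding G by simp
  have "A \<longlonglongrightarrow> 0"
  proof (rule Lim_null_comparison)
    show "(\<lambda>N. (1 + mu 0 * scale) * \<bar>invint M (bdq N)\<bar>) \<longlonglongrightarrow> 0"
      using tendsto_mult_left[OF tendsto_rabs_zero[OF G_lim], of "1 + mu 0 * scale"] by simp
    have "\<bar>A N\<bar> \<le> (1 + mu 0 * scale) * \<bar>invint M (bdq N)\<bar>" for N
      unfolding A_def invint_square_eq abs_mult
      using bdq_at_0_pos[of N] bdq_at_0_le[of N] by (intro mult_right_mono) auto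
    then show "\<forall>\<^sub>F N in sequentially. norm (A N) \<le> (1 + mu 0 * scale) * \<bar>invint M (bdq N)\<bar>"
      by simp
  qed
  then have "(\<lambda>N. A N + inverse (real (Suc N))) \<longlonglongrightarrow> 0"
    using tendsto_add[OF _ LIMSEQ_inverse_real_of_nat] by fastforce
  then have s_lim: "s \<longlonglongrightarrow> 0"
    unfolding s_def[abs_def] using tendsto_real_sqrt by fastforce
  have s_pos: "0 < s N" for N using A0[of N] by (simp add: s_def add_nonneg_pos)
  have A_le: "A N \<le> s N * s N" for N using A0[of N] by (simp add: s_def)
  have "\<bar>lap_kernel M t N j\<bar> \<le> (s N + s N * B) / 2" if t: "0 \<le> t" for t N
  proof -
    define f where "f x = (1 / s N) * (poly (bdq N * bdq N) x / x) + s N * poly ([:0, 1:] * (bdq j * bdq j)) x" for x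
    have f_int: "integrable M f"
      unfolding f_def[abs_def]
      by (intro Bochner_Integration.integrable_add integrable_mult_right invint_integrable[OF M_facts] stieltjes_poly[OF st])
    have amgm: "\<bar>a * b\<bar> \<le> ((1 / r) * (a * a / x) + r * (x * (b * b))) / 2" if "0 < r" "0 < x" for a b r x :: real
    proof -
      have "0 \<le> (\<bar>a\<bar> - r * x * \<bar>b\<bar>)\<^sup>2 / (r * x)" using that by simp
      also have "\<dots> = (1 / r) * (a * a / x) + r * (x * (b * b)) - 2 * \<bar>a * b\<bar>"
        using that by (simp add: power2_eq_square field_simps abs_mult)
      finally show ?thesis by simp
    qed
    have "\<bar>lap_kernel M t N j\<bar> \<le> (\<integral>x. f x / 2 \<partial>M)"
      unfolding lap_kernel_def
    proof (rule lap_bound[OF st t])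
      show "integrable M (\<lambda>x. f x / 2)" using f_int by (rule integrable_divide_zero)
      show "AE x in M. 0 \<le> x \<longrightarrow> \<bar>poly (bdq N * bdq j) x\<bar> \<le> f x / 2"
        using M_facts(2)
      proof eventually_elim
        case (elim x)
        show ?case unfolding f_def using amgm[OF s_pos elim, of "poly (bdq N) x" "poly (bdq j) x" N] by simp
      qed
    qed
    also have "\<dots> = ((1 / s N) * A N + s N * B) / 2"
      unfolding f_def A_def B_def invint_def integral_divide_zero
        Bochner_Integration.integral_add[OF integrable_mult_right[OF invint_integrable[OF M_facts]]
          integrable_mult_right[OF stieltjes_poly[OF st]]] integral_mult_right_zero ..
    also have "\<dots> \<le> (s N + s N * B) / 2"
      using A_le[of N] s_pos[of N] by (simp add: pos_divide_le_eq)
    finally show ?thesis .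
  qed
  moreover have "(\<lambda>N. (s N + s N * B) / 2) \<longlonglongrightarrow> (0 + 0 * B) / 2"
    by (intro tendsto_intros s_lim) simp
  ultimately show ?thesis by (intro exI[of _ "\<lambda>N. (s N + s N * B) / 2"]) simp
qed

lemma minimal_boundary_Q_process:
  assumes "(\<integral>x. 1 / x \<partial>M) = green"
  shows "Q_process lam mu (\<lambda>t i j. lap_kernel M t i j * wt j)"
  by (rule dirichlet_Q_process[OF summable_wt kernel_lap[OF st orth] lap_kernel_decay[OF assms]])

end

text \<open>On zeros of \<open>bdq n\<close> the left side of \<open>invint_bdq\<close> is zero,
  which determines the inverse moment as \<open>c / (1 + mu 0 * c)\<close>, the Green function of
  the chain absorbed at \<open>n\<close>. It increases with \<open>c\<close>.\<close>

lemma gauss_invint: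
  assumes M: "\<And>p. integrable G (poly p)" "AE x in G. 0 < x" "integrable G (\<lambda>x. 1 / x)" "sets G = sets borel"
    and root: "AE x in G. poly (bdq n) x = 0"
    and orth: "\<And>k. k < n \<Longrightarrow> (\<integral>x. poly (bdq k) x \<partial>G) = (if k = 0 then 1 else 0)"
  shows "(\<integral>x. 1 / x \<partial>G) \<le> green"
proof -
  define m where "m = (\<integral>x. 1 / x \<partial>G)"
  define c where "c = (\<Sum>k<n. 1 / cond k)"
  have c: "0 \<le> c" "c \<le> scale"
    unfolding c_def by (intro sum_nonneg) (simp_all add: less_imp_le partial_scale_le)
  have "invint G (bdq n) = 0"
    unfolding invint_def by (rule integral_eq_zero_AE) (use root in eventually_elim, simp)
  then have "m - (1 - mu 0 * m) * c = 0"
    using invint_bdq[OF M orth] by (simp only: m_def c_def)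
  then have "m * (1 + mu 0 * c) = c"
    by (simp add: algebra_simps)
  moreover have pos: "0 < 1 + mu 0 * c" "0 < 1 + mu 0 * scale"
    using c scale_pos mu0_pos by (auto intro!: add_pos_nonneg)
  ultimately have "m = c / (1 + mu 0 * c)"
    by (metis less_irrefl nonzero_eq_divide_eq)
  also have "\<dots> \<le> green"
  proof -
    have "c * (1 + mu 0 * scale) \<le> scale * (1 + mu 0 * c)"
      using c(2) by (simp add: distrib_left mult_ac)
    then show ?thesis
      using pos unfolding green_def by (simp add: pos_divide_le_eq pos_le_divide_eq)
  qed
  finally show ?thesis by (simp add: m_def)
qed

text \<open>The bound on the inverse moments of the quadrature measures survives the weak limit,
  because \<open>1 / x\<close> is an increasing limit of bounded continuous functions.\<close>

lemma exists_natural_solution: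
  assumes st: "stieltjes_measure M" and orth: "orthogonal M"
  obtains N where "stieltjes_solution M N" "m_neg1 N \<le> ennreal green"
proof -
  have q0: "bdq 0 \<noteq> 0" by simp
  have orth': "(\<integral>x. poly (bdq m * bdq n) x \<partial>M) = 0" if "m \<noteq> n" for m n
    using orth that by (simp add: orthogonal_def)
  obtain G r N where G: "\<And>n. real_distribution (G n)"
    "\<And>n. AE x in G n. 0 < x \<and> poly (bdq (r n)) x = 0" "\<And>n p. integrable (G n) (poly p)"
    "\<And>n p. degree p < 2 * r n \<Longrightarrow> (\<integral>x. poly p x \<partial>G n) = (\<integral>x. poly p x \<partial>M)"
    "\<And>n. 0 < r n" "weak_conv_m G N" "stieltjes_solution M N"
    by (rule gauss_limit[OF st degree_bdq q0 orth']) blast+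
  have mass: "(\<integral>x. 1 / x \<partial>G n) \<le> green" and inv: "integrable (G n) (\<lambda>x. 1 / x)"
    and pos: "AE x in G n. 0 < x" for n
  proof -
    interpret G: real_distribution "G n" by (rule G(1))
    show pos: "AE x in G n. 0 < x" using G(2)[of n] by eventually_elim simp
    \<comment> \<open>The extra point \<open>1\<close> keeps the set nonempty for
      \<open>Min\<close>; a positive lower bound for the nodes makes \<open>1 / x\<close> bounded
      almost everywhere.\<close>
    define Z where "Z = insert 1 {x. poly (bdq (r n)) x = 0 \<and> 0 < x}"
    have "bdq (r n) \<noteq> 0" using degree_bdq[of "r n"] G(5)[of n] by force
    then have Z: "finite Z" by (simp add: Z_def poly_roots_finite)
    define c where "c = Min Z"
    have c: "0 < c" using Z by (auto simp: c_def Z_def)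
    show inv: "integrable (G n) (\<lambda>x. 1 / x)"
    proof (rule G.integrable_const_bound[where B = "1 / c"])
      show "AE x in G n. norm (1 / x) \<le> 1 / c"
        using G(2)[of n]
      proof eventually_elim
        case (elim x)
        then have "c \<le> x" using Z by (auto simp: c_def Z_def)
        with c elim show ?case by (simp add: frac_le)
      qed
    qed simp
    show "(\<integral>x. 1 / x \<partial>G n) \<le> green"
    proof (rule gauss_invint[OF G(3) pos inv G.events_eq_borel])
      show "AE x in G n. poly (bdq (r n)) x = 0" using G(2)[of n] by eventually_elim simp
      show "(\<integral>x. poly (bdq k) x \<partial>G n) = (if k = 0 then 1 else 0)" if "k < r n" for k
        using G(4)[of "bdq k" n] that integral_bdq[OF orth] by simp
    qed
  qed
  \<comment> \<open>These truncations tend to infinity at \<open>x = 0\<close>, so the final bound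
    also rules out an atom of the limit measure at the origin.\<close>
  define f where "f j x = 1 / max x (1 / real (Suc j))" for j and x :: real
  have f_bd: "\<bar>f j x\<bar> \<le> real (Suc j)" "0 \<le> f j x" for j x
  proof -
    have p: "0 < 1 / real (Suc j)" by simp
    have "f j x \<le> 1 / (1 / real (Suc j))"
      unfolding f_def using p by (intro divide_left_mono) (auto simp: less_max_iff_disj)
    moreover show "0 \<le> f j x"
      unfolding f_def using p by (intro divide_nonneg_pos) (auto simp: less_max_iff_disj)
    ultimately show "\<bar>f j x\<bar> \<le> real (Suc j)" by simp
  qed
  have f_mono: "f j x \<le> f (Suc j) x" for j x
  proof -
    have p: "0 < 1 / real (Suc j)" "0 < 1 / real (Suc (Suc j))" by simp_all
    have "1 / real (Suc (Suc j)) \<le> 1 / real (Suc j)" by (intro frac_le) auto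
    then show ?thesis
      unfolding f_def using p
      by (intro divide_left_mono max.mono mult_pos_pos) (auto simp only: less_max_iff_disj)
  qed
  have N: "stieltjes_measure N" using G(7) by (simp add: stieltjes_solution_def)
  have rdN: "real_distribution N"
    using stieltjes_prob[OF N] stieltjes_sets[OF N] by (simp add: real_distribution_def real_distribution_axioms_def)
  interpret N: real_distribution N by (rule rdN)
  have f_int: "integrable N (f j)" for j
    using f_bd by (intro N.integrable_const_bound[where B = "real (Suc j)"]) (auto simp: f_def[abs_def])
  have f_le: "integral\<^sup>L N (f j) \<le> green" for j
  proof (rule LIMSEQ_le_const2)
    have "isCont (f j) x" for x
      unfolding f_def[abs_def] by (intro continuous_intros) (auto simp: max_def)
    then show "(\<lambda>n. integral\<^sup>L (G n) (f j)) \<longlonglongrightarrow> integral\<^sup>L N (f j)"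
      using f_bd(1) by (rule weak_conv_integral[OF G(6,1) rdN])
    have "integral\<^sup>L (G n) (f j) \<le> green" for n
    proof -
      interpret G: real_distribution "G n" by (rule G(1))
      have "integral\<^sup>L (G n) (f j) \<le> (\<integral>x. 1 / x \<partial>G n)"
      proof (rule integral_mono_AE)
        show "integrable (G n) (f j)"
          using f_bd by (intro G.integrable_const_bound[where B = "real (Suc j)"]) (auto simp: f_def[abs_def])
        show "AE x in G n. f j x \<le> 1 / x"
          using pos by eventually_elim (simp add: f_def frac_le)
      qed (rule inv)
      with mass[of n] show ?thesis by linarith
    qed
    then show "\<exists>n0. \<forall>n\<ge>n0. integral\<^sup>L (G n) (f j) \<le> green" by blast
  qed
  have "m_neg1 N = (\<integral>\<^sup>+x. (SUP j. ennreal (f j x)) \<partial>N)"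
    unfolding m_neg1_def
  proof (rule nn_integral_cong_AE)
    show "AE x in N. inverse (ennreal x) * indicator {0..} x = (SUP j. ennreal (f j x))"
      using stieltjes_nonneg[OF N]
    proof eventually_elim
      case (elim x)
      have mono: "incseq (\<lambda>j. ennreal (f j x))"
        by (intro incseq_SucI ennreal_leI f_mono)
      show ?case
      proof (cases "x = 0")
        case True
        have "(SUP j. ennreal (f j x)) = top"
          unfolding SUP_eq_top_iff
        proof (intro allI impI)
          fix y :: ennreal assume "y < top"
          then obtain n where "y < of_nat n" using ennreal_Ex_less_of_nat by blast
          also have "of_nat n \<le> ennreal (f n x)"
            using True by (simp add: f_def ennreal_of_nat_eq_real_of_nat del: of_nat_Suc)
          finally show "\<exists>j\<in>UNIV. y < ennreal (f j x)" by blast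
        qed
        moreover have "inverse (ennreal x) * indicator {0..} x = top" using True by simp
        ultimately show ?thesis by (rule trans[OF _ sym, rotated])
      next
        case False
        with elim have x: "0 < x" by simp
        have "(\<lambda>j. ennreal (f j x)) \<longlonglongrightarrow> ennreal (1 / x)"
        proof (rule tendsto_eventually)
          obtain n where "inverse (real (Suc n)) < x" using reals_Archimedean[OF x] by blast
          have "f j x = 1 / x" if "n \<le> j" for j
          proof -
            have "1 / real (Suc j) \<le> 1 / real (Suc n)" using that by (simp add: frac_le)
            with \<open>inverse (real (Suc n)) < x\<close> show ?thesis by (simp add: f_def max_def inverse_eq_divide)
          qed
          then show "\<forall>\<^sub>F j in sequentially. ennreal (f j x) = ennreal (1 / x)"
            unfolding eventually_sequentially by (intro exI[of _ n]) simp
        qed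
        with mono have "(SUP j. ennreal (f j x)) = ennreal (1 / x)"
          using LIMSEQ_SUP LIMSEQ_unique by blast
        with x show ?thesis by (simp add: inverse_ennreal inverse_eq_divide)
      qed
    qed
  qed
  also have "\<dots> = (SUP j. \<integral>\<^sup>+x. ennreal (f j x) \<partial>N)"
  proof (rule nn_integral_monotone_convergence_SUP)
    show "incseq (\<lambda>j x. ennreal (f j x))"
      by (intro incseq_SucI le_funI ennreal_leI f_mono)
    show "(\<lambda>x. ennreal (f j x)) \<in> borel_measurable N" for j
      using f_int[of j] by measurable
  qed
  also have "\<dots> \<le> ennreal green"
  proof (rule SUP_least)
    fix j
    have "(\<integral>\<^sup>+x. ennreal (f j x) \<partial>N) = ennreal (integral\<^sup>L N (f j))"
      using f_bd by (intro nn_integral_eq_integral f_int) simp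
    also have "\<dots> \<le> ennreal green" by (intro ennreal_leI f_le)
    finally show "(\<integral>\<^sup>+x. ennreal (f j x) \<partial>N) \<le> ennreal green" .
  qed
  finally show ?thesis using that[OF G(7)] by blast
qed

end

section \<open>Mixtures of measures\<close>

text \<open>The weights need not add up to \<open>1\<close>: parts of smaller mass occur when one
  component of a probability measure is exchanged for another.\<close>

definition mix :: "real \<Rightarrow> real measure \<Rightarrow> real \<Rightarrow> real measure \<Rightarrow> real measure" where
  "mix c A d B = measure_of UNIV (sets borel) (\<lambda>S. ennreal c * emeasure A S + ennreal d * emeasure B S)"

lemma sets_mix [simp]: "sets (mix c A d B) = sets borel"
  unfolding mix_def using sets.sigma_sets_eq[of "borel :: real measure"] by simp

lemma emeasure_mix:
  assumes "sets A = sets borel" "sets B = sets borel" "S \<in> sets borel"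
  shows "emeasure (mix c A d B) S = ennreal c * emeasure A S + ennreal d * emeasure B S"
proof -
  have "countably_additive (sets borel) (\<lambda>S. ennreal c * emeasure A S + ennreal d * emeasure B S)"
  proof (rule countably_additiveI)
    fix F :: "nat \<Rightarrow> real set"
    assume F: "range F \<subseteq> sets borel" "disjoint_family F" "\<Union> (range F) \<in> sets borel"
    have 1: "(\<Sum>i. emeasure A (F i)) = emeasure A (\<Union> (range F))"
      using F assms by (intro suminf_emeasure) auto
    have 2: "(\<Sum>i. emeasure B (F i)) = emeasure B (\<Union> (range F))"
      using F assms by (intro suminf_emeasure) auto
    show "(\<Sum>i. ennreal c * emeasure A (F i) + ennreal d * emeasure B (F i)) =
      ennreal c * emeasure A (\<Union> (range F)) + ennreal d * emeasure B (\<Union> (range F))"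
      by (simp add: 1[symmetric] 2[symmetric] suminf_add[symmetric])
  qed
  moreover have "positive (sets borel) (\<lambda>S. ennreal c * emeasure A S + ennreal d * emeasure B S)"
    by (simp add: positive_def)
  ultimately show ?thesis
    using assms(3) sets.sigma_algebra_axioms[of "borel :: real measure"]
    unfolding mix_def by (intro emeasure_measure_of_sigma) auto
qed

lemma nn_integral_mix:
  assumes A: "sets A = sets borel" and B: "sets B = sets borel" and f: "f \<in> borel_measurable borel"
  shows "(\<integral>\<^sup>+x. f x \<partial>mix c A d B) = ennreal c * (\<integral>\<^sup>+x. f x \<partial>A) + ennreal d * (\<integral>\<^sup>+x. f x \<partial>B)"
  using f
proof (induction rule: borel_measurable_induct)
  case (cong f g)
  then show ?case by (simp add: space_borel cong: nn_integral_cong)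
next
  case (set S)
  then show ?case using A B by (simp add: emeasure_mix)
next
  case (mult u e)
  have "u \<in> borel_measurable A" "u \<in> borel_measurable B" "u \<in> borel_measurable (mix c A d B)"
    using mult(2) by (simp_all add: measurable_cong_sets[OF A refl] measurable_cong_sets[OF B refl]
        measurable_cong_sets[OF sets_mix refl])
  then show ?case using mult by (simp add: nn_integral_cmult distrib_left mult_ac)
next
  case (add u v)
  have "u \<in> borel_measurable A" "u \<in> borel_measurable B" "u \<in> borel_measurable (mix c A d B)"
    "v \<in> borel_measurable A" "v \<in> borel_measurable B" "v \<in> borel_measurable (mix c A d B)"
    using add by (simp_all add: measurable_cong_sets[OF A refl] measurable_cong_sets[OF B refl]
        measurable_cong_sets[OF sets_mix refl])
  then show ?case using add by (simp add: nn_integral_add distrib_left add_ac)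
next
  case (seq U)
  have m: "U i \<in> borel_measurable A" "U i \<in> borel_measurable B" "U i \<in> borel_measurable (mix c A d B)" for i
    using seq(1) by (simp_all add: measurable_cong_sets[OF A refl] measurable_cong_sets[OF B refl]
        measurable_cong_sets[OF sets_mix refl])
  have lim: "(\<integral>\<^sup>+x. (SUP i. U i) x \<partial>L) = (SUP i. \<integral>\<^sup>+x. U i x \<partial>L)" if "\<And>i. U i \<in> borel_measurable L" for L
    using nn_integral_monotone_convergence_SUP[OF seq(3) that] by (simp add: image_image)
  have mono: "incseq (\<lambda>i. ennreal e * (\<integral>\<^sup>+x. U i x \<partial>L))" for L e
    using seq(3) by (auto simp: incseq_def le_fun_def intro!: mult_left_mono nn_integral_mono)
  show ?case
    unfolding lim[OF m(1)] lim[OF m(2)] lim[OF m(3)] seq.IH SUP_mult_left_ennreal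
    by (rule ennreal_SUP_add[OF mono mono])
qed

lemma
  fixes f :: "real \<Rightarrow> real"
  assumes A: "sets A = sets borel" and B: "sets B = sets borel" and c: "0 \<le> c" "0 \<le> d"
    and f: "integrable A f" "integrable B f"
  shows integrable_mix: "integrable (mix c A d B) f"
    and integral_mix: "(\<integral>x. f x \<partial>mix c A d B) = c * (\<integral>x. f x \<partial>A) + d * (\<integral>x. f x \<partial>B)"
proof -
  have [measurable]: "f \<in> borel_measurable borel"
    using borel_measurable_integrable[OF f(1)] by (simp add: measurable_cong_sets[OF A refl])
  have fin: "(\<integral>\<^sup>+x. ennreal (f x) \<partial>A) < \<infinity>" "(\<integral>\<^sup>+x. ennreal (f x) \<partial>B) < \<infinity>"
    "(\<integral>\<^sup>+x. ennreal (- f x) \<partial>A) < \<infinity>" "(\<integral>\<^sup>+x. ennreal (- f x) \<partial>B) < \<infinity>"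
    using f by (auto simp: real_integrable_def top.not_eq_extremum)
  show i: "integrable (mix c A d B) f"
    unfolding real_integrable_def using fin
    by (auto simp: nn_integral_mix[OF A B] measurable_cong_sets[OF sets_mix refl] ennreal_mult_eq_top_iff)
  have e: "enn2real (ennreal c * x + ennreal d * y) = c * enn2real x + d * enn2real y"
    if "x < \<infinity>" "y < \<infinity>" for x y
    using that c by (simp add: enn2real_plus enn2real_mult ennreal_mult_less_top)
  have n: "(\<integral>\<^sup>+x. ennreal (f x) \<partial>mix c A d B) = ennreal c * (\<integral>\<^sup>+x. ennreal (f x) \<partial>A) + ennreal d * (\<integral>\<^sup>+x. ennreal (f x) \<partial>B)"
    "(\<integral>\<^sup>+x. ennreal (- f x) \<partial>mix c A d B) = ennreal c * (\<integral>\<^sup>+x. ennreal (- f x) \<partial>A) + ennreal d * (\<integral>\<^sup>+x. ennreal (- f x) \<partial>B)"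
    by (intro nn_integral_mix[OF A B]; measurable)+
  show "(\<integral>x. f x \<partial>mix c A d B) = c * (\<integral>x. f x \<partial>A) + d * (\<integral>x. f x \<partial>B)"
    unfolding real_lebesgue_integral_def[OF i] real_lebesgue_integral_def[OF f(1)] real_lebesgue_integral_def[OF f(2)]
      n(1) n(2) e[OF fin(1,2)] e[OF fin(3,4)]
    by (simp add: algebra_simps)
qed

lemma AE_mix:
  assumes A: "sets A = sets borel" and B: "sets B = sets borel"
    and P: "Measurable.pred borel P" "AE x in A. P x" "AE x in B. P x"
  shows "AE x in mix c A d B. P x"
proof -
  have S: "{x. \<not> P x} \<in> sets borel" using P(1) by measurable
  have sp: "space A = UNIV" "space B = UNIV" "space (mix c A d B) = UNIV"
    using sets_eq_imp_space_eq[OF A] sets_eq_imp_space_eq[OF B] sets_eq_imp_space_eq[OF sets_mix] by auto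
  have "emeasure A {x. \<not> P x} = 0" "emeasure B {x. \<not> P x} = 0"
    using P(2,3) S A B sp by (simp_all add: AE_iff_null null_sets_def)
  then have "emeasure (mix c A d B) {x. \<not> P x} = 0" by (simp add: emeasure_mix[OF A B S])
  then show ?thesis using S sp by (simp add: AE_iff_null null_sets_def)
qed

text \<open>Neither normalised nor of infinite support, so that the Dirac measure at
  \<open>0\<close> and arbitrary nonnegative combinations are included.\<close>

definition moment_functional_measure :: "real measure \<Rightarrow> bool" where
  "moment_functional_measure M \<longleftrightarrow> sets M = sets borel \<and> (\<forall>p. integrable M (poly p)) \<and> (AE x in M. 0 \<le> x)"

lemma stieltjes_moment_functional: "stieltjes_measure M \<Longrightarrow> moment_functional_measure M"
  by (simp add: moment_functional_measure_def stieltjes_sets stieltjes_poly stieltjes_nonneg)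

lemma moment_functional_mix:
  assumes "moment_functional_measure A" "moment_functional_measure B" "0 \<le> c" "0 \<le> d"
  shows "moment_functional_measure (mix c A d B)"
proof -
  have A: "sets A = sets borel" "\<And>p. integrable A (poly p)" "AE x in A. 0 \<le> x"
    and B: "sets B = sets borel" "\<And>p. integrable B (poly p)" "AE x in B. 0 \<le> x"
    using assms(1,2) by (auto simp: moment_functional_measure_def)
  have "integrable (mix c A d B) (poly p)" for p
    by (rule integrable_mix[OF A(1) B(1) assms(3,4) A(2) B(2)])
  moreover have "AE x in mix c A d B. 0 \<le> x"
    by (rule AE_mix[OF A(1) B(1) _ A(3) B(3)]) measurable
  ultimately show ?thesis by (simp add: moment_functional_measure_def)
qed

lemma moment_functional_return: "moment_functional_measure (return borel 0)"
proof -
  interpret prob_space "return borel (0 :: real)" by (rule prob_space_return) simp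
  have "integrable (return borel 0) (poly p)" for p :: "real poly"
    by (rule integrable_const_bound[where B = "\<bar>poly p 0\<bar>"]) (simp_all add: AE_return)
  then show ?thesis by (simp add: moment_functional_measure_def AE_return)
qed

lemma moment_functional_stieltjes:
  assumes M: "moment_functional_measure M" and one: "(\<integral>x. poly 1 x \<partial>M) = 1"
    and pos: "\<And>p. p \<noteq> 0 \<Longrightarrow> (\<integral>x. (poly p x)\<^sup>2 \<partial>M) \<noteq> 0"
  shows "stieltjes_measure M"
proof (rule stieltjes_measureI[OF _ _ _ _ pos])
  have int: "integrable M (poly p)" for p using M by (simp add: moment_functional_measure_def)
  have "integrable M (\<lambda>x. 1 :: real)" using int[of 1] by (simp add: poly_1[abs_def])
  then have "(\<integral>\<^sup>+x. ennreal (norm (1 :: real)) \<partial>M) < \<infinity>"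
    unfolding integrable_iff_bounded by blast
  then interpret finite_measure M by (intro finite_measureI) simp
  have "measure M (space M) = 1" using one by (simp add: poly_1[abs_def])
  then show "prob_space M" by (intro prob_spaceI) (simp add: emeasure_eq_measure)
  show "integrable M (\<lambda>x. x ^ n)" for n
    using int[of "monom 1 n"] by (simp add: poly_monom[abs_def])
qed (use M in \<open>auto simp: moment_functional_measure_def\<close>)

text \<open>Total mass one and positivity on squares are both properties of the moments, so they
  carry over from \<open>N\<close>.\<close>

lemma moment_functional_solution:
  assumes M: "moment_functional_measure M" and st: "stieltjes_measure N"
    and eq: "\<And>p. (\<integral>x. poly p x \<partial>M) = (\<integral>x. poly p x \<partial>N)"
  shows "stieltjes_solution N M"
proof -
  interpret N: prob_space N by (rule stieltjes_prob[OF st])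
  have "stieltjes_measure M"
  proof (rule moment_functional_stieltjes[OF M])
    show "(\<integral>x. poly 1 x \<partial>M) = 1" unfolding eq by (simp add: poly_1[abs_def] N.prob_space)
    show "(\<integral>x. (poly p x)\<^sup>2 \<partial>M) \<noteq> 0" if "p \<noteq> 0" for p
      using stieltjes_square_pos[OF st that] eq[of "p\<^sup>2"] by (simp add: poly_power)
  qed
  moreover have "same_moments M N"
    unfolding same_moments_def using eq[of "monom 1 _"] by (simp add: poly_monom)
  ultimately show ?thesis by (simp add: stieltjes_solution_def)
qed

section \<open>The measures \<open>\<phi>\<^sup>(\<^sup>a\<^sup>)\<close>\<close>

lemma integrable_return_borel:
  fixes f :: "real \<Rightarrow> real"
  assumes [measurable]: "f \<in> borel_measurable borel"
  shows "integrable (return borel c) f"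
proof -
  interpret prob_space "return borel c" by (rule prob_space_return) simp
  show ?thesis
    by (rule integrable_const_bound[where B = "\<bar>f c\<bar>"]) (simp_all add: AE_return)
qed

definition inverse_moment :: "real measure \<Rightarrow> real" where
  "inverse_moment \<psi> = (\<integral>x. 1 / x \<partial>\<psi>)"

context
  fixes \<psi> :: "real measure"
  assumes st: "stieltjes_measure \<psi>" and fin: "m_neg1 \<psi> < \<infinity>"
begin

lemmas psi_facts = stieltjes_poly[OF st] m_neg1_finite(1,2)[OF st fin] stieltjes_sets[OF st]

lemma inverse_moment_pos: "0 < (\<integral>x. 1 / x \<partial>\<psi>)"
proof -
  interpret prob_space \<psi> by (rule stieltjes_prob[OF st])
  have nn: "AE x in \<psi>. 0 \<le> 1 / x" using psi_facts(2) by eventually_elim simp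
  have "(\<integral>x. 1 / x \<partial>\<psi>) \<noteq> 0"
  proof
    assume "(\<integral>x. 1 / x \<partial>\<psi>) = 0"
    then have "AE x in \<psi>. 1 / x = 0"
      using integral_nonneg_eq_0_iff_AE[OF psi_facts(3) nn] by simp
    then have "AE x in \<psi>. False" using psi_facts(2) by eventually_elim simp
    then show False using AE_False by simp
  qed
  moreover have "0 \<le> (\<integral>x. 1 / x \<partial>\<psi>)" using nn by (rule integral_nonneg_AE)
  ultimately show ?thesis by simp
qed

lemma phi0_density: "phi0 \<psi> = density \<psi> (\<lambda>x. ennreal (1 / x / inverse_moment \<psi>))"
  unfolding phi0_def
proof (rule density_cong)
  have [measurable]: "(\<lambda>x. inverse (ennreal x)) \<in> borel_measurable borel"
    by (rule measurable_compose[OF measurable_ennreal borel_measurable_inverse_ennreal]) simp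
  show "(\<lambda>x. inverse (ennreal x) / m_neg1 \<psi> * indicator {0..} x) \<in> borel_measurable \<psi>"
    unfolding measurable_cong_sets[OF psi_facts(4) refl] divide_ennreal_def by measurable
  show "(\<lambda>x. ennreal (1 / x / inverse_moment \<psi>)) \<in> borel_measurable \<psi>"
    unfolding measurable_cong_sets[OF psi_facts(4) refl] by measurable
  show "AE x in \<psi>. inverse (ennreal x) / m_neg1 \<psi> * indicator {0..} x = ennreal (1 / x / inverse_moment \<psi>)"
    using psi_facts(2)
  proof eventually_elim
    case (elim x)
    then show ?case
      using inverse_moment_pos unfolding m_neg1_finite(3)[OF st fin] inverse_moment_def
      by (simp add: inverse_ennreal divide_ennreal inverse_eq_divide)
  qed
qed

lemma sets_phi0: "sets (phi0 \<psi>) = sets borel"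
  by (simp add: phi0_def psi_facts(4))

lemma integral_phi0:
  fixes f :: "real \<Rightarrow> real"
  assumes "f \<in> borel_measurable borel"
  shows "(\<integral>x. f x \<partial>phi0 \<psi>) = (\<integral>x. f x / x \<partial>\<psi>) / inverse_moment \<psi>"
    and "integrable (phi0 \<psi>) f \<longleftrightarrow> integrable \<psi> (\<lambda>x. f x / x)"
proof -
  have mb: "f \<in> borel_measurable \<psi>" "(\<lambda>x. 1 / x / inverse_moment \<psi>) \<in> borel_measurable \<psi>"
    using assms unfolding measurable_cong_sets[OF psi_facts(4) refl] by measurable
  have m: "0 < inverse_moment \<psi>" using inverse_moment_pos by (simp add: inverse_moment_def)
  have nn: "AE x in \<psi>. 0 \<le> 1 / x / inverse_moment \<psi>"
    using psi_facts(2) by eventually_elim (use m in simp)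
  have "(\<integral>x. f x \<partial>phi0 \<psi>) = (\<integral>x. (1 / x / inverse_moment \<psi>) *\<^sub>R f x \<partial>\<psi>)"
    unfolding phi0_density by (rule integral_density[OF mb nn])
  also have "\<dots> = (\<integral>x. f x / x / inverse_moment \<psi> \<partial>\<psi>)"
    by (intro Bochner_Integration.integral_cong) (simp_all add: field_simps)
  finally show "(\<integral>x. f x \<partial>phi0 \<psi>) = (\<integral>x. f x / x \<partial>\<psi>) / inverse_moment \<psi>"
    by (simp only: integral_divide_zero)
  have "integrable (phi0 \<psi>) f \<longleftrightarrow> integrable \<psi> (\<lambda>x. (1 / x / inverse_moment \<psi>) *\<^sub>R f x)"
    unfolding phi0_density by (rule integrable_density[OF mb nn])
  also have "\<dots> \<longleftrightarrow> integrable \<psi> (\<lambda>x. 1 / inverse_moment \<psi> * (f x / x))"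
    by (intro Bochner_Integration.integrable_cong) (simp_all add: field_simps)
  also have "\<dots> \<longleftrightarrow> integrable \<psi> (\<lambda>x. f x / x)"
    unfolding integrable_mult_left_iff using m by simp
  finally show "integrable (phi0 \<psi>) f \<longleftrightarrow> integrable \<psi> (\<lambda>x. f x / x)" .
qed

lemma AE_phi0: "AE x in phi0 \<psi>. 0 < x"
  unfolding phi0_density
  by (subst AE_density) (use psi_facts(2) in \<open>auto simp: measurable_cong_sets[OF psi_facts(4) refl] elim: eventually_mono\<close>)

lemma integral_poly_phi0: "(\<integral>x. poly p x \<partial>phi0 \<psi>) = invint \<psi> p / inverse_moment \<psi>"
  by (simp add: integral_phi0(1)[OF borel_measurable_poly] invint_def)

lemma stieltjes_phi0: "stieltjes_measure (phi0 \<psi>)"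
proof (rule moment_functional_stieltjes)
  show "moment_functional_measure (phi0 \<psi>)"
    unfolding moment_functional_measure_def
    using sets_phi0 AE_phi0 invint_integrable[OF psi_facts]
    by (auto simp: integral_phi0(2)[OF borel_measurable_poly] elim: eventually_mono)
  show "(\<integral>x. poly 1 x \<partial>phi0 \<psi>) = 1"
    using inverse_moment_pos unfolding integral_poly_phi0 by (simp add: invint_def inverse_moment_def)
  fix p :: "real poly" assume p: "p \<noteq> 0"
  show "(\<integral>x. (poly p x)\<^sup>2 \<partial>phi0 \<psi>) \<noteq> 0"
  proof
    assume "(\<integral>x. (poly p x)\<^sup>2 \<partial>phi0 \<psi>) = 0"
    then have "(\<integral>x. poly (p * p) x / x \<partial>\<psi>) = 0"
      using integral_poly_phi0[of "p * p"] inverse_moment_pos by (simp add: invint_def inverse_moment_def power2_eq_square)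
    moreover have "AE x in \<psi>. 0 \<le> poly (p * p) x / x"
      using psi_facts(2) by eventually_elim simp
    ultimately have "AE x in \<psi>. poly (p * p) x / x = 0"
      using integral_nonneg_eq_0_iff_AE[OF invint_integrable[OF psi_facts]] by blast
    then have "AE x in \<psi>. poly p x = 0"
      using psi_facts(2) by eventually_elim simp
    with p stieltjes_AE_poly_eq_0[OF st] show False by blast
  qed
qed

lemma phi_mix:
  assumes a: "0 < a"
  shows "phi a \<psi> = mix (a / (a + 1)) (return borel 0) (1 / (a + 1)) (phi0 \<psi>)"
proof (rule measure_eqI)
  fix A assume "A \<in> sets (phi a \<psi>)"
  then have A: "A \<in> sets borel" by simp
  have i: "inverse (ennreal (a + 1)) = ennreal (1 / (a + 1))"
    using a by (simp add: inverse_ennreal inverse_eq_divide del: ennreal_plus)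
  have "ennreal (a / (a + 1)) = ennreal a * ennreal (1 / (a + 1))"
    using a by (simp flip: ennreal_mult)
  then show "emeasure (phi a \<psi>) A = emeasure (mix (a / (a + 1)) (return borel 0) (1 / (a + 1)) (phi0 \<psi>)) A"
    using A unfolding emeasure_phi[OF psi_facts(4) A] emeasure_mix[OF sets_return sets_phi0 A] divide_ennreal_def i
    by (simp add: distrib_left mult_ac)
qed simp

lemma integral_poly_phi:
  assumes a: "0 < a"
  shows "(\<integral>x. poly p x \<partial>phi a \<psi>) = (a * poly p 0 + invint \<psi> p / inverse_moment \<psi>) / (a + 1)"
proof -
  have "(\<integral>x. poly p x \<partial>phi a \<psi>) = a / (a + 1) * (\<integral>x. poly p x \<partial>return borel 0) + 1 / (a + 1) * (\<integral>x. poly p x \<partial>phi0 \<psi>)"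
    unfolding phi_mix[OF a] using a
    by (intro integral_mix sets_return sets_phi0 integrable_return_borel stieltjes_poly[OF stieltjes_phi0]) auto
  then show ?thesis
    by (simp add: integral_return integral_poly_phi0 add_divide_distrib)
qed

lemma stieltjes_phi:
  assumes a: "0 < a"
  shows "stieltjes_measure (phi a \<psi>)"
proof (rule moment_functional_stieltjes)
  show "moment_functional_measure (phi a \<psi>)"
    unfolding phi_mix[OF a] using a
    by (intro moment_functional_mix moment_functional_return stieltjes_moment_functional stieltjes_phi0) auto
  have e: "(\<integral>x. poly p x \<partial>phi a \<psi>) = (a * poly p 0 + (\<integral>x. poly p x \<partial>phi0 \<psi>)) / (a + 1)" for p
    unfolding integral_poly_phi[OF a] integral_poly_phi0 ..
  interpret phi0: prob_space "phi0 \<psi>" by (rule stieltjes_prob[OF stieltjes_phi0])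
  show "(\<integral>x. poly 1 x \<partial>phi a \<psi>) = 1"
    unfolding e using a by (simp add: poly_1[abs_def] phi0.prob_space)
  show "(\<integral>x. (poly p x)\<^sup>2 \<partial>phi a \<psi>) \<noteq> 0" if "p \<noteq> 0" for p
  proof -
    have "0 < a * (poly p 0)\<^sup>2 + (\<integral>x. (poly p x)\<^sup>2 \<partial>phi0 \<psi>)"
      using stieltjes_square_pos[OF stieltjes_phi0 that] a by (intro add_nonneg_pos) auto
    then show ?thesis using e[of "p\<^sup>2"] a by (simp add: poly_power)
  qed
qed

lemma emeasure_phi0_0: "emeasure (phi0 \<psi>) {0} = 0"
proof -
  have "AE x in phi0 \<psi>. \<not> x = 0" using AE_phi0 by eventually_elim simp
  moreover have "space (phi0 \<psi>) = UNIV" using sets_eq_imp_space_eq[OF sets_phi0] by simp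
  ultimately show ?thesis by (drule_tac emeasure_eq_0_AE) simp
qed

lemma emeasure_phi_0:
  assumes "0 < a"
  shows "emeasure (phi a \<psi>) {0} = ennreal (a / (a + 1))"
  using assms emeasure_phi0_0 by (simp add: emeasure_phi[OF psi_facts(4)] divide_ennreal del: ennreal_plus)

text \<open>The factor \<open>x\<close> removes the atom at \<open>0\<close> and cancels the density
  \<open>1 / x\<close>, which leads back to \<open>\<psi>\<close>.\<close>

lemma lap_phi_times_x:
  assumes a: "0 < a" and t: "0 \<le> t"
  shows "lap (phi a \<psi>) t ([:0, 1:] * q) = lap \<psi> t q / ((a + 1) * inverse_moment \<psi>)"
proof -
  define f where "f x = indicator {0..} x * (exp (- x * t) * poly ([:0, 1:] * q) x)" for x :: real
  have [measurable]: "f \<in> borel_measurable borel" unfolding f_def[abs_def] by measurable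
  have "integrable (phi0 \<psi>) f"
    using lap_integrable[OF stieltjes_phi0 t, of "[:0, 1:] * q"]
    by (simp only: f_def[abs_def] set_integrable_def real_scaleR_def)
  then have "(\<integral>x. f x \<partial>phi a \<psi>) = a / (a + 1) * (\<integral>x. f x \<partial>return borel 0) + 1 / (a + 1) * (\<integral>x. f x \<partial>phi0 \<psi>)"
    unfolding phi_mix[OF a] using a
    by (intro integral_mix sets_return sets_phi0 integrable_return_borel) auto
  moreover have "(\<integral>x. f x \<partial>return borel 0) = 0"
    by (subst integral_return) (auto simp: f_def)
  moreover have "(\<integral>x. f x \<partial>phi0 \<psi>) = (\<integral>x. indicator {0..} x * (exp (- x * t) * poly q x) \<partial>\<psi>) / inverse_moment \<psi>"
  proof -
    have "(\<integral>x. f x / x \<partial>\<psi>) = (\<integral>x. indicator {0..} x * (exp (- x * t) * poly q x) \<partial>\<psi>)"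
    proof (rule integral_cong_AE)
      show "AE x in \<psi>. f x / x = indicator {0..} x * (exp (- x * t) * poly q x)"
        using psi_facts(2) by eventually_elim (simp add: f_def)
    qed (unfold measurable_cong_sets[OF psi_facts(4) refl], measurable)
    then show ?thesis by (simp add: integral_phi0(1))
  qed
  ultimately show ?thesis
    by (simp add: lap_def set_lebesgue_integral_def f_def)
qed

end

section \<open>Orthonormal polynomials and the dual measure\<close>

text \<open>Needed to evaluate \<open>orthonormal_poly\<close>, which is a definite description.
  After matching leading coefficients, the difference \<open>r\<close> has lower degree and is
  orthogonal to both candidates, hence to itself; the positive leading coefficients exclude the
  factor \<open>-1\<close>.\<close>

lemma orthonormal_sequence_unique:
  assumes st: "stieltjes_measure M" and p: "orthonormal_sequence M p" and q: "orthonormal_sequence M q"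
  shows "p = q"
proof
  fix n
  note int = stieltjes_poly[OF st]
  have lower: "(\<integral>x. poly (p n * r) x \<partial>M) = 0" if "orthonormal_sequence M p" "degree r < n" for p r
  proof (rule orthogonal_lower_degree[where q = p, OF int])
    show "degree (p k) = k" "p 0 \<noteq> 0" for k
      using that(1) unfolding orthonormal_sequence_def by (auto dest: spec[of _ 0])
    show "(\<integral>x. poly (p n * p k) x \<partial>M) = 0" if "k < n" for k
      using \<open>orthonormal_sequence M p\<close> that unfolding orthonormal_sequence_def by simp
  qed (rule that)
  define c where "c = lead_coeff (q n) / lead_coeff (p n)"
  have "degree (p n) = n \<and> lead_coeff (p n) > 0" "degree (q n) = n \<and> lead_coeff (q n) > 0"
    using p q unfolding orthonormal_sequence_def by blast+
  then have dp: "degree (p n) = n" "lead_coeff (p n) > 0" and dq: "degree (q n) = n" "lead_coeff (q n) > 0"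
    by blast+
  have c: "0 < c" using dp dq by (simp add: c_def)
  define r where "r = q n - smult c (p n)"
  have "r = 0 \<or> degree r < n"
  proof -
    have "coeff r n = 0" using dp dq by (simp add: r_def c_def)
    moreover have "degree r \<le> n" unfolding r_def using dp dq by (intro degree_diff_le) auto
    ultimately show ?thesis by (metis le_neq_implies_less leading_coeff_0_iff)
  qed
  then have z: "(\<integral>x. poly (p n * r) x \<partial>M) = 0" "(\<integral>x. poly (q n * r) x \<partial>M) = 0"
    using lower[OF p] lower[OF q] by (auto simp: poly_0[abs_def] simp del: poly_mult)
  have "r * r = q n * r - smult c (p n * r)" by (simp add: r_def left_diff_distrib)
  then have "(\<integral>x. poly (r * r) x \<partial>M) = 0"
    by (simp only: integral_poly_diff[OF int] integral_poly_smult[OF int] z mult_zero_right diff_self)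
  then have "r = 0" using stieltjes_square_pos[OF st, of r] by (auto simp: power2_eq_square)
  then have qp: "q n = smult c (p n)" by (simp add: r_def)
  have "(\<integral>x. poly (q n * q n) x \<partial>M) = 1" "(\<integral>x. poly (p n * p n) x \<partial>M) = 1"
    using p q unfolding orthonormal_sequence_def by simp_all
  moreover have "q n * q n = smult (c * c) (p n * p n)" unfolding qp by simp
  ultimately have "c * c = 1"
    by (simp only: integral_poly_smult[OF int])
  then have "c = 1" using c by (simp add: square_eq_1_iff)
  then show "p n = q n" using qp by simp
qed

lemma rho_eq:
  assumes st: "stieltjes_measure M" and p: "orthonormal_sequence M p"
  shows "rho M x = inverse (\<Sum>n. ennreal ((poly (p n) x)\<^sup>2))"
proof -
  have "orthonormal_poly M = p"
    unfolding orthonormal_poly_def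
    using p orthonormal_sequence_unique[OF st _ p] by (rule the_equality)
  then show ?thesis by (simp add: rho_def)
qed

context birth_death
begin

lemma lead_coeff_bdq: "lead_coeff (bdq n) = (-1) ^ n / (\<Prod>k<n. lam k)"
  unfolding bdq_def lead_coeff_smult conjunct2[OF bd_poly_monic] by simp

text \<open>The leading coefficients of \<open>bdq\<close> alternate in sign, which
  \<open>(-1) ^ n\<close> compensates.\<close>

lemma orthonormal_bdq:
  assumes st: "stieltjes_measure M" and orth: "orthogonal M"
  shows "orthonormal_sequence M (\<lambda>n. smult ((-1) ^ n * sqrt (wt n)) (bdq n))"
  unfolding orthonormal_sequence_def
proof (intro conjI allI)
  fix n
  show "degree (smult ((-1) ^ n * sqrt (wt n)) (bdq n)) = n"
    using wt_pos[of n, THEN less_imp_neq] by simp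
  have "lead_coeff (smult ((-1) ^ n * sqrt (wt n)) (bdq n)) = sqrt (wt n) / (\<Prod>k<n. lam k)"
    unfolding lead_coeff_smult lead_coeff_bdq by (simp flip: power_add mult.assoc)
  also have "\<dots> > 0" by simp
  finally show "0 < lead_coeff (smult ((-1) ^ n * sqrt (wt n)) (bdq n))" .
next
  fix i j
  have "(\<integral>x. poly (smult ((-1) ^ i * sqrt (wt i)) (bdq i)) x * poly (smult ((-1) ^ j * sqrt (wt j)) (bdq j)) x \<partial>M)
    = (\<integral>x. poly (smult ((-1) ^ i * sqrt (wt i) * ((-1) ^ j * sqrt (wt j))) (bdq i * bdq j)) x \<partial>M)"
    by (simp add: mult_ac)
  also have "\<dots> = (-1) ^ i * sqrt (wt i) * ((-1) ^ j * sqrt (wt j)) * (if i = j then 1 / wt j else 0)"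
    using orth by (simp only: integral_poly_smult[OF stieltjes_poly[OF st]] orthogonal_def)
  also have "\<dots> = (if i = j then 1 else 0)"
  proof (cases "i = j")
    case True
    have "(-1) ^ j * sqrt (wt j) * ((-1) ^ j * sqrt (wt j)) = ((-1) ^ j * (-1) ^ j) * (sqrt (wt j) * sqrt (wt j))"
      by (simp only: mult_ac)
    also have "\<dots> = wt j" by (simp flip: power_add add: less_imp_le)
    finally show ?thesis using True wt_pos[of j, THEN less_imp_neq] by simp
  qed simp
  finally show "(\<integral>x. poly (smult ((-1) ^ i * sqrt (wt i)) (bdq i)) x * poly (smult ((-1) ^ j * sqrt (wt j)) (bdq j)) x \<partial>M)
    = (if i = j then 1 else 0)" .
qed

end

context regular_birth_death
begin

text \<open>Equals \<open>1 / (mu 0 * green) - 1\<close>; the resulting atom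
  \<open>a / (a + 1)\<close> is \<open>1 / (1 + mu 0 * scale)\<close>, the reciprocal of the total
  dual weight.\<close>

definition a_dual :: real where "a_dual = 1 / (mu 0 * scale)"

lemma a_dual_pos: "0 < a_dual"
  using scale_pos mu0_pos by (simp add: a_dual_def)

lemma a_dual_eq: "(a_dual + 1) * green = 1 / mu 0"
proof -
  define s where "s = scale"
  have "0 < s" "0 < mu 0" "0 < 1 + mu 0 * s" using scale_pos mu0_pos by (auto simp: s_def add_pos_pos)
  then show ?thesis unfolding a_dual_def green_def s_def[symmetric] by (simp add: divide_simps)
qed

lemma sums_dual_wt: "dual.wt sums (1 + mu 0 * scale)"
proof -
  have "(\<lambda>n. dual.wt (Suc n)) sums (mu 0 * scale)"
    unfolding dual_wt_Suc scale_def using sums_mult[OF summable_sums[OF summable_cond], of "mu 0"] by simp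
  from sums_Suc[OF this] show ?thesis by (simp add: add.commute)
qed

text \<open>Keeps the zeros of all dual polynomials away from the origin by a common distance. The
  two families control each other: bounds on \<open>bdq k\<close> for \<open>k < n\<close> keep the
  telescoped sum for \<open>dual.bdq n\<close> within \<open>1 / 2\<close> of its value at
  \<open>0\<close>, by the assumption on \<open>x\<close>, and the bounds on
  \<open>dual.bdq n\<close> limit the next increment of \<open>bdq\<close>.\<close>

lemma dual_bdq_bounds:
  assumes "0 \<le> x" "x * ((1 + mu 0 * scale) * suminf wt) \<le> mu 0 / 2"
  shows "1 / 2 \<le> poly (dual.bdq n) x \<and> poly (dual.bdq n) x \<le> 1 \<and>
    0 \<le> poly (bdq n) x \<and> poly (bdq n) x \<le> (\<Sum>k\<le>n. dual.wt k)"
proof (induction n rule: less_induct)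
  case (less n)
  define B where "B = 1 + mu 0 * scale"
  have W: "(\<Sum>k\<le>n. dual.wt k) \<le> B" for n
    using bdq_at_0_le[of n] unfolding bdq_at_0 B_def .
  have tele: "poly (dual.bdq n) x = 1 - x / mu 0 * (\<Sum>k<n. wt k * poly (bdq k) x)" for n
  proof (induction n)
    case (Suc n)
    have "poly (dual.bdq (Suc n)) x = poly (dual.bdq n) x - x * (wt n / mu 0 * poly (bdq n) x)"
      using conjunct2[OF dual_bdq_eval] .
    with Suc show ?case by (simp add: algebra_simps)
  qed simp
  have "(\<Sum>k<n. wt k * poly (bdq k) x) \<le> (\<Sum>k<n. wt k * B)"
    using less W by (intro sum_mono mult_left_mono) (auto simp: less_imp_le intro: order.trans)
  also have "\<dots> = B * (\<Sum>k<n. wt k)" by (simp add: sum_distrib_left mult.commute)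
  also have "\<dots> \<le> B * suminf wt"
    using mu0_pos scale_pos by (intro mult_left_mono sum_le_suminf summable_wt) (auto simp: less_imp_le B_def add_nonneg_nonneg)
  finally have le: "(\<Sum>k<n. wt k * poly (bdq k) x) \<le> B * suminf wt" .
  have ge: "0 \<le> (\<Sum>k<n. wt k * poly (bdq k) x)"
    using less by (intro sum_nonneg mult_nonneg_nonneg) (auto simp: less_imp_le)
  have "x / mu 0 * (\<Sum>k<n. wt k * poly (bdq k) x) \<le> x / mu 0 * (B * suminf wt)"
    using assms(1) mu0_pos le by (intro mult_left_mono) auto
  also have "\<dots> \<le> 1 / 2"
    using assms(2) mu0_pos by (simp add: B_def pos_divide_le_eq)
  finally have h1: "1 / 2 \<le> poly (dual.bdq n) x" unfolding tele[of n] by simp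
  have "0 \<le> x / mu 0 * (\<Sum>k<n. wt k * poly (bdq k) x)"
    using assms(1) mu0_pos ge by simp
  then have h2: "poly (dual.bdq n) x \<le> 1" unfolding tele[of n] by simp
  have q: "0 \<le> dual.wt n * poly (dual.bdq n) x" "dual.wt n * poly (dual.bdq n) x \<le> dual.wt n"
    using h1 h2 by (auto simp: mult_left_le less_imp_le)
  show ?case
  proof (cases n)
    case 0
    with h1 h2 show ?thesis by simp
  next
    case (Suc k)
    have "poly (bdq n) x = poly (bdq k) x + dual.wt n * poly (dual.bdq n) x"
      unfolding Suc by (simp add: bdq_Suc)
    moreover have "0 \<le> poly (bdq k) x" "poly (bdq k) x \<le> (\<Sum>k\<le>k. dual.wt k)"
      using less[of k] Suc by auto
    moreover have "(\<Sum>k\<le>n. dual.wt k) = (\<Sum>k\<le>k. dual.wt k) + dual.wt n"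
      by (simp add: Suc)
    ultimately show ?thesis using q h1 h2 by linarith
  qed
qed

end

section \<open>The dual process and indeterminacy\<close>

context regular_birth_death
begin

text \<open>Minimality enters only through the entry \<open>(0, 0)\<close>, against the process
  built from \<open>N\<close>. That this is a process at all rests on the inverse moment of
  \<open>N\<close> being exactly \<open>green\<close>.\<close>

lemma inverse_moment_minimal:
  assumes X: "minimal_Q_process lam mu X" and corr: "corresponding_measure lam mu X \<psi>"
  shows "stieltjes_measure \<psi>" "orthogonal \<psi>" "m_neg1 \<psi> < \<infinity>" "inverse_moment \<psi> = green"
    "m_neg1 \<psi> = ennreal green"
proof -
  have Q: "Q_process lam mu X" using X by (simp add: minimal_Q_process_def)
  show st: "stieltjes_measure \<psi>" using corr by (simp add: corresponding_measure_iff)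
  show orth: "orthogonal \<psi>" by (rule orthogonal_corresponding[OF Q corr])
  obtain N where N: "stieltjes_solution \<psi> N" "m_neg1 N \<le> ennreal green"
    by (rule exists_natural_solution[OF st orth])
  have stN: "stieltjes_measure N" using N(1) by (simp add: stieltjes_solution_def)
  have orthN: "orthogonal N" by (rule orthogonal_same_moments[OF orth st N(1)])
  have finN: "m_neg1 N < \<infinity>" using N(2) by (simp add: le_less_trans)
  have "(\<integral>x. 1 / x \<partial>N) \<le> green"
    using N(2) green_pos unfolding m_neg1_finite(3)[OF stN finN] by (simp add: ennreal_le_iff)
  with green_le[OF stN orthN finN] have "Q_process lam mu (\<lambda>t i j. lap_kernel N t i j * wt j)"
    by (intro minimal_boundary_Q_process[OF stN orthN finN]) simp
  then have le: "X t 0 0 \<le> lap_kernel N t 0 0 * wt 0" if "0 \<le> t" for t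
    using X that unfolding minimal_Q_process_def by blast
  have "m_neg1 \<psi> \<le> m_neg1 N"
    unfolding m_neg1_laplace[OF st] m_neg1_laplace[OF stN]
  proof (rule nn_integral_mono)
    fix t :: real
    show "ennreal (lap \<psi> t 1) * indicator {0..} t \<le> ennreal (lap N t 1) * indicator {0..} t"
    proof (cases "0 \<le> t")
      case True
      have "X t 0 0 = lap_kernel \<psi> t 0 0 * wt 0"
        using corr True by (simp add: corresponding_measure_iff)
      with le[OF True] True show ?thesis by (simp add: lap_kernel_def ennreal_leI)
    qed simp
  qed
  then have le_green: "m_neg1 \<psi> \<le> ennreal green" using N(2) by (rule order.trans)
  then show fin: "m_neg1 \<psi> < \<infinity>" by (simp add: le_less_trans)
  have "(\<integral>x. 1 / x \<partial>\<psi>) \<le> green"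
    using le_green green_pos unfolding m_neg1_finite(3)[OF st fin] by (simp add: ennreal_le_iff)
  with green_le[OF st orth fin] show eq: "inverse_moment \<psi> = green"
    by (simp add: inverse_moment_def)
  then show "m_neg1 \<psi> = ennreal green"
    unfolding m_neg1_finite(3)[OF st fin] inverse_moment_def by simp
qed

section \<open>The measure of the dual process\<close>

context
  fixes \<psi> :: "real measure"
  assumes st: "stieltjes_measure \<psi>" and orth: "orthogonal \<psi>" and fin: "m_neg1 \<psi> < \<infinity>"
    and eq: "inverse_moment \<psi> = green"
begin

abbreviation "\<nu> \<equiv> phi a_dual \<psi>"

lemmas st_dual = stieltjes_phi[OF st fin a_dual_pos]

lemma lap_dual_times_x:
  assumes "0 \<le> t"
  shows "lap \<nu> t ([:0, 1:] * q) = mu 0 * lap \<psi> t q"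
  using lap_phi_times_x[OF st fin a_dual_pos assms, of q] unfolding eq a_dual_eq by simp

lemma lap_dual_difference:
  assumes t: "0 \<le> t"
  shows "lap \<nu> t (dual.bdq (Suc n) * p) - lap \<nu> t (dual.bdq n * p) = - (wt n * lap \<psi> t (bdq n * p))"
proof -
  have "dual.bdq (Suc n) * p = dual.bdq n * p - smult (wt n / mu 0) ([:0, 1:] * (bdq n * p))"
    unfolding dual_bdq_Suc by (simp only: left_diff_distrib mult_smult_left mult.assoc)
  then have "lap \<nu> t (dual.bdq (Suc n) * p) = lap \<nu> t (dual.bdq n * p) - wt n / mu 0 * (mu 0 * lap \<psi> t (bdq n * p))"
    by (simp only: lap_diff[OF st_dual t] lap_smult lap_dual_times_x[OF t])
  then show ?thesis using mu0_pos by simp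
qed

lemma lap_mixed:
  assumes t: "0 \<le> t"
  shows "dual.wt j * lap \<psi> t (bdq n * dual.bdq j) = lap_kernel \<psi> t n j - prev (lap_kernel \<psi> t n) j"
proof (cases j)
  case 0 then show ?thesis by (simp add: lap_kernel_def)
next
  case (Suc k)
  have "bdq n * bdq j = bdq n * bdq k + smult (dual.wt j) (bdq n * dual.bdq j)"
    unfolding Suc bdq_Suc[of k] by (simp only: distrib_left mult_smult_right)
  then show ?thesis
    unfolding Suc prev_simps lap_kernel_def by (simp only: Suc lap_add[OF st t] lap_smult add_diff_cancel_left')
qed

text \<open>The increment of \<open>dual.bdq\<close> in one index turns an integral against
  \<open>\<nu>\<close> into one against \<open>\<psi>\<close>, where orthogonality is known. This
  gives a first-order difference equation for \<open>T i j\<close> in \<open>j\<close>.\<close>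

lemma orthogonal_dual: "dual.orthogonal \<nu>"
proof -
  define T where "T i j = lap \<nu> 0 (dual.bdq j * dual.bdq i)" for i j
  have k0: "lap_kernel \<psi> 0 i j = (if i = j then 1 / wt j else 0)" for i j
    using kernel_lap[OF st orth] by (simp add: kernel_def)
  have step: "T i (Suc j) = T i j + ((if i = Suc j then 1 else 0) - (if i = j then 1 else 0)) / dual.wt i" for i j
  proof -
    have "T i (Suc j) - T i j = - (wt j * lap \<psi> 0 (bdq j * dual.bdq i))"
      unfolding T_def by (rule lap_dual_difference) simp
    moreover have "dual.wt i * lap \<psi> 0 (bdq j * dual.bdq i) = ((if i = j then 1 else 0) - (if i = Suc j then 1 else 0)) / wt j"
      unfolding lap_mixed[OF order.refl] by (cases i) (auto simp: k0)
    then have "wt j * lap \<psi> 0 (bdq j * dual.bdq i) = ((if i = j then 1 else 0) - (if i = Suc j then 1 else 0)) / dual.wt i"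
      using wt_pos[of j, THEN less_imp_neq] dual.wt_pos[of i, THEN less_imp_neq] by (simp add: field_simps)
    ultimately show ?thesis by (simp add: diff_divide_distrib)
  qed
  have sol: "T i j = T i 0 + ((if i = j then 1 else 0) - (if i = 0 then 1 else 0)) / dual.wt i" for i j
    by (induction j) (simp_all add: step diff_divide_distrib)
  have "T 0 0 = 1"
    using prob_space.prob_space[OF stieltjes_prob[OF st_dual]]
    by (simp add: T_def lap_zero[OF st_dual] poly_1[abs_def])
  \<comment> \<open>Total mass one fixes row \<open>0\<close> of the solution, and symmetry carries
    it over to the initial values in column \<open>0\<close>.\<close>
  then have "T i 0 = (if i = 0 then 1 else 0)" for i
    using sol[of 0 i] by (simp add: T_def mult.commute)
  then have "T i j = (if i = j then 1 / dual.wt j else 0)" for i j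
    using sol[of i j] by auto
  then show ?thesis
    unfolding dual.orthogonal_def T_def lap_zero[OF st_dual] by (auto simp del: poly_mult)
qed

text \<open>The dual conductance \<open>mu 0 / wt N\<close> cancels the weight in
  \<open>lap_dual_difference\<close>; the remaining integral is an increment of the original kernel
  in its second index.\<close>

lemma dual_flux:
  assumes t: "0 \<le> t"
  shows "dual.flux (dual.lap_kernel \<nu>) N j t = - (mu 0 / dual.wt j) * (lap_kernel \<psi> t N j - prev (lap_kernel \<psi> t N) j)"
proof -
  have "dual.flux (dual.lap_kernel \<nu>) N j t = mu 0 / wt N * - (wt N * lap \<psi> t (bdq N * dual.bdq j))"
    unfolding dual.flux_def dual.lap_kernel_def dual_cond lap_dual_difference[OF t] ..
  also have "\<dots> = - (mu 0 / dual.wt j) * (dual.wt j * lap \<psi> t (bdq N * dual.bdq j))"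
    using wt_pos[of N, THEN less_imp_neq] dual.wt_pos[of j, THEN less_imp_neq] by simp
  finally show ?thesis unfolding lap_mixed[OF t] .
qed

lemma dual_flux_vanishes:
  "\<exists>e. e \<longlonglongrightarrow> 0 \<and> (\<forall>N. \<forall>t\<ge>0. \<bar>dual.flux (dual.lap_kernel \<nu>) N j t\<bar> \<le> e N)"
proof -
  have dec: "\<exists>e. e \<longlonglongrightarrow> 0 \<and> (\<forall>N. \<forall>t\<ge>0. \<bar>lap_kernel \<psi> t N j\<bar> \<le> e N)" for j
    using lap_kernel_decay[OF st orth fin] eq by (simp add: inverse_moment_def)
  obtain e where e: "e \<longlonglongrightarrow> 0" "\<And>N t. 0 \<le> t \<Longrightarrow> \<bar>lap_kernel \<psi> t N j\<bar> \<le> e N"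
    using dec by blast
  obtain e' where e': "e' \<longlonglongrightarrow> 0" "\<And>N t. 0 \<le> t \<Longrightarrow> \<bar>prev (lap_kernel \<psi> t N) j\<bar> \<le> e' N"
  proof (cases j)
    case 0 then show ?thesis using that[of "\<lambda>_. 0"] by simp
  next
    case (Suc k)
    obtain e where "e \<longlonglongrightarrow> 0" "\<And>N t. 0 \<le> t \<Longrightarrow> \<bar>lap_kernel \<psi> t N k\<bar> \<le> e N"
      using dec by blast
    with Suc show ?thesis using that[of e] by simp
  qed
  have "\<bar>dual.flux (dual.lap_kernel \<nu>) N j t\<bar> \<le> mu 0 / dual.wt j * (e N + e' N)" if t: "0 \<le> t" for N t
  proof -
    have "0 \<le> mu 0 / dual.wt j" using mu0_pos by (simp add: less_imp_le)
    then have "\<bar>dual.flux (dual.lap_kernel \<nu>) N j t\<bar> = mu 0 / dual.wt j * \<bar>lap_kernel \<psi> t N j - prev (lap_kernel \<psi> t N) j\<bar>"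
      unfolding dual_flux[OF t] by (simp only: abs_mult abs_minus_cancel abs_of_nonneg)
    also have "\<dots> \<le> mu 0 / dual.wt j * (e N + e' N)"
      using e(2)[OF t, of N] e'(2)[OF t, of N] \<open>0 \<le> mu 0 / dual.wt j\<close> by (intro mult_left_mono) auto
    finally show ?thesis .
  qed
  moreover have "(\<lambda>N. mu 0 / dual.wt j * (e N + e' N)) \<longlonglongrightarrow> mu 0 / dual.wt j * (0 + 0)"
    by (intro tendsto_intros e e')
  ultimately show ?thesis by (intro exI[of _ "\<lambda>N. mu 0 / dual.wt j * (e N + e' N)"]) simp
qed

text \<open>Increments of the kernel in \<open>N\<close> are fluxes multiplied by
  \<open>wt N / mu 0\<close>, with bounded fluxes and summable weights.\<close>

lemma dual_kernel_bounded: "\<exists>B. \<forall>t\<ge>0. \<forall>N. \<bar>dual.lap_kernel \<nu> t N j\<bar> \<le> B"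
proof -
  obtain e where e: "e \<longlonglongrightarrow> 0" "\<And>N t. 0 \<le> t \<Longrightarrow> \<bar>dual.flux (dual.lap_kernel \<nu>) N j t\<bar> \<le> e N"
    using dual_flux_vanishes by blast
  obtain E where E: "\<And>N. \<bar>e N\<bar> \<le> E"
    using convergent_imp_Bseq[OF convergentI[OF e(1)]] unfolding Bseq_def by auto
  define K where "K = (\<integral>x. \<bar>poly (dual.bdq 0 * dual.bdq j) x\<bar> \<partial>\<nu>)"
  have "\<bar>dual.lap_kernel \<nu> t N j\<bar> \<le> K + E / mu 0 * (\<Sum>k<N. wt k)" if t: "0 \<le> t" for t N
  proof (induction N)
    case 0
    show ?case
      unfolding dual.lap_kernel_def K_def
      using lap_bound[OF st_dual t integrable_abs[OF stieltjes_poly[OF st_dual]]] by simp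
  next
    case (Suc N)
    have "mu 0 / wt N * (dual.lap_kernel \<nu> t (Suc N) j - dual.lap_kernel \<nu> t N j) = dual.flux (dual.lap_kernel \<nu>) N j t"
      unfolding dual.flux_def dual_cond ..
    then have "dual.lap_kernel \<nu> t (Suc N) j - dual.lap_kernel \<nu> t N j = dual.flux (dual.lap_kernel \<nu>) N j t * (wt N / mu 0)"
      using mu0_pos wt_pos[of N, THEN less_imp_neq] by (simp add: field_simps)
    also have "\<bar>dual.flux (dual.lap_kernel \<nu>) N j t * (wt N / mu 0)\<bar> \<le> E * (wt N / mu 0)"
      unfolding abs_mult using e(2)[OF t, of N] E[of N] mu0_pos by (intro mult_mono) (auto simp: less_imp_le)
    finally show ?case using Suc by (simp add: algebra_simps)
  qed
  moreover have "E / mu 0 * (\<Sum>k<N. wt k) \<le> E / mu 0 * suminf wt" for N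
    using E[of 0] mu0_pos by (intro mult_left_mono sum_le_suminf summable_wt) (auto simp: less_imp_le)
  ultimately show ?thesis by (intro exI[of _ "K + E / mu 0 * suminf wt"]) (meson add_left_mono order.trans)
qed

lemma summable_dual_wt: "summable dual.wt"
  using sums_dual_wt by (rule sums_summable)

lemma maximal_dual:
  "maximal_Q_process (dual_birth lam mu) (dual_death lam mu) (\<lambda>t i j. dual.lap_kernel \<nu> t i j * dual.wt j)"
proof -
  have k: "dual.kernel (dual.lap_kernel \<nu>)" by (rule dual.kernel_lap[OF st_dual orthogonal_dual])
  obtain B where B: "\<And>t N j. 0 \<le> t \<Longrightarrow> \<bar>dual.lap_kernel \<nu> t N j\<bar> \<le> B j"
    using dual_kernel_bounded by metis
  note Q = dual.neumann_Q_process[OF k B dual_flux_vanishes]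
  have "dual_death lam mu 0 = 0" by (simp add: dual_death_def)
  then show ?thesis
    unfolding maximal_Q_process_def
    using Q(1) dual.honest_maximal[OF summable_dual_wt k dual.kernel_nonneg[OF k Q(2)] _ dual_flux_vanishes, of B]
      abs_le_D1[OF B] by blast
qed

lemma corresponding_dual:
  "corresponding_measure (dual_birth lam mu) (dual_death lam mu) (\<lambda>t i j. dual.lap_kernel \<nu> t i j * dual.wt j) \<nu>"
  unfolding dual.corresponding_measure_iff using st_dual by simp

text \<open>The dual polynomials equal \<open>1\<close> at the origin, so the squared orthonormal
  polynomials there are the dual weights, whose sum is \<open>1 + mu 0 * scale\<close>.\<close>

lemma mass_dual: "emeasure \<nu> {0} = rho \<nu> 0" "0 < emeasure \<nu> {0}"
proof -
  define s where "s = mu 0 * scale"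
  have s: "0 < s" using mu0_pos scale_pos by (simp add: s_def)
  have e: "a_dual / (a_dual + 1) = 1 / (1 + s)"
    using s unfolding a_dual_def s_def[symmetric] by (simp add: field_simps)
  have "((-1) ^ n * sqrt (dual.wt n))\<^sup>2 = dual.wt n" for n
    by (simp add: power_mult_distrib less_imp_le flip: power_mult)
  then have "(\<Sum>n. ennreal ((poly (smult ((-1) ^ n * sqrt (dual.wt n)) (dual.bdq n)) 0)\<^sup>2)) = (\<Sum>n. ennreal (dual.wt n))"
    by (simp only: poly_smult dual_bdq_at_0 mult_1_right)
  also have "\<dots> = ennreal (1 + s)"
    unfolding s_def by (rule suminf_ennreal_eq[OF _ sums_dual_wt]) (simp add: less_imp_le)
  finally have "rho \<nu> 0 = inverse (ennreal (1 + s))"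
    unfolding rho_eq[OF st_dual dual.orthonormal_bdq[OF st_dual orthogonal_dual]] by (rule arg_cong)
  also have "\<dots> = ennreal (1 / (1 + s))"
    using s by (simp add: inverse_ennreal inverse_eq_divide del: ennreal_plus)
  finally show "emeasure \<nu> {0} = rho \<nu> 0"
    unfolding emeasure_phi_0[OF st fin a_dual_pos] e ..
  show "0 < emeasure \<nu> {0}"
    unfolding emeasure_phi_0[OF st fin a_dual_pos] using a_dual_pos by simp
qed

text \<open>All quadrature nodes of the dual polynomials lie beyond a common positive number, and a
  weak limit of such measures cannot charge the origin.\<close>

lemma dual_solution_without_atom:
  obtains N where "stieltjes_solution \<nu> N" "emeasure N {0} = 0"
proof -
  have q0: "dual.bdq 0 \<noteq> 0" by simp
  have orth': "(\<integral>x. poly (dual.bdq m * dual.bdq n) x \<partial>\<nu>) = 0" if "m \<noteq> n" for m n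
    using orthogonal_dual that by (simp add: dual.orthogonal_def)
  obtain G r N where G: "\<And>n. real_distribution (G n)"
    "\<And>n. AE x in G n. 0 < x \<and> poly (dual.bdq (r n)) x = 0" "\<And>n p. integrable (G n) (poly p)"
    "\<And>n p. degree p < 2 * r n \<Longrightarrow> (\<integral>x. poly p x \<partial>G n) = (\<integral>x. poly p x \<partial>\<nu>)"
    "\<And>n. 0 < r n" "weak_conv_m G N" "stieltjes_solution \<nu> N"
    by (rule gauss_limit[OF st_dual dual.degree_bdq q0 orth']) blast+
  define B where "B = (1 + mu 0 * scale) * suminf wt"
  have B: "0 < B"
    unfolding B_def using mu0_pos scale_pos suminf_pos[OF summable_wt wt_pos] by (simp add: add_pos_pos)
  \<comment> \<open>The largest \<open>x\<close> to which \<open>dual_bdq_bounds\<close> applies; up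
    to there the dual polynomials stay at least \<open>1 / 2\<close>.\<close>
  define d where "d = mu 0 / 2 / B"
  have d: "0 < d" using B mu0_pos by (simp add: d_def)
  have root: "d < x" if "0 < x" "poly (dual.bdq n) x = 0" for x n
  proof (rule ccontr)
    assume "\<not> d < x"
    then have "x * B \<le> mu 0 / 2" using B unfolding d_def by (simp add: not_less pos_le_divide_eq)
    with dual_bdq_bounds[of x n] that show False by (simp add: B_def)
  qed
  \<comment> \<open>A continuous bump equal to \<open>1\<close> at the origin and \<open>0\<close>
    from \<open>d\<close> on.\<close>
  define f where "f x = max 0 (min 1 (1 - x / d))" for x :: real
  have f_bd: "\<bar>f x\<bar> \<le> 1" for x by (simp add: f_def)
  have N: "stieltjes_measure N" using G(7) by (simp add: stieltjes_solution_def)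
  have rdN: "real_distribution N"
    using stieltjes_prob[OF N] stieltjes_sets[OF N] by (simp add: real_distribution_def real_distribution_axioms_def)
  interpret N: real_distribution N by (rule rdN)
  have "(\<lambda>n. integral\<^sup>L (G n) f) \<longlonglongrightarrow> integral\<^sup>L N f"
  proof (rule weak_conv_integral[OF G(6,1) rdN _ f_bd])
    show "isCont f x" for x
      unfolding f_def[abs_def] using d by (intro continuous_intros) auto
  qed
  moreover have "integral\<^sup>L (G n) f = 0" for n
  proof (rule integral_eq_zero_AE)
    show "AE x in G n. f x = 0"
      using G(2)[of n]
    proof eventually_elim
      case (elim x)
      then have "d < x" by (blast intro: root)
      then show ?case using d by (simp add: f_def)
    qed
  qed
  ultimately have z: "integral\<^sup>L N f = 0" by (simp add: LIMSEQ_const_iff)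
  have "integrable N f"
    using f_bd by (intro N.integrable_const_bound[where B = 1]) (auto simp: f_def[abs_def])
  with z have "AE x in N. f x = 0"
    by (subst (asm) integral_nonneg_eq_0_iff_AE) (auto simp: f_def)
  then have "AE x in N. \<not> x = 0" by eventually_elim (auto simp: f_def)
  then have "emeasure N {0} = 0" by (drule_tac emeasure_eq_0_AE) simp
  with G(7) show ?thesis by (rule that)
qed

text \<open>Both \<open>phi a \<psi>\<close> and \<open>\<nu>\<close> are combinations of the Dirac
  measure at \<open>0\<close> and \<open>phi0 \<psi>\<close>, so the former contains a positive
  multiple of the latter. Exchanging \<open>\<nu>\<close> for the solution \<open>N\<close> within
  that multiple preserves all moments and lowers the atom at \<open>0\<close>.\<close>

lemma indet_phi:
  assumes a: "0 < a"
  shows "indet_S (phi a \<psi>)"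
proof -
  obtain N where N: "stieltjes_solution \<nu> N" "emeasure N {0} = 0"
    by (rule dual_solution_without_atom)
  define b where "b = a_dual"
  have b: "0 < b" using a_dual_pos by (simp add: b_def)
  \<comment> \<open>The largest \<open>c\<close> for which \<open>c\<close> times
    \<open>\<nu>\<close> is dominated by \<open>phi a \<psi>\<close>: the two arguments of the
    minimum come from the components \<open>phi0 \<psi>\<close> and the Dirac measure, and
    \<open>u\<close> and \<open>v\<close> are what remains of the latter and the former.\<close>
  define c where "c = (b + 1) / (a + 1) * min 1 (a / b)"
  define u where "u = a / (a + 1) - c * (b / (b + 1))"
  define v where "v = 1 / (a + 1) - c * (1 / (b + 1))"
  have c: "0 < c" using a b by (simp add: c_def)
  have u: "0 \<le> u" "u < a / (a + 1)"
  proof -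
    have "c * (b / (b + 1)) = b / (a + 1) * min 1 (a / b)" using b by (simp add: c_def)
    also have "\<dots> \<le> b / (a + 1) * (a / b)" using a b by (intro mult_left_mono) auto
    also have "\<dots> = a / (a + 1)" using b by simp
    finally show "0 \<le> u" by (simp add: u_def)
    show "u < a / (a + 1)" using b c by (simp add: u_def)
  qed
  have v: "0 \<le> v"
  proof -
    have "c * (1 / (b + 1)) = 1 / (a + 1) * min 1 (a / b)" using b by (simp add: c_def)
    also have "\<dots> \<le> 1 / (a + 1) * 1" using a b by (intro mult_left_mono) auto
    finally show ?thesis by (simp add: v_def)
  qed
  have mf0: "moment_functional_measure (phi0 \<psi>)"
    by (intro stieltjes_moment_functional stieltjes_phi0 st fin)
  have mfN: "moment_functional_measure N"
    using N(1) by (intro stieltjes_moment_functional) (simp add: stieltjes_solution_def)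
  have stN: "stieltjes_measure N" using N(1) by (simp add: stieltjes_solution_def)
  define \<tau> where "\<tau> = mix u (return borel 0) v (phi0 \<psi>)"
  define \<sigma> where "\<sigma> = mix c N 1 \<tau>"
  have mft: "moment_functional_measure \<tau>"
    unfolding \<tau>_def by (intro moment_functional_mix moment_functional_return mf0 u v)
  have mfs: "moment_functional_measure \<sigma>"
    unfolding \<sigma>_def using c by (intro moment_functional_mix mfN mft) auto
  have int: "integrable M (poly p)" if "moment_functional_measure M" for M p
    using that by (simp add: moment_functional_measure_def)
  have tau: "(\<integral>x. poly p x \<partial>\<tau>) = u * poly p 0 + v * (\<integral>x. poly p x \<partial>phi0 \<psi>)" for p
    unfolding \<tau>_def
    by (subst integral_mix[OF sets_return sets_phi0[OF st fin] u(1) v integrable_return_borel[OF borel_measurable_poly] int[OF mf0]])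
      (simp add: integral_return)
  have sigma: "(\<integral>x. poly p x \<partial>\<sigma>) = c * (\<integral>x. poly p x \<partial>N) + (\<integral>x. poly p x \<partial>\<tau>)" for p
    unfolding \<sigma>_def
    by (subst integral_mix[OF stieltjes_sets[OF stN] _ less_imp_le[OF c] zero_le_one int[OF mfN] int[OF mft]])
      (simp_all add: \<tau>_def)
  have phi: "(\<integral>x. poly p x \<partial>phi a \<psi>) = a / (a + 1) * poly p 0 + 1 / (a + 1) * (\<integral>x. poly p x \<partial>phi0 \<psi>)"
    if "0 < a" for a p
    unfolding integral_poly_phi[OF st fin that] integral_poly_phi0[OF st fin] by (simp add: add_divide_distrib)
  have "(\<integral>x. poly p x \<partial>N) = (\<integral>x. poly p x \<partial>\<nu>)" for p
    using N(1) by (intro same_moments_poly) (auto simp: stieltjes_solution_def intro: stieltjes_power st_dual)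
  then have "(\<integral>x. poly p x \<partial>\<sigma>) = (\<integral>x. poly p x \<partial>phi a \<psi>)" for p
    unfolding sigma tau phi[OF a] by (simp add: phi[OF a_dual_pos] u_def v_def b_def algebra_simps)
  then have sol: "stieltjes_solution (phi a \<psi>) \<sigma>"
    by (intro moment_functional_solution mfs stieltjes_phi st fin a)
  have "emeasure \<sigma> {0} = ennreal u"
    using N(2) emeasure_phi0_0[OF st fin]
    by (simp add: \<sigma>_def \<tau>_def emeasure_mix stieltjes_sets[OF stN] sets_phi0[OF st fin])
  moreover have "emeasure (phi a \<psi>) {0} = ennreal (a / (a + 1))"
    by (rule emeasure_phi_0[OF st fin a])
  ultimately have "\<sigma> \<noteq> phi a \<psi>"
    using u by (auto simp: ennreal_inj)
  with sol show ?thesis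
    using stieltjes_phi[OF st fin a] by (auto simp: indet_S_def det_S_def)
qed

end

end

theorem theorem4p4:
  fixes lam mu :: "nat \<Rightarrow> real"
    and X :: "real \<Rightarrow> nat \<Rightarrow> nat \<Rightarrow> real"
    and \<psi> :: "real measure"
  assumes "rate_set lam mu"
    and "mu 0 > 0"
    and "summable (\<lambda>n. pi_coeff lam mu n + 1 / (lam n * pi_coeff lam mu n))"
    and "minimal_Q_process lam mu X"
    and "corresponding_measure lam mu X \<psi>"
  shows "ennreal (mu 0) < 1 / m_neg1 \<psi> \<and>
    (\<forall>a>0. indet_S (phi a \<psi>)) \<and>
    (let a = inverse (mu 0 * enn2real (m_neg1 \<psi>)) - 1 in
       (\<exists>Xd. maximal_Q_process (dual_birth lam mu) (dual_death lam mu) Xd \<and>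
             corresponding_measure (dual_birth lam mu) (dual_death lam mu) Xd (phi a \<psi>)) \<and>
       N_extremal (phi a \<psi>) (phi a \<psi>))"
proof -
  interpret regular_birth_death lam mu
    by standard (use assms in auto)
  note psi = inverse_moment_minimal[OF assms(4,5)]
  have a: "inverse (mu 0 * enn2real (m_neg1 \<psi>)) - 1 = a_dual"
    using a_dual_eq green_pos mu0_pos unfolding psi(5) by (simp add: field_simps)
  have "ennreal (mu 0) < ennreal (1 / green)"
    using green_less green_pos mu0_pos by (simp add: ennreal_less_iff pos_less_divide_eq)
  also have "\<dots> = 1 / m_neg1 \<psi>"
    unfolding psi(5) using green_pos by (simp flip: divide_ennreal)
  finally have 1: "ennreal (mu 0) < 1 / m_neg1 \<psi>" .
  note indet = indet_phi[OF psi(1-4)]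
  have "stieltjes_solution (phi a_dual \<psi>) (phi a_dual \<psi>)"
    using st_dual[OF psi(1-4)] by (simp add: stieltjes_solution_def same_moments_def)
  then have "N_extremal (phi a_dual \<psi>) (phi a_dual \<psi>)"
    unfolding N_extremal_def using indet[OF a_dual_pos] mass_dual[OF psi(1-4)] by blast
  with 1 indet show ?thesis
    unfolding a Let_def using maximal_dual[OF psi(1-4)] corresponding_dual[OF psi(1-4)] by blast
qed

end
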